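(* Let $\tau$ be an analytic expanding circle map and let $\tau'_{\max}=\max_{z\in\mathbb{T}}|\tau'(z)|$. Let $\delta$ be any positive real number with $$\delta>1+\tau'_{\max}.$$ Then there is $r\in(0,1)$ such that the Koopman operator $C_\tau$ is Hilbert-Schmidt on $H^2(A_r^c)$ and such that moreover the following holds. Let $\alpha\in\mathbb{R}$, and suppose that for every $n\in\mathbb{N}$ the number $m=m(n)\in\mathbb{N}$ is chosen such that $m\ge\delta n$. For $n\in\mathbb{N}$ let $M_n$ be the $(2n-1)\times(2n-1)$ EDMD matrix of $\tau$ built from the observables $\psi_l(z)=z^l$, $-(n-1)\le l\le n-1$, and the phase space points $z^{(j)}=e^{2\pi i j/m+i\alpha}$, $0\le j\le m-1$, with $m=m(n)$. Then: (a) Any convergent sequence $(\lambda_n)_{n\in\mathbb{N}}$ with $\lambda_n\in\operatorname{spec}(M_n)$ converges to a spectral point of $C_\tau$. (b) Conversely, for any $\lambda\in\operatorname{spec}(C_\tau)$ there exists a sequence $(\lambda_n)_{n\in\mathbb{N}}$ with $\lambda_n\in\operatorname{spec}(M_n)$ such that $\lambda_n\to\lambda$ as $n\to\infty$. Moreover, $|\lambda-\lambda_n|=O(e^{-an})$ as $n\to\infty$ for some $a>0$. (c) Suppose $\lambda\in\operatorname{spec}(C_\tau)$ is non-zero and $(\lambda_n)_{n\in\mathbb{N}}$ denotes the approximating sequence of eigenvalues of $M_n$ given in (b). If, for each $n$, $\xi_n=(\xi_{n,-n+1},\ldots,\xi_{n,0},\ldots,\xi_{n,n-1})^T\in\mathbb{C}^{2n-1}$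 is a generalised eigenvector of the transpose $M_n^T$ corresponding to the eigenvalue $\lambda_n$, normalised so that $\sum_{|k|<n}|\xi_{n,k}|^2r^{2|k|}=1$, then setting $h_n(z)=\sum_{|k|<n}\xi_{n,k}z^k$ yields a sequence of Laurent polynomials with $$\|\mathcal{P}h_n-h_n\|_{H^2(A_r^c)}=O(e^{-bn})\quad\text{as }n\to\infty$$ for some $b>0$, where $\mathcal{P}$ is the spectral projection associated to the eigenvalue $\lambda$ of $C_\tau$.
   Context: $\mathbb{T}=\{z\in\mathbb{C}:|z|=1\}$ and, for $r\in(0,1)$, $A_r=\{z\in\mathbb{C}: r<|z|<r^{-1}\}$. An analytic expanding circle map is a map $\tau:\mathbb{T}\to\mathbb{T}$ which has an analytic extension to some annulus $A_r$, $r\in(0,1)$, and satisfies $\min_{z\in\mathbb{T}}|\tau'(z)|>1$. EDMD matrix: given observables $\psi_{-n+1},\dots,\psi_{n-1}$ and points $z^{(0)},\dots,z^{(m-1)}$, put, for $k,l\in\{-n+1,\dots,n-1\}$, $$G_{k,l}=\frac1m\sum_{j=0}^{m-1}\psi_k(\tau(z^{(j)}))\overline{\psi_l(z^{(j)})},\qquad H_{k,l}=\frac1m\sum_{j=0}^{m-1}\psi_k(z^{(j)})\overline{\psi_l(z^{(j)})},$$ and $M_n=GH^{-1}$. For $f\in L^2(\mathbb{T})$ let $c_n(f)=\frac1{2\pi}\int_0^{2\pi}f(e^{it})e^{-int}\,dt$. For $r\in(0,1)$, $H^2(A_r^c)$ is the Hilbert space completion of the space of Laurent polynomials with respect to the norm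 $\|f\|_{H^2(A_r^c)}=\sqrt{\sum_{n\in\mathbb{Z}}|c_n(f)|^2r^{2|n|}}$; it contains $L^2(\mathbb{T})$. The Koopman operator $C_\tau$ is defined on Laurent polynomials $f$ by $C_\tau f=f\circ\tau$ (viewed as a function on $\mathbb{T}$, hence an element of $L^2(\mathbb{T})\subset H^2(A_r^c)$) and on all of $H^2(A_r^c)$ by continuous extension. A generalised eigenvector of a matrix $A$ for an eigenvalue $\mu$ is a non-zero vector in $\ker((\mu I-A)^\nu)$ for some $\nu\in\mathbb{N}$. The spectral projection associated to a non-zero eigenvalue $\lambda$ of a compact operator $T$ is the Riesz projection $\frac1{2\pi i}\int_\gamma(\zeta I-T)^{-1}d\zeta$, with $\gamma$ a small circle around $\lambda$ enclosing no other spectral point. *)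

theory Defs
  imports
    "HOL-Complex_Analysis.Complex_Analysis"
    "HOL-Library.Landau_Symbols"
    "Jordan_Normal_Form.Spectral_Radius"
    "Jordan_Normal_Form.Gauss_Jordan_Elimination"
begin

section \<open>Analytic expanding circle maps\<close>

definition annulus :: "real \<Rightarrow> complex set" where
  "annulus r = {z. r < cmod z \<and> cmod z < inverse r}"

text \<open>
  A circle map is a function on \<^typ>\<open>complex\<close> of which only the values on the unit circle matter.
  Its complex derivative at a point of the circle is the limit of difference quotients taken
  along the circle; it coincides there with the derivative of any holomorphic extension.
\<close>

definition circle_deriv :: "(complex \<Rightarrow> complex) \<Rightarrow> complex \<Rightarrow> complex" where
  "circle_deriv \<tau> z = (THE D. (\<tau> has_field_derivative D) (at z within sphere 0 1))"

definition min_expansion :: "(complex \<Rightarrow> complex) \<Rightarrow> real" where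
  "min_expansion \<tau> = (INF z\<in>sphere 0 1. cmod (circle_deriv \<tau> z))"

definition max_expansion :: "(complex \<Rightarrow> complex) \<Rightarrow> real" where
  "max_expansion \<tau> = (SUP z\<in>sphere 0 1. cmod (circle_deriv \<tau> z))"

definition analytic_expanding_circle_map :: "(complex \<Rightarrow> complex) \<Rightarrow> bool" where
  "analytic_expanding_circle_map \<tau> \<longleftrightarrow>
     \<tau> ` sphere 0 1 \<subseteq> sphere 0 1 \<and>
     (\<exists>r g. 0 < r \<and> r < 1 \<and> g holomorphic_on annulus r \<and> (\<forall>z\<in>sphere 0 1. g z = \<tau> z)) \<and>
     min_expansion \<tau> > 1"


section \<open>The space \<open>H\<^sup>2(A\<^sub>r\<^sup>c)\<close>\<close>

definition fourier_coeff :: "(complex \<Rightarrow> complex) \<Rightarrow> int \<Rightarrow> complex" where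
  "fourier_coeff f n =
     1 / (2 * of_real pi) * integral {0..2 * pi} (\<lambda>t. f (cis t) * cis (- (of_int n * t)))"

definition laurent_polynomials :: "(complex \<Rightarrow> complex) set" where
  "laurent_polynomials = {p. \<exists>N a. p = (\<lambda>z. \<Sum>k\<in>{-int N..int N}. a k * z powi k)}"

text \<open>
  The completion of the Laurent polynomials is realised concretely: an element is given by its
  sequence of Fourier coefficients, and a function \<open>f\<close> on the circle is embedded as
  \<open>fourier_coeff f\<close>. That this is a Hilbert space completion is shown
  below (\<open>fourier_coeff_laurent_in_H2\<close>, \<open>laurent_dense_H2\<close>, \<open>H2_complete\<close>).
\<close>

definition H2 :: "real \<Rightarrow> (int \<Rightarrow> complex) set" where
  "H2 r = {c. (\<lambda>n. (cmod (c n))\<^sup>2 * r ^ (2 * nat \<bar>n\<bar>)) summable_on UNIV}"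

definition H2_norm :: "real \<Rightarrow> (int \<Rightarrow> complex) \<Rightarrow> real" where
  "H2_norm r c = sqrt (\<Sum>\<^sub>\<infinity>n. (cmod (c n))\<^sup>2 * r ^ (2 * nat \<bar>n\<bar>))"

definition H2_inner :: "real \<Rightarrow> (int \<Rightarrow> complex) \<Rightarrow> (int \<Rightarrow> complex) \<Rightarrow> complex" where
  "H2_inner r c d = (\<Sum>\<^sub>\<infinity>n. c n * cnj (d n) * of_real (r ^ (2 * nat \<bar>n\<bar>)))"


section \<open>Operators on \<open>H\<^sup>2(A\<^sub>r\<^sup>c)\<close>\<close>

text \<open>
  An operator is a function on sequences of which only the restriction to \<^term>\<open>H2 r\<close> matters.
\<close>

definition H2_bounded_operator ::
    "real \<Rightarrow> ((int \<Rightarrow> complex) \<Rightarrow> (int \<Rightarrow> complex)) \<Rightarrow> bool" where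
  "H2_bounded_operator r T \<longleftrightarrow>
     (\<forall>f\<in>H2 r. T f \<in> H2 r) \<and>
     (\<forall>f\<in>H2 r. \<forall>g\<in>H2 r. T (\<lambda>n. f n + g n) = (\<lambda>n. T f n + T g n)) \<and>
     (\<forall>c. \<forall>f\<in>H2 r. T (\<lambda>n. c * f n) = (\<lambda>n. c * T f n)) \<and>
     (\<exists>B. \<forall>f\<in>H2 r. H2_norm r (T f) \<le> B * H2_norm r f)"

definition H2_spectrum ::
    "real \<Rightarrow> ((int \<Rightarrow> complex) \<Rightarrow> (int \<Rightarrow> complex)) \<Rightarrow> complex set" where
  "H2_spectrum r T =
     {\<zeta>. \<not> (\<exists>S. H2_bounded_operator r S \<and>
               (\<forall>f\<in>H2 r. S (\<lambda>n. \<zeta> * f n - T f n) = f) \<and>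
               (\<forall>f\<in>H2 r. (\<lambda>n. \<zeta> * S f n - T (S f) n) = f))}"

definition H2_resolvent ::
    "real \<Rightarrow> ((int \<Rightarrow> complex) \<Rightarrow> (int \<Rightarrow> complex)) \<Rightarrow> complex \<Rightarrow> (int \<Rightarrow> complex) \<Rightarrow> (int \<Rightarrow> complex)" where
  "H2_resolvent r T \<zeta> f = (THE g. g \<in> H2 r \<and> (\<lambda>n. \<zeta> * g n - T g n) = f)"

text \<open>
  The operator-valued contour integral is evaluated coefficientwise; this is legitimate because it
  converges in operator norm and taking the \<open>n\<close>-th coefficient is a continuous linear functional.
\<close>

definition riesz_projection ::
    "real \<Rightarrow> ((int \<Rightarrow> complex) \<Rightarrow> (int \<Rightarrow> complex)) \<Rightarrow> complex \<Rightarrow> (int \<Rightarrow> complex) \<Rightarrow> (int \<Rightarrow> complex)" where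
  "riesz_projection r T lam f =
     (let \<epsilon> = (SOME \<epsilon>. \<epsilon> > 0 \<and> H2_spectrum r T \<inter> cball lam \<epsilon> = {lam})
      in (\<lambda>n. 1 / (2 * of_real pi * \<i>) *
              contour_integral (circlepath lam \<epsilon>) (\<lambda>\<zeta>. H2_resolvent r T \<zeta> f n)))"

definition H2_orthonormal_basis :: "real \<Rightarrow> (int \<Rightarrow> complex) set \<Rightarrow> bool" where
  "H2_orthonormal_basis r E \<longleftrightarrow>
     E \<subseteq> H2 r \<and>
     (\<forall>e\<in>E. \<forall>e'\<in>E. H2_inner r e e' = (if e = e' then 1 else 0)) \<and>
     (\<forall>f\<in>H2 r. (\<forall>e\<in>E. H2_inner r f e = 0) \<longrightarrow> f = (\<lambda>_. 0))"

definition H2_hilbert_schmidt ::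
    "real \<Rightarrow> ((int \<Rightarrow> complex) \<Rightarrow> (int \<Rightarrow> complex)) \<Rightarrow> bool" where
  "H2_hilbert_schmidt r T \<longleftrightarrow>
     H2_bounded_operator r T \<and>
     (\<exists>E. H2_orthonormal_basis r E \<and> (\<lambda>e. (H2_norm r (T e))\<^sup>2) summable_on E)"

text \<open>
  \<open>C\<close> is the Koopman operator of \<open>\<tau>\<close>: the continuous extension to \<^term>\<open>H2 r\<close> of composition with
  \<open>\<tau>\<close> on Laurent polynomials. Such a \<open>C\<close> is unique on \<^term>\<open>H2 r\<close> (\<open>koopman_operator_unique\<close>).
\<close>

definition is_koopman_operator ::
    "(complex \<Rightarrow> complex) \<Rightarrow> real \<Rightarrow> ((int \<Rightarrow> complex) \<Rightarrow> (int \<Rightarrow> complex)) \<Rightarrow> bool" where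
  "is_koopman_operator \<tau> r C \<longleftrightarrow>
     H2_bounded_operator r C \<and>
     (\<forall>p\<in>laurent_polynomials. C (fourier_coeff p) = fourier_coeff (p \<circ> \<tau>))"


section \<open>EDMD matrices\<close>

text \<open>
  The observables carry indices in \<open>{-n+1..n-1}\<close>, matrix rows and columns positions in
  \<open>{0..<2*n-1}\<close>; position \<open>i\<close> stands for the index \<open>centred n i\<close>. Only \<open>n \<ge> 1\<close> is meaningful.
\<close>

definition centred :: "nat \<Rightarrow> nat \<Rightarrow> int" where
  "centred n i = int i - int n + 1"

definition edmd_G ::
    "(complex \<Rightarrow> complex) \<Rightarrow> (int \<Rightarrow> complex \<Rightarrow> complex) \<Rightarrow> nat \<Rightarrow> (nat \<Rightarrow> complex) \<Rightarrow> nat \<Rightarrow> complex mat" where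
  "edmd_G \<tau> \<psi> m z n = Matrix.mat (2 * n - 1) (2 * n - 1) (\<lambda>(i, j).
     1 / of_nat m * (\<Sum>s<m. \<psi> (centred n i) (\<tau> (z s)) * cnj (\<psi> (centred n j) (z s))))"

definition edmd_H ::
    "(int \<Rightarrow> complex \<Rightarrow> complex) \<Rightarrow> nat \<Rightarrow> (nat \<Rightarrow> complex) \<Rightarrow> nat \<Rightarrow> complex mat" where
  "edmd_H \<psi> m z n = Matrix.mat (2 * n - 1) (2 * n - 1) (\<lambda>(i, j).
     1 / of_nat m * (\<Sum>s<m. \<psi> (centred n i) (z s) * cnj (\<psi> (centred n j) (z s))))"

definition edmd_matrix ::
    "(complex \<Rightarrow> complex) \<Rightarrow> (int \<Rightarrow> complex \<Rightarrow> complex) \<Rightarrow> nat \<Rightarrow> (nat \<Rightarrow> complex) \<Rightarrow> nat \<Rightarrow> complex mat" where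
  "edmd_matrix \<tau> \<psi> m z n = edmd_G \<tau> \<psi> m z n * the (mat_inverse (edmd_H \<psi> m z n))"

definition circle_points :: "real \<Rightarrow> nat \<Rightarrow> nat \<Rightarrow> complex" where
  "circle_points \<alpha> m j =
     exp (2 * of_real pi * \<i> * of_nat j / of_nat m + \<i> * of_real \<alpha>)"

definition circle_edmd :: "(complex \<Rightarrow> complex) \<Rightarrow> real \<Rightarrow> nat \<Rightarrow> nat \<Rightarrow> complex mat" where
  "circle_edmd \<tau> \<alpha> m n = edmd_matrix \<tau> (\<lambda>l z. z powi l) m (circle_points \<alpha> m) n"

definition generalised_eigenvector :: "complex mat \<Rightarrow> complex \<Rightarrow> complex Matrix.vec \<Rightarrow> bool" where
  "generalised_eigenvector A \<mu> v \<longleftrightarrow>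
     v \<in> carrier_vec (dim_row A) \<and> v \<noteq> 0\<^sub>v (dim_row A) \<and>
     (\<exists>\<nu>::nat. ((\<mu> \<cdot>\<^sub>m 1\<^sub>m (dim_row A) - A) ^\<^sub>m \<nu>) *\<^sub>v v = 0\<^sub>v (dim_row A))"

text \<open>The entry \<open>\<xi>\<^sub>k\<close>, \<open>\<bar>k\<bar> < n\<close>, of a vector \<open>\<xi>\<close> of dimension \<open>2 * n - 1\<close>.\<close>

definition centred_entry :: "nat \<Rightarrow> complex Matrix.vec \<Rightarrow> int \<Rightarrow> complex" where
  "centred_entry n \<xi> k = Matrix.vec_index \<xi> (nat (k + int n - 1))"

definition laurent_of_vec :: "nat \<Rightarrow> complex Matrix.vec \<Rightarrow> complex \<Rightarrow> complex" where
  "laurent_of_vec n \<xi> z = (\<Sum>k | \<bar>k\<bar> < int n. centred_entry n \<xi> k * z powi k)"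


section \<open>\<open>H2\<close> is the Hilbert space completion of the Laurent polynomials\<close>

lemma H2_weight_sum:
  "(\<Sum>n\<in>F. (cmod (c n))\<^sup>2 * r ^ (2 * nat \<bar>n\<bar>)) = (L2_set (\<lambda>n. cmod (c n) * r ^ nat \<bar>n\<bar>) F)\<^sup>2"
proof -
  have "(cmod (c n))\<^sup>2 * r ^ (2 * nat \<bar>n\<bar>) = (cmod (c n) * r ^ nat \<bar>n\<bar>)\<^sup>2" for n
    unfolding power_even_eq power_mult_distrib ..
  then show ?thesis
    unfolding L2_set_def by (simp only: real_sqrt_pow2[OF sum_nonneg[OF zero_le_power2]])
qed

lemma L2_set_le_H2_norm:
  assumes "c \<in> H2 r" "finite F" "0 < r"
  shows "L2_set (\<lambda>n. cmod (c n) * r ^ nat \<bar>n\<bar>) F \<le> H2_norm r c"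
proof -
  have "(\<Sum>n\<in>F. (cmod (c n))\<^sup>2 * r ^ (2 * nat \<bar>n\<bar>)) \<le> (\<Sum>\<^sub>\<infinity>n. (cmod (c n))\<^sup>2 * r ^ (2 * nat \<bar>n\<bar>))"
    using assms by (intro finite_sum_le_infsum) (auto simp: H2_def)
  then show ?thesis
    unfolding H2_norm_def H2_weight_sum by (rule real_le_rsqrt)
qed

lemma H2_I:
  assumes "0 < r" "0 \<le> B" "\<And>F. finite F \<Longrightarrow> L2_set (\<lambda>n. cmod (c n) * r ^ nat \<bar>n\<bar>) F \<le> B"
  shows "c \<in> H2 r" "H2_norm r c \<le> B"
proof -
  have le: "(\<Sum>n\<in>F. (cmod (c n))\<^sup>2 * r ^ (2 * nat \<bar>n\<bar>)) \<le> B\<^sup>2" if "finite F" for F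
    unfolding H2_weight_sum using assms(3)[OF that] by (intro power_mono) auto
  show "c \<in> H2 r"
    unfolding H2_def using le assms(1)
    by (auto intro!: nonneg_bdd_above_summable_on bdd_aboveI[of _ "B\<^sup>2"])
  then have "(\<Sum>\<^sub>\<infinity>n. (cmod (c n))\<^sup>2 * r ^ (2 * nat \<bar>n\<bar>)) \<le> B\<^sup>2"
    using le by (intro infsum_le_finite_sums) (auto simp: H2_def)
  then show "H2_norm r c \<le> B"
    unfolding H2_norm_def using assms(2) by (intro real_le_lsqrt) auto
qed

lemma H2_norm_nonneg: "0 < r \<Longrightarrow> 0 \<le> H2_norm r c"
  unfolding H2_norm_def by (auto intro!: infsum_nonneg)

lemma H2_add:
  assumes r: "0 < r" and f: "f \<in> H2 r" and g: "g \<in> H2 r"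
  shows "(\<lambda>n. f n + g n) \<in> H2 r"
    "H2_norm r (\<lambda>n. f n + g n) \<le> H2_norm r f + H2_norm r g"
proof -
  have "L2_set (\<lambda>n. cmod (f n + g n) * r ^ nat \<bar>n\<bar>) F \<le> H2_norm r f + H2_norm r g"
    if "finite F" for F
  proof -
    have "L2_set (\<lambda>n. cmod (f n + g n) * r ^ nat \<bar>n\<bar>) F
        \<le> L2_set (\<lambda>n. cmod (f n) * r ^ nat \<bar>n\<bar> + cmod (g n) * r ^ nat \<bar>n\<bar>) F"
      using r by (intro L2_set_mono)
        (auto simp flip: distrib_right intro!: mult_right_mono norm_triangle_ineq)
    also have "\<dots> \<le> H2_norm r f + H2_norm r g"
      by (rule order_trans[OF L2_set_triangle_ineq])
        (intro add_mono L2_set_le_H2_norm f g that r)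
    finally show ?thesis .
  qed
  from H2_I[OF r _ this] show "(\<lambda>n. f n + g n) \<in> H2 r"
    "H2_norm r (\<lambda>n. f n + g n) \<le> H2_norm r f + H2_norm r g"
    using H2_norm_nonneg[OF r] by auto
qed

lemma H2_uminus: "f \<in> H2 r \<Longrightarrow> (\<lambda>n. - f n) \<in> H2 r" "H2_norm r (\<lambda>n. - f n) = H2_norm r f"
  by (auto simp: H2_def H2_norm_def)

lemma H2_diff:
  assumes r: "0 < r" and f: "f \<in> H2 r" and g: "g \<in> H2 r"
  shows "(\<lambda>n. f n - g n) \<in> H2 r"
    "H2_norm r (\<lambda>n. f n - g n) \<le> H2_norm r f + H2_norm r g"
  using H2_add[OF r f H2_uminus(1)[OF g]] H2_uminus(2)[of r g] by auto

lemma H2_coeff_le: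
  assumes "c \<in> H2 r" "0 < r"
  shows "cmod (c n) * r ^ nat \<bar>n\<bar> \<le> H2_norm r c"
  using L2_set_le_H2_norm[OF assms(1) _ assms(2), of "{n}"] assms(2) by (simp add: L2_set_def)

lemma H2_complete:
  assumes r: "0 < r" and f: "\<And>k. f k \<in> H2 r"
    and cauchy: "\<And>e. 0 < e \<Longrightarrow> \<exists>N::nat. \<forall>k\<ge>N. \<forall>l\<ge>N. H2_norm r (\<lambda>n. f k n - f l n) < e"
  shows "\<exists>g\<in>H2 r. (\<lambda>k. H2_norm r (\<lambda>n. f k n - g n)) \<longlonglongrightarrow> 0"
proof -
  have C: "Cauchy (\<lambda>k. f k n)" for n
  proof (rule metric_CauchyI)
    fix e :: real assume "0 < e"
    then obtain N where N: "\<forall>k\<ge>N. \<forall>l\<ge>N. H2_norm r (\<lambda>n. f k n - f l n) < e * r ^ nat \<bar>n\<bar>"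
      using cauchy[of "e * r ^ nat \<bar>n\<bar>"] r by auto
    have "cmod (f k n - f l n) < e" if "k \<ge> N" "l \<ge> N" for k l
    proof -
      have "cmod (f k n - f l n) * r ^ nat \<bar>n\<bar> < e * r ^ nat \<bar>n\<bar>"
        using H2_coeff_le[OF H2_diff(1)[OF r f f] r] N that by (meson le_less_trans)
      then show ?thesis using r by simp
    qed
    then show "\<exists>N. \<forall>k\<ge>N. \<forall>l\<ge>N. dist (f k n) (f l n) < e"
      by (auto simp: dist_norm)
  qed
  define g where "g n = lim (\<lambda>k. f k n)" for n
  have g: "(\<lambda>k. f k n) \<longlonglongrightarrow> g n" for n
    unfolding g_def using Cauchy_convergent[OF C] by (simp only: convergent_LIMSEQ_iff)
  have close: "\<exists>N. \<forall>k\<ge>N. (\<lambda>n. f k n - g n) \<in> H2 r \<and> H2_norm r (\<lambda>n. f k n - g n) \<le> e"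
    if e: "0 < e" for e
  proof -
    obtain N where N: "\<forall>k\<ge>N. \<forall>l\<ge>N. H2_norm r (\<lambda>n. f k n - f l n) < e"
      using cauchy[OF e] by auto
    have "L2_set (\<lambda>n. cmod (f k n - g n) * r ^ nat \<bar>n\<bar>) F \<le> e" if k: "k \<ge> N" and F: "finite F" for k F
    proof (rule LIMSEQ_le_const2)
      show "(\<lambda>l. L2_set (\<lambda>n. cmod (f k n - f l n) * r ^ nat \<bar>n\<bar>) F)
              \<longlonglongrightarrow> L2_set (\<lambda>n. cmod (f k n - g n) * r ^ nat \<bar>n\<bar>) F"
        unfolding L2_set_def by (intro tendsto_intros g)
      show "\<exists>M. \<forall>l\<ge>M. L2_set (\<lambda>n. cmod (f k n - f l n) * r ^ nat \<bar>n\<bar>) F \<le> e"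
        using L2_set_le_H2_norm[OF H2_diff(1)[OF r f f] F r] N k
        by (meson less_imp_le order_trans)
    qed
    note bound = this
    show ?thesis
    proof (intro exI[of _ N] allI impI conjI)
      fix k assume k: "N \<le> k"
      show "(\<lambda>n. f k n - g n) \<in> H2 r"
        by (rule H2_I(1)[OF r less_imp_le[OF e] bound[OF k]])
      show "H2_norm r (\<lambda>n. f k n - g n) \<le> e"
        by (rule H2_I(2)[OF r less_imp_le[OF e] bound[OF k]])
    qed
  qed
  obtain N where N: "(\<lambda>n. f N n - g n) \<in> H2 r"
    using close[of 1] by auto
  have "g \<in> H2 r"
    using H2_diff(1)[OF r f[of N] N] by simp
  moreover have "(\<lambda>k. H2_norm r (\<lambda>n. f k n - g n)) \<longlonglongrightarrow> 0"
  proof (rule LIMSEQ_I)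
    fix e :: real assume "0 < e"
    then obtain N where "\<forall>k\<ge>N. H2_norm r (\<lambda>n. f k n - g n) \<le> e / 2"
      using close[of "e / 2"] by auto
    then have "\<forall>k\<ge>N. norm (H2_norm r (\<lambda>n. f k n - g n) - 0) < e"
      using \<open>0 < e\<close> H2_norm_nonneg[OF r] by fastforce
    then show "\<exists>N. \<forall>k\<ge>N. norm (H2_norm r (\<lambda>n. f k n - g n) - 0) < e" ..
  qed
  ultimately show ?thesis by blast
qed

lemma has_integral_cis_int:
  "((\<lambda>t. cis (of_int m * t)) has_integral (if m = 0 then 2 * of_real pi else 0)) {0..2 * pi}"
proof (cases "m = 0")
  case True
  then show ?thesis
    using has_integral_const_real[of "1::complex" 0 "2 * pi"] by (simp add: scaleR_conv_of_real)
next
  case False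
  have "((\<lambda>t. cis (of_int m * t)) has_integral
      (cis (of_int m * (2 * pi)) / (\<i> * of_int m) - cis (of_int m * 0) / (\<i> * of_int m))) {0..2 * pi}"
  proof (rule fundamental_theorem_of_calculus)
    show "((\<lambda>t. cis (of_int m * t) / (\<i> * of_int m)) has_vector_derivative cis (of_int m * t))
        (at t within {0..2 * pi})" for t
    proof -
      have "((\<lambda>z. exp (\<i> * of_int m * z) / (\<i> * of_int m)) has_field_derivative
          exp (\<i> * of_int m * of_real t)) (at (of_real t))"
        using False by (auto intro!: derivative_eq_intros)
      from has_vector_derivative_real_field[OF this] show ?thesis
        by (simp add: cis_conv_exp mult.assoc)
    qed
  qed auto
  moreover have "cis (of_int m * (2 * pi)) = 1"
    using cis_multiple_2pi[of "of_int m"] by (simp add: mult.commute mult.left_commute)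
  ultimately show ?thesis using False by simp
qed

lemma fourier_coeff_laurent:
  assumes "finite K"
  shows "fourier_coeff (\<lambda>z. \<Sum>k\<in>K. a k * z powi k) n = (if n \<in> K then a n else 0)"
proof -
  have "((\<lambda>t. \<Sum>k\<in>K. a k * cis (of_int (k - n) * t)) has_integral
      (\<Sum>k\<in>K. a k * (if k - n = 0 then 2 * of_real pi else 0))) {0..2 * pi}"
    by (intro has_integral_sum assms has_integral_mult_right has_integral_cis_int)
  moreover have "(\<Sum>k\<in>K. a k * cis (of_int (k - n) * t))
      = (\<Sum>k\<in>K. a k * cis t powi k) * cis (- (of_int n * t))" for t
    unfolding sum_distrib_right
    by (intro sum.cong refl) (simp add: cis_power_int cis_mult algebra_simps)
  moreover have "(\<Sum>k\<in>K. a k * (if k - n = 0 then 2 * of_real pi else 0))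
      = (if n \<in> K then a n * (2 * of_real pi) else 0)"
    using assms by (simp add: if_distrib[of "\<lambda>x. _ * x"] cong: if_cong)
  ultimately show ?thesis
    unfolding fourier_coeff_def by (auto dest: integral_unique)
qed

lemma fourier_coeff_laurent_in_H2:
  assumes "p \<in> laurent_polynomials"
  shows "fourier_coeff p \<in> H2 r"
proof -
  obtain N a where p: "p = (\<lambda>z. \<Sum>k\<in>{-int N..int N}. a k * z powi k)"
    using assms by (auto simp: laurent_polynomials_def)
  have "(\<lambda>n. (cmod (fourier_coeff p n))\<^sup>2 * r ^ (2 * nat \<bar>n\<bar>)) summable_on {-int N..int N}"
    by simp
  then show ?thesis
    unfolding H2_def mem_Collect_eq
    by (rule summable_on_cong_neutral[THEN iffD1, rotated -1])
       (auto simp: p fourier_coeff_laurent)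
qed

lemma laurent_dense_H2:
  assumes r: "0 < r" and f: "f \<in> H2 r" and e: "0 < e"
  shows "\<exists>p\<in>laurent_polynomials. H2_norm r (\<lambda>n. f n - fourier_coeff p n) < e"
proof -
  let ?w = "\<lambda>n. (cmod (f n))\<^sup>2 * r ^ (2 * nat \<bar>n\<bar>)"
  have sm: "?w summable_on UNIV" using f by (simp add: H2_def)
  obtain F where F: "finite F" "dist (sum ?w F) (infsum ?w UNIV) \<le> e\<^sup>2 / 4"
    using infsum_finite_approximation[OF sm, of "e\<^sup>2 / 4"] e by auto
  obtain N where N: "F \<subseteq> {-int N..int N}"
  proof -
    define N where "N = (\<Sum>k\<in>F. nat \<bar>k\<bar>)"
    have "nat \<bar>k\<bar> \<le> N" if "k \<in> F" for k
      unfolding N_def using member_le_sum[of k F "\<lambda>k. nat \<bar>k\<bar>"] F(1) that by auto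
    then have "F \<subseteq> {-int N..int N}" by fastforce
    then show ?thesis using that by blast
  qed
  define K where "K = {-int N..int N}"
  define p where "p = (\<lambda>z. \<Sum>k\<in>K. f k * z powi k)"
  have "p \<in> laurent_polynomials" by (auto simp: p_def K_def laurent_polynomials_def)
  have coeff: "fourier_coeff p n = (if n \<in> K then f n else 0)" for n
    unfolding p_def by (rule fourier_coeff_laurent) (simp add: K_def)
  have le: "H2_norm r (\<lambda>n. f n - fourier_coeff p n) \<le> e / 2"
  proof (rule H2_I(2)[OF r])
    fix A :: "int set" assume A: "finite A"
    have 1: "(L2_set (\<lambda>n. cmod (f n - fourier_coeff p n) * r ^ nat \<bar>n\<bar>) A)\<^sup>2 = sum ?w (A - K)"
      unfolding H2_weight_sum[symmetric] coeff
      by (rule sum.mono_neutral_cong_right) (use A in auto)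
    have 2: "sum ?w (A - K) \<le> sum ?w (A - F)"
      by (rule sum_mono2) (use N A r in \<open>auto simp: K_def\<close>)
    have "(A \<union> F) - F = A - F" by blast
    then have 3: "sum ?w (A - F) = sum ?w (A \<union> F) - sum ?w F"
      using sum_diff[of "A \<union> F" F ?w] A F(1) by simp
    have 4: "sum ?w (A \<union> F) \<le> infsum ?w UNIV"
      by (rule finite_sum_le_infsum[OF sm]) (use A F(1) r in auto)
    have 5: "infsum ?w UNIV - sum ?w F \<le> e\<^sup>2 / 4"
      using abs_le_D2[OF F(2)[unfolded dist_real_def]] by simp
    have 6: "(e / 2)\<^sup>2 = e\<^sup>2 / 4"
      by (simp add: power_divide)
    have "(L2_set (\<lambda>n. cmod (f n - fourier_coeff p n) * r ^ nat \<bar>n\<bar>) A)\<^sup>2 \<le> (e / 2)\<^sup>2"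
      using 2 3 4 5 unfolding 1 6 by linarith
    then show "L2_set (\<lambda>n. cmod (f n - fourier_coeff p n) * r ^ nat \<bar>n\<bar>) A \<le> e / 2"
      by (rule power2_le_imp_le) (use e in simp)
  qed (use e in auto)
  then show ?thesis
    by (intro bexI[of _ p] order.strict_trans1[OF le] \<open>p \<in> laurent_polynomials\<close>) (use e in simp)
qed

lemma koopman_operator_unique:
  assumes r: "0 < r" and C: "is_koopman_operator \<tau> r C" and D: "is_koopman_operator \<tau> r D"
    and f: "f \<in> H2 r"
  shows "C f = D f"
proof -
  have diff: "T (\<lambda>n. g n - h n) = (\<lambda>n. T g n - T h n)"
    if "H2_bounded_operator r T" "g \<in> H2 r" "h \<in> H2 r" for T g h
  proof -
    have "T (\<lambda>n. -1 * h n) = (\<lambda>n. -1 * T h n)"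
      using that unfolding H2_bounded_operator_def by blast
    moreover have "\<forall>f\<in>H2 r. \<forall>g\<in>H2 r. T (\<lambda>n. f n + g n) = (\<lambda>n. T f n + T g n)"
      using that(1) by (simp add: H2_bounded_operator_def)
    from bspec[OF bspec[OF this that(2)] H2_uminus(1)[OF that(3)]]
    have "T (\<lambda>n. g n + - h n) = (\<lambda>n. T g n + T (\<lambda>n. - h n) n)" .
    ultimately show ?thesis by simp
  qed
  have CD: "H2_bounded_operator r C" "H2_bounded_operator r D"
    using C D by (auto simp: is_koopman_operator_def)
  obtain B1 B2 where B1: "\<And>f. f \<in> H2 r \<Longrightarrow> H2_norm r (C f) \<le> B1 * H2_norm r f"
    and B2: "\<And>f. f \<in> H2 r \<Longrightarrow> H2_norm r (D f) \<le> B2 * H2_norm r f"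
    using CD[THEN H2_bounded_operator_def[THEN iffD1], THEN conjunct2, THEN conjunct2, THEN conjunct2]
    by blast
  define B where "B = \<bar>B1\<bar> + \<bar>B2\<bar> + 1"
  have "C f n = D f n" for n
  proof (rule ccontr)
    assume "C f n \<noteq> D f n"
    define e where "e = cmod (C f n - D f n) * r ^ nat \<bar>n\<bar> / B"
    have B: "B > 0" by (simp add: B_def)
    have "e > 0" using \<open>C f n \<noteq> D f n\<close> r B by (simp add: e_def)
    then obtain p where p: "p \<in> laurent_polynomials"
      and lt: "H2_norm r (\<lambda>n. f n - fourier_coeff p n) < e"
      using laurent_dense_H2[OF r f] by blast
    define h where "h = (\<lambda>n. f n - fourier_coeff p n)"
    have h: "h \<in> H2 r"
      unfolding h_def by (rule H2_diff(1)[OF r f fourier_coeff_laurent_in_H2[OF p]])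
    have same: "C (fourier_coeff p) = D (fourier_coeff p)"
      using C D p by (auto simp: is_koopman_operator_def)
    have "C f n - D f n = C h n - D h n"
      unfolding h_def using diff[OF CD(1) f fourier_coeff_laurent_in_H2[OF p]]
        diff[OF CD(2) f fourier_coeff_laurent_in_H2[OF p]] same by simp
    then have "cmod (C f n - D f n) * r ^ nat \<bar>n\<bar> = cmod (C h n - D h n) * r ^ nat \<bar>n\<bar>"
      by simp
    also have "\<dots> \<le> H2_norm r (\<lambda>n. C h n - D h n)"
      using CD h by (intro H2_coeff_le H2_diff r) (auto simp: H2_bounded_operator_def)
    also have "\<dots> \<le> H2_norm r (C h) + H2_norm r (D h)"
      using CD h by (intro H2_diff r) (auto simp: H2_bounded_operator_def)
    also have "\<dots> \<le> (B1 + B2) * H2_norm r h"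
      using B1[OF h] B2[OF h] by (simp add: algebra_simps)
    also have "\<dots> \<le> B * H2_norm r h"
      by (intro mult_right_mono H2_norm_nonneg r) (simp add: B_def)
    also have "\<dots> < B * e"
      using lt B by (simp add: h_def)
    finally show False using B by (simp add: e_def)
  qed
  then show ?thesis by blast
qed

end

theory Submission
  imports Defs
begin

text \<open>
  Near the circle \<open>ln \<bar>\<tau>(z)\<bar>\<close> is \<open>\<plusminus>\<kappa> ln \<bar>z\<bar>\<close> with \<open>\<kappa>\<close> slightly outside the range of \<open>\<bar>\<tau>'\<bar>\<close>. Shifting contours, the
  matrix of \<open>C\<^sub>\<tau>\<close> in the weighted basis has entries bounded by \<open>c s\<^bsup>\<bar>l\<bar>+\<bar>k\<bar>\<^esup>\<close> with \<open>s < 1\<close>. The nodes being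
  equidistant, \<open>H\<close> is the identity, and \<open>M\<^sub>n\<^sup>T\<close> differs from the section of that matrix by the error of
  the trapezoidal rule, of order \<open>exp (- \<Omega> n)\<close> because \<open>\<delta> > 1 + \<tau>'\<^sub>m\<^sub>a\<^sub>x\<close>; this beats the weights if
  \<open>r\<close> is close to \<open>1\<close>.

  The determinants \<open>det (1 - w M\<^sub>n)\<close> therefore converge exponentially fast to an entire function of \<open>w\<close>
  (Leibniz' formula bounds them by the product of the row sums). Where it does not vanish, Cramer's rule
  bounds the inverses of \<open>1 - w M\<^sub>n\<close> uniformly in \<open>n\<close>, so \<open>1 / w\<close> is not in the spectrum of \<open>C\<^sub>\<tau>\<close>. Hence a
  non-zero spectral point is isolated, it comes from a zero of finite order, and the maximum principle
  yields zeros of \<open>det (1 - w M\<^sub>n)\<close> exponentially close to it. For (c) the resolvents of \<open>C\<^sub>\<tau>\<close> and \<open>M\<^sub>n\<^sup>T\<close>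
  applied to \<open>h\<^sub>n\<close> are compared on a small circle.
\<close>

section \<open>Sequences and kernels with exponential decay\<close>

text \<open>The sections are in general neither normal nor compressions of the operator: aliasing
  perturbs their entries, and in the weighted basis an error in column k is magnified by r^(-|k|).
  This is where \<delta> enters. On the circle of radius exp x the integrand z^(-l) \<tau>(z)^k is
  at most exp(x (1 + \<kappa>2) n) for |l|, |k| < n, with \<kappa>2 slightly above the largest
  expansion, while m \<ge> \<delta> n nodes gain exp(-x \<delta> n). The surplus is positive, and
  -ln r is chosen so small that the weights consume at most half of it. On the other hand -ln r must
  lie strictly between x' and \<kappa>1 x' for some radius exp x', where \<kappa>1 > 1 is below the
  smallest expansion; only then do the weighted entries decay in both indices at once.

  The parameter w = 1/z keeps all but finitely many diagonal entries of 1 - w A close to 1,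
  uniformly in the dimension, so that the determinants have a limit. The price is that the spectral
  point 0 is invisible to them: it is found through the smallness of the operator on z^n, and
  approximated through the size of the product of all eigenvalues of a section.\<close>

lemma summable_power_nat_abs:
  fixes s :: real
  assumes "0 \<le> s" "s < 1"
  shows "(\<lambda>k::int. s ^ nat \<bar>k\<bar>) summable_on UNIV"
proof -
  have g: "(\<lambda>n::nat. s ^ n) summable_on UNIV"
    using assms by (subst summable_on_UNIV_nonneg_real_iff) auto
  have "(\<lambda>k::int. s ^ nat \<bar>k\<bar>) summable_on range int"
    using g by (subst summable_on_reindex) (auto simp: o_def)
  moreover have "(\<lambda>k::int. s ^ nat \<bar>k\<bar>) summable_on range (\<lambda>n. - int n)"
    using g by (subst summable_on_reindex) (auto simp: o_def inj_on_def)
  ultimately have "(\<lambda>k::int. s ^ nat \<bar>k\<bar>) summable_on (range int \<union> range (\<lambda>n. - int n))"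
    by (rule summable_on_union)
  moreover have "range int \<union> range (\<lambda>n. - int n) = UNIV"
    by (auto simp: image_iff) (metis int_cases2)
  ultimately show ?thesis by simp
qed

definition geo_sum :: "real \<Rightarrow> real" where
  "geo_sum s = (\<Sum>\<^sub>\<infinity>k::int. s ^ nat \<bar>k\<bar>)"

lemma sum_power_nat_abs_le:
  assumes "0 \<le> s" "s < 1" "finite F"
  shows "(\<Sum>k\<in>F. s ^ nat \<bar>k\<bar>) \<le> geo_sum s"
  unfolding geo_sum_def using assms
  by (intro finite_sum_le_infsum summable_power_nat_abs) auto

lemma geo_sum_ge_1:
  assumes "0 \<le> s" "s < 1"
  shows "1 \<le> geo_sum s"
  using sum_power_nat_abs_le[OF assms, of "{0}"] by simp

text \<open>In the orthonormal basis of normalised monomials z^k / r^|k| the operator has the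
  entries K l k r^|l| / r^|k|; the condition bounds these by c s^(|l| + |k|). The weight of the
  column is moved to the right-hand side to avoid a division.\<close>

definition kernel_bound :: "real \<Rightarrow> real \<Rightarrow> real \<Rightarrow> (int \<Rightarrow> int \<Rightarrow> complex) \<Rightarrow> bool" where
  "kernel_bound r s c K \<longleftrightarrow>
     (\<forall>l k. cmod (K l k) * r ^ nat \<bar>l\<bar> \<le> c * s ^ nat \<bar>l\<bar> * (s ^ nat \<bar>k\<bar> * r ^ nat \<bar>k\<bar>))"

definition kernel_operator ::
    "(int \<Rightarrow> int \<Rightarrow> complex) \<Rightarrow> (int \<Rightarrow> complex) \<Rightarrow> int \<Rightarrow> complex" where
  "kernel_operator K f l = (\<Sum>\<^sub>\<infinity>k. K l k * f k)"

text \<open>The l^2 norm of the weighted coefficients is dominated by their l^1 norm. This is how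
  coefficientwise estimates are turned into norm estimates throughout.\<close>

lemma H2_I_decay:
  assumes "0 < r" "0 \<le> s" "s < 1" "0 \<le> b" and le: "\<And>l. cmod (g l) * r ^ nat \<bar>l\<bar> \<le> b * s ^ nat \<bar>l\<bar>"
  shows "g \<in> H2 r" "H2_norm r g \<le> b * geo_sum s"
proof -
  have B: "0 \<le> b * geo_sum s"
    using geo_sum_ge_1[OF assms(2,3)] assms(4) by auto
  have *: "L2_set (\<lambda>n. cmod (g n) * r ^ nat \<bar>n\<bar>) F \<le> b * geo_sum s" if "finite F" for F
  proof -
    have "L2_set (\<lambda>n. cmod (g n) * r ^ nat \<bar>n\<bar>) F \<le> (\<Sum>n\<in>F. cmod (g n) * r ^ nat \<bar>n\<bar>)"
      using assms(1) by (intro L2_set_le_sum) auto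
    also have "\<dots> \<le> (\<Sum>n\<in>F. b * s ^ nat \<bar>n\<bar>)"
      by (intro sum_mono le)
    also have "\<dots> \<le> b * geo_sum s"
      unfolding sum_distrib_left[symmetric]
      by (intro mult_left_mono sum_power_nat_abs_le assms that)
    finally show ?thesis .
  qed
  show "g \<in> H2 r" "H2_norm r g \<le> b * geo_sum s"
    using H2_I[OF assms(1) B *] by auto
qed

text \<open>The factor s^|k| makes the series converge even if \<open>f\<close> is merely bounded in
  the weighted supremum norm, and the factor s^|l| survives as decay of the image. Cramer's rule
  yields exactly such supremum bounds, so one more application of the kernel recovers a norm
  bound.\<close>

lemma kernel_operator_bounded_seq:
  assumes "0 < r" "0 < s" "s < 1" "0 \<le> c" and K: "kernel_bound r s c K"
    and f: "\<And>k. cmod (f k) * r ^ nat \<bar>k\<bar> \<le> b"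
  shows "(\<lambda>k. K l k * f k) summable_on UNIV"
    and "cmod (kernel_operator K f l) * r ^ nat \<bar>l\<bar> \<le> c * geo_sum s * b * s ^ nat \<bar>l\<bar>"
proof -
  let ?D = "c * s ^ nat \<bar>l\<bar> * b"
  have le: "norm (K l k * f k) * r ^ nat \<bar>l\<bar> \<le> ?D * s ^ nat \<bar>k\<bar>" for k
  proof -
    have "norm (K l k * f k) * r ^ nat \<bar>l\<bar> = (cmod (K l k) * r ^ nat \<bar>l\<bar>) * cmod (f k)"
      by (simp add: norm_mult)
    also have "\<dots> \<le> (c * s ^ nat \<bar>l\<bar> * (s ^ nat \<bar>k\<bar> * r ^ nat \<bar>k\<bar>)) * cmod (f k)"
      using K unfolding kernel_bound_def by (intro mult_right_mono) auto
    also have "\<dots> = (c * s ^ nat \<bar>l\<bar> * s ^ nat \<bar>k\<bar>) * (cmod (f k) * r ^ nat \<bar>k\<bar>)"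
      by simp
    also have "\<dots> \<le> (c * s ^ nat \<bar>l\<bar> * s ^ nat \<bar>k\<bar>) * b"
      using assms by (intro mult_left_mono f) auto
    finally show ?thesis by (simp add: mult_ac)
  qed
  have le': "norm (K l k * f k) \<le> ?D / r ^ nat \<bar>l\<bar> * s ^ nat \<bar>k\<bar>" for k
    using le[of k] assms(1) by (simp add: field_simps)
  have sm: "(\<lambda>k. ?D / r ^ nat \<bar>l\<bar> * s ^ nat \<bar>k\<bar>) summable_on (UNIV :: int set)"
    using assms by (intro summable_on_cmult_right summable_power_nat_abs) auto
  have abs: "(\<lambda>k. norm (K l k * f k)) summable_on UNIV"
    by (rule summable_on_comparison_test[OF sm]) (use le' in auto)
  then show "(\<lambda>k. K l k * f k) summable_on UNIV" by (rule abs_summable_summable)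
  have "cmod (kernel_operator K f l) \<le> (\<Sum>\<^sub>\<infinity>k. norm (K l k * f k))"
    unfolding kernel_operator_def by (rule norm_infsum_bound[OF abs])
  also have "\<dots> \<le> (\<Sum>\<^sub>\<infinity>k. ?D / r ^ nat \<bar>l\<bar> * s ^ nat \<bar>k\<bar>)"
    by (rule infsum_mono[OF abs sm]) (rule le')
  also have "\<dots> = ?D / r ^ nat \<bar>l\<bar> * geo_sum s"
    unfolding geo_sum_def by (rule infsum_cmult_right')
  finally show "cmod (kernel_operator K f l) * r ^ nat \<bar>l\<bar> \<le> c * geo_sum s * b * s ^ nat \<bar>l\<bar>"
    using assms(1) by (simp add: field_simps)
qed

lemma kernel_operator_H2:
  assumes "0 < r" "0 < s" "s < 1" "0 \<le> c" and K: "kernel_bound r s c K" and f: "f \<in> H2 r"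
  shows "(\<lambda>k. K l k * f k) summable_on UNIV"
    and "cmod (kernel_operator K f l) * r ^ nat \<bar>l\<bar> \<le> c * geo_sum s * H2_norm r f * s ^ nat \<bar>l\<bar>"
    and "kernel_operator K f \<in> H2 r"
    and "H2_norm r (kernel_operator K f) \<le> c * geo_sum s ^ 2 * H2_norm r f"
proof -
  note b = kernel_operator_bounded_seq[OF assms(1-5) H2_coeff_le[OF f assms(1)]]
  show "(\<lambda>k. K l k * f k) summable_on UNIV" by (rule b(1))
  show "cmod (kernel_operator K f l) * r ^ nat \<bar>l\<bar> \<le> c * geo_sum s * H2_norm r f * s ^ nat \<bar>l\<bar>"
    by (rule b(2))
  have "0 \<le> c * geo_sum s * H2_norm r f"
    using geo_sum_ge_1[of s] H2_norm_nonneg[OF assms(1), of f] assms by auto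
  from H2_I_decay[OF assms(1) less_imp_le[OF assms(2)] assms(3) this b(2)]
  show "kernel_operator K f \<in> H2 r" "H2_norm r (kernel_operator K f) \<le> c * geo_sum s ^ 2 * H2_norm r f"
    by (auto simp: power2_eq_square mult_ac)
qed

lemma kernel_operator_add:
  assumes "(\<lambda>k. K l k * f k) summable_on UNIV" "(\<lambda>k. K l k * g k) summable_on UNIV"
  shows "kernel_operator K (\<lambda>k. f k + g k) l = kernel_operator K f l + kernel_operator K g l"
  unfolding kernel_operator_def distrib_left
  by (intro infsum_add assms)

lemma kernel_operator_scale:
  "kernel_operator K (\<lambda>k. a * f k) l = a * kernel_operator K f l"
proof -
  have "kernel_operator K (\<lambda>k. a * f k) l = (\<Sum>\<^sub>\<infinity>k. a * (K l k * f k))"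
    unfolding kernel_operator_def by (simp add: mult_ac)
  also have "\<dots> = a * kernel_operator K f l"
    unfolding kernel_operator_def by (rule infsum_cmult_right')
  finally show ?thesis .
qed

lemma kernel_operator_kernel_diff:
  assumes "(\<lambda>k. K l k * f k) summable_on UNIV" "(\<lambda>k. L l k * f k) summable_on UNIV"
  shows "kernel_operator (\<lambda>l k. K l k - L l k) f l = kernel_operator K f l - kernel_operator L f l"
proof -
  have "(\<lambda>k. - (L l k * f k)) summable_on UNIV" using assms(2) by (simp add: summable_on_uminus)
  then have "(\<Sum>\<^sub>\<infinity>k. K l k * f k + - (L l k * f k)) = (\<Sum>\<^sub>\<infinity>k. K l k * f k) + (\<Sum>\<^sub>\<infinity>k. - (L l k * f k))"
    by (intro infsum_add assms)
  then show ?thesis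
    unfolding kernel_operator_def by (simp add: left_diff_distrib infsum_uminus)
qed

lemma kernel_operator_finite:
  assumes "finite F" "\<And>k. k \<notin> F \<Longrightarrow> K l k * f k = 0"
  shows "kernel_operator K f l = (\<Sum>k\<in>F. K l k * f k)"
proof -
  have "kernel_operator K f l = infsum (\<lambda>k. K l k * f k) F"
    unfolding kernel_operator_def using assms by (intro infsum_cong_neutral) auto
  then show ?thesis using assms by simp
qed

lemma kernel_operator_H2_bounded:
  assumes "0 < r" "0 < s" "s < 1" "0 \<le> c" and K: "kernel_bound r s c K"
  shows "H2_bounded_operator r (kernel_operator K)"
  unfolding H2_bounded_operator_def
  using kernel_operator_H2[OF assms] kernel_operator_scale[of K]
  by (auto intro!: kernel_operator_add exI[of _ "c * geo_sum s ^ 2"])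

lemma H2_scale:
  assumes "0 < r" "f \<in> H2 r"
  shows "(\<lambda>n. a * f n) \<in> H2 r" "H2_norm r (\<lambda>n. a * f n) = cmod a * H2_norm r f"
proof -
  have eq: "(cmod (a * f n))\<^sup>2 * r ^ (2 * nat \<bar>n\<bar>) = (cmod a)\<^sup>2 * ((cmod (f n))\<^sup>2 * r ^ (2 * nat \<bar>n\<bar>))" for n
    by (simp add: norm_mult power_mult_distrib)
  show "(\<lambda>n. a * f n) \<in> H2 r"
    using assms(2) unfolding H2_def eq mem_Collect_eq by (intro summable_on_cmult_right)
  show "H2_norm r (\<lambda>n. a * f n) = cmod a * H2_norm r f"
    unfolding H2_norm_def eq infsum_cmult_right' by (simp add: real_sqrt_mult)
qed

lemma H2_zero: "(\<lambda>_. 0) \<in> H2 r" "H2_norm r (\<lambda>_. 0) = 0"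
  by (auto simp: H2_def H2_norm_def)

lemma H2_norm_eq_0:
  assumes "0 < r" "f \<in> H2 r" "H2_norm r f \<le> 0"
  shows "f = (\<lambda>_. 0)"
proof
  fix n
  have "cmod (f n) * r ^ nat \<bar>n\<bar> \<le> 0" using H2_coeff_le[OF assms(2,1), of n] assms(3) by linarith
  then show "f n = 0" using assms(1) zero_less_power[OF assms(1), of "nat \<bar>n\<bar>"] by (auto simp: mult_le_0_iff)
qed

lemma H2_I_finite:
  assumes "finite F" "\<And>k. k \<notin> F \<Longrightarrow> f k = 0"
  shows "f \<in> H2 r" "H2_norm r f = sqrt (\<Sum>k\<in>F. (cmod (f k))\<^sup>2 * r ^ (2 * nat \<bar>k\<bar>))"
proof -
  have "(\<lambda>n. (cmod (f n))\<^sup>2 * r ^ (2 * nat \<bar>n\<bar>)) summable_on F" using assms(1) by simp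
  then show "f \<in> H2 r"
    unfolding H2_def mem_Collect_eq
    by (rule summable_on_cong_neutral[THEN iffD1, rotated -1]) (use assms in auto)
  have "(\<Sum>\<^sub>\<infinity>n. (cmod (f n))\<^sup>2 * r ^ (2 * nat \<bar>n\<bar>)) = infsum (\<lambda>n. (cmod (f n))\<^sup>2 * r ^ (2 * nat \<bar>n\<bar>)) F"
    using assms by (intro infsum_cong_neutral) auto
  then show "H2_norm r f = sqrt (\<Sum>k\<in>F. (cmod (f k))\<^sup>2 * r ^ (2 * nat \<bar>k\<bar>))"
    unfolding H2_norm_def using assms(1) by simp
qed

lemma kernel_operator_hilbert_schmidt:
  assumes "0 < r" "0 < s" "s < 1" "0 \<le> c" and K: "kernel_bound r s c K"
  shows "H2_hilbert_schmidt r (kernel_operator K)"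
proof -
  \<comment> \<open>The normalised monomials; their images are the columns of the kernel, whose
    norms decay like s^|k|.\<close>
  define e where "e k = (\<lambda>n::int. if n = k then complex_of_real (1 / r ^ nat \<bar>k\<bar>) else 0)" for k
  have eH2: "e k \<in> H2 r" for k
    by (rule H2_I_finite[of "{k}"]) (auto simp: e_def)
  have enorm: "H2_norm r (e k) = 1" for k
    using assms(1) by (subst H2_I_finite(2)[of "{k}"])
      (auto simp: e_def norm_divide norm_power power_divide power_mult [symmetric] mult.commute)
  have inj: "inj e"
  proof (rule injI)
    fix j k assume "e j = e k"
    from fun_cong[OF this, of j] show "j = k" using assms(1) by (auto simp: e_def split: if_splits)
  qed
  have inner: "H2_inner r f (e k) = f k * of_real (r ^ nat \<bar>k\<bar>)" for f k
  proof -
    have "H2_inner r f (e k) = infsum (\<lambda>n. f n * cnj (e k n) * of_real (r ^ (2 * nat \<bar>n\<bar>))) {k}"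
      unfolding H2_inner_def by (intro infsum_cong_neutral) (auto simp: e_def)
    also have "\<dots> = f k * of_real (r ^ nat \<bar>k\<bar>)"
      using assms(1) by (simp add: e_def mult_2 power_add)
    finally show ?thesis .
  qed
  have "H2_orthonormal_basis r (range e)"
    unfolding H2_orthonormal_basis_def
  proof (intro conjI ballI impI)
    show "range e \<subseteq> H2 r" using eH2 by auto
  next
    fix u v assume "u \<in> range e" "v \<in> range e"
    then obtain j k where uv: "u = e j" "v = e k" by auto
    have "(u = v) = (j = k)" using inj uv by (auto dest: injD)
    then show "H2_inner r u v = (if u = v then 1 else 0)"
      using assms(1) unfolding uv inner by (auto simp: e_def)
  next
    fix f assume "f \<in> H2 r" "\<forall>u\<in>range e. H2_inner r f u = 0"
    then show "f = (\<lambda>_. 0)" using assms(1) by (auto simp: inner)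
  qed
  moreover have "(\<lambda>u. (H2_norm r (kernel_operator K u))\<^sup>2) summable_on range e"
  proof -
    have le: "(H2_norm r (kernel_operator K (e k)))\<^sup>2 \<le> (c * geo_sum s)\<^sup>2 * s ^ nat \<bar>k\<bar>" for k
    proof -
      have b: "cmod (kernel_operator K (e k) l) * r ^ nat \<bar>l\<bar> \<le> (c * s ^ nat \<bar>k\<bar>) * s ^ nat \<bar>l\<bar>" for l
      proof -
        have "kernel_operator K (e k) l = K l k * e k k"
          by (subst kernel_operator_finite[of "{k}"]) (auto simp: e_def)
        then have "cmod (kernel_operator K (e k) l) * r ^ nat \<bar>l\<bar> = (cmod (K l k) * r ^ nat \<bar>l\<bar>) / r ^ nat \<bar>k\<bar>"
          using assms(1) by (simp add: e_def norm_mult norm_divide norm_power)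
        also have "\<dots> \<le> (c * s ^ nat \<bar>l\<bar> * (s ^ nat \<bar>k\<bar> * r ^ nat \<bar>k\<bar>)) / r ^ nat \<bar>k\<bar>"
          using K assms(1) unfolding kernel_bound_def by (intro divide_right_mono) auto
        finally show ?thesis using assms(1) by (simp add: mult_ac)
      qed
      have "H2_norm r (kernel_operator K (e k)) \<le> c * s ^ nat \<bar>k\<bar> * geo_sum s"
        using assms by (intro H2_I_decay(2)[OF _ _ _ _ b]) auto
      then have "(H2_norm r (kernel_operator K (e k)))\<^sup>2 \<le> (c * s ^ nat \<bar>k\<bar> * geo_sum s)\<^sup>2"
        using H2_norm_nonneg[OF assms(1)] by (intro power_mono) auto
      also have "\<dots> = (c * geo_sum s)\<^sup>2 * (s ^ nat \<bar>k\<bar> * s ^ nat \<bar>k\<bar>)"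
        by (simp add: power2_eq_square mult_ac)
      also have "\<dots> \<le> (c * geo_sum s)\<^sup>2 * (s ^ nat \<bar>k\<bar> * 1)"
        using assms by (intro mult_left_mono) (auto intro!: power_le_one)
      finally show ?thesis by simp
    qed
    have "(\<lambda>k. (H2_norm r (kernel_operator K (e k)))\<^sup>2) summable_on UNIV"
      by (rule summable_on_comparison_test[of "\<lambda>k. (c * geo_sum s)\<^sup>2 * s ^ nat \<bar>k\<bar>"])
         (use assms le in \<open>auto intro!: summable_on_cmult_right summable_power_nat_abs\<close>)
    then show ?thesis
      by (subst summable_on_reindex[OF inj]) (simp add: o_def)
  qed
  ultimately show ?thesis
    unfolding H2_hilbert_schmidt_def using kernel_operator_H2_bounded[OF assms] by blast
qed

section \<open>Determinants of matrices with exponentially decaying entries\<close>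

text \<open>The factors are exchanged one at a time. The error is measured relative to \<beta> i, so
  that every exchange leaves the full product of the bounds behind.\<close>

lemma norm_prod_diff_le:
  fixes a b :: "'i \<Rightarrow> complex"
  assumes "finite I" "0 \<le> e"
    and "\<And>i. i \<in> I \<Longrightarrow> norm (a i) \<le> \<beta> i" "\<And>i. i \<in> I \<Longrightarrow> norm (b i) \<le> \<beta> i"
    and "\<And>i. i \<in> I \<Longrightarrow> norm (a i - b i) \<le> e * \<beta> i"
  shows "norm (prod a I - prod b I) \<le> real (card I) * e * prod \<beta> I"
  using assms
proof (induction I rule: finite_induct)
  case (insert x F)
  have \<beta>: "0 \<le> \<beta> i" if "i \<in> insert x F" for i
    using insert.prems(2)[OF that] norm_ge_zero order_trans by blast
  have IH: "norm (prod a F - prod b F) \<le> real (card F) * e * prod \<beta> F"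
    by (rule insert.IH) (use insert.prems in auto)
  have b: "norm (prod b F) \<le> prod \<beta> F"
    unfolding prod_norm[symmetric] by (rule prod_mono) (use insert.prems in auto)
  have "prod a (insert x F) - prod b (insert x F) = a x * (prod a F - prod b F) + (a x - b x) * prod b F"
    using insert.hyps by (simp add: algebra_simps)
  then have "norm (prod a (insert x F) - prod b (insert x F))
      \<le> norm (a x) * norm (prod a F - prod b F) + norm (a x - b x) * norm (prod b F)"
    by (metis norm_mult norm_triangle_ineq)
  also have "\<dots> \<le> \<beta> x * (real (card F) * e * prod \<beta> F) + e * \<beta> x * prod \<beta> F"
    using insert.prems IH b \<beta> by (intro add_mono mult_mono) auto
  also have "\<dots> = real (card (insert x F)) * e * prod \<beta> (insert x F)"
    using insert.hyps by (simp add: algebra_simps)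
  finally show ?case .
qed simp

text \<open>Multiplying out the product of the row sums gives one non-negative term for every map of
  the index set to itself, and the permutations are among these maps.\<close>

lemma sum_permutes_prod_le:
  fixes \<beta> :: "nat \<Rightarrow> nat \<Rightarrow> real"
  assumes "\<And>i j. i < n \<Longrightarrow> j < n \<Longrightarrow> 0 \<le> \<beta> i j"
  shows "(\<Sum>p | p permutes {0..<n}. \<Prod>i=0..<n. \<beta> i (p i)) \<le> (\<Prod>i=0..<n. \<Sum>j=0..<n. \<beta> i j)"
proof -
  \<comment> \<open>Permutations are the identity off the index set, extensional functions are
    \<open>undefined\<close> there; restriction passes from one convention to the other.\<close>
  let ?P = "{p. p permutes {0..<n}}" and ?R = "\<lambda>p. restrict p {0..<n}"
  have inj: "inj_on ?R ?P"
  proof (rule inj_onI)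
    fix p q assume *: "p \<in> ?P" "q \<in> ?P" "?R p = ?R q"
    show "p = q"
    proof
      fix x show "p x = q x"
      proof (cases "x \<in> {0..<n}")
        case True
        then show ?thesis using fun_cong[OF *(3), of x] by (simp only: restrict_apply')
      qed (use * in \<open>simp add: permutes_not_in\<close>)
    qed
  qed
  have "(\<Sum>p\<in>?P. \<Prod>i=0..<n. \<beta> i (p i)) = (\<Sum>q\<in>?R ` ?P. \<Prod>i=0..<n. \<beta> i (q i))"
    by (subst sum.reindex[OF inj]) auto
  also have "\<dots> \<le> (\<Sum>q\<in>{0..<n} \<rightarrow>\<^sub>E {0..<n}. \<Prod>i=0..<n. \<beta> i (q i))"
  proof (rule sum_mono2)
    have "p i \<in> {0..<n}" if "p \<in> ?P" "i \<in> {0..<n}" for p i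
      using that permutes_in_image[of p "{0..<n}" i] by simp
    then show "?R ` ?P \<subseteq> {0..<n} \<rightarrow>\<^sub>E {0..<n}"
      unfolding image_subset_iff restrict_PiE_iff by blast
    fix q assume "q \<in> ({0..<n} \<rightarrow>\<^sub>E {0..<n}) - ?R ` ?P"
    then have q: "q i \<in> {0..<n}" if "i \<in> {0..<n}" for i
      using that by (blast dest: PiE_mem)
    show "0 \<le> (\<Prod>i=0..<n. \<beta> i (q i))"
      by (intro prod_nonneg ballI assms) (use q in \<open>simp_all\<close>)
  qed (rule finite_PiE, simp_all)
  also have "\<dots> = (\<Prod>i=0..<n. \<Sum>j=0..<n. \<beta> i j)"
    by (rule prod_sum_PiE[symmetric]) auto
  finally show ?thesis .
qed

text \<open>The bound is a product over rows. For a perturbation of the identity with summable rows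
  it stays bounded as the dimension grows.\<close>

lemma norm_det_le:
  fixes A :: "complex mat"
  assumes A: "A \<in> carrier_mat n n"
    and le: "\<And>i j. i < n \<Longrightarrow> j < n \<Longrightarrow> norm (A $$ (i,j)) \<le> \<beta> i j"
  shows "norm (Determinant.det A) \<le> (\<Prod>i=0..<n. \<Sum>j=0..<n. \<beta> i j)"
proof -
  have \<beta>: "0 \<le> \<beta> i j" if "i < n" "j < n" for i j
    using le[OF that] norm_ge_zero order_trans by blast
  have "norm (Determinant.det A) \<le> (\<Sum>p | p permutes {0..<n}. \<Prod>i=0..<n. \<beta> i (p i))"
    unfolding Determinant.det_def'[OF A]
  proof (rule sum_norm_le)
    fix p assume "p \<in> {p. p permutes {0..<n}}"
    then have p: "p i < n" if "i < n" for i using that permutes_in_image by fastforce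
    have "norm (of_int (sign p) * (\<Prod>i=0..<n. A $$ (i, p i))) = (\<Prod>i=0..<n. norm (A $$ (i, p i)))"
      by (simp add: norm_mult prod_norm sign_def)
    also have "\<dots> \<le> (\<Prod>i=0..<n. \<beta> i (p i))"
      by (rule prod_mono) (auto intro!: le p)
    finally show "norm (of_int (sign p) * (\<Prod>i=0..<n. A $$ (i, p i))) \<le> (\<Prod>i=0..<n. \<beta> i (p i))" .
  qed
  also note sum_permutes_prod_le[OF \<beta>]
  finally show ?thesis by auto
qed

text \<open>Leibniz' formula is compared term by term. The dimension appears only as a linear
  factor, harmless once e is exponentially small.\<close>

lemma norm_det_diff_le:
  fixes A B :: "complex mat"
  assumes A: "A \<in> carrier_mat n n" and B: "B \<in> carrier_mat n n" and e: "0 \<le> e"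
    and leA: "\<And>i j. i < n \<Longrightarrow> j < n \<Longrightarrow> norm (A $$ (i,j)) \<le> \<beta> i j"
    and leB: "\<And>i j. i < n \<Longrightarrow> j < n \<Longrightarrow> norm (B $$ (i,j)) \<le> \<beta> i j"
    and diff: "\<And>i j. i < n \<Longrightarrow> j < n \<Longrightarrow> norm (A $$ (i,j) - B $$ (i,j)) \<le> e * \<beta> i j"
  shows "norm (Determinant.det A - Determinant.det B) \<le> real n * e * (\<Prod>i=0..<n. \<Sum>j=0..<n. \<beta> i j)"
proof -
  have \<beta>: "0 \<le> \<beta> i j" if "i < n" "j < n" for i j
    using leA[OF that] norm_ge_zero order_trans by blast
  have "norm (Determinant.det A - Determinant.det B)
      \<le> (\<Sum>p | p permutes {0..<n}. real n * e * (\<Prod>i=0..<n. \<beta> i (p i)))"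
    unfolding Determinant.det_def'[OF A] Determinant.det_def'[OF B] sum_subtractf[symmetric]
  proof (rule sum_norm_le)
    fix p assume "p \<in> {p. p permutes {0..<n}}"
    then have p: "p i < n" if "i < n" for i using that permutes_in_image by fastforce
    have "norm (of_int (sign p) * (\<Prod>i=0..<n. A $$ (i, p i)) - of_int (sign p) * (\<Prod>i=0..<n. B $$ (i, p i)))
        = norm ((\<Prod>i=0..<n. A $$ (i, p i)) - (\<Prod>i=0..<n. B $$ (i, p i)))"
      by (auto simp: norm_minus_commute sign_def)
    also have "\<dots> \<le> real (card {0..<n}) * e * (\<Prod>i=0..<n. \<beta> i (p i))"
      by (rule norm_prod_diff_le) (auto intro!: leA leB diff p e)
    finally show "norm (of_int (sign p) * (\<Prod>i=0..<n. A $$ (i, p i)) - of_int (sign p) * (\<Prod>i=0..<n. B $$ (i, p i)))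
        \<le> real n * e * (\<Prod>i=0..<n. \<beta> i (p i))" by simp
  qed
  also have "\<dots> = real n * e * (\<Sum>p | p permutes {0..<n}. \<Prod>i=0..<n. \<beta> i (p i))"
    by (rule sum_distrib_left[symmetric])
  also have "\<dots> \<le> real n * e * (\<Prod>i=0..<n. \<Sum>j=0..<n. \<beta> i j)"
    by (intro mult_left_mono sum_permutes_prod_le \<beta>) (use e in auto)
  finally show ?thesis .
qed

section \<open>Matrices indexed by the symmetric range |k| < n\<close>

lemma centred_bij: "bij_betw (centred n) {0..<2 * n - 1} {k. \<bar>k\<bar> < int n}"
  by (rule bij_betw_byWitness[where f' = "\<lambda>k. nat (k + int n - 1)"])
     (auto simp: centred_def abs_less_iff)

lemma abs_centred: "i < 2 * n - 1 \<Longrightarrow> \<bar>centred n i\<bar> < int n"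
  using bij_betwE[OF centred_bij] by auto

lemma centred_eq_iff: "centred n i = centred n j \<longleftrightarrow> i = j"
  by (auto simp: centred_def)

lemma sum_centred: "(\<Sum>j=0..<2 * n - 1. f (centred n j)) = (\<Sum>k | \<bar>k\<bar> < int n. f k)"
  by (rule sum.reindex_bij_betw[OF centred_bij])

lemma finite_abs_less: "finite {k::int. \<bar>k\<bar> < int n}"
  using bij_betw_finite[OF centred_bij[of n]] by simp

lemma sum_power_centred_le:
  assumes "0 \<le> s" "s < 1"
  shows "(\<Sum>j=0..<2 * n - 1. s ^ nat \<bar>centred n j\<bar>) \<le> geo_sum s"
  unfolding sum_centred[of "\<lambda>k. s ^ nat \<bar>k\<bar>" n]
  by (rule sum_power_nat_abs_le[OF assms finite_abs_less])

text \<open>By 1 + t \<le> exp t the excesses of the rows add up in the exponent, where they form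
  part of a convergent geometric sum; hence the bound is independent of n.\<close>

lemma prod_rows_le_exp:
  assumes s: "0 \<le> s" "s < 1" and V: "0 \<le> V"
    and \<beta>: "\<And>i. i < 2 * n - 1 \<Longrightarrow> 0 \<le> \<rho> i"
    and le: "\<And>i. i < 2 * n - 1 \<Longrightarrow> \<rho> i \<le> 1 + V * s ^ nat \<bar>centred n i\<bar>"
  shows "(\<Prod>i=0..<2 * n - 1. \<rho> i) \<le> exp (V * geo_sum s)"
proof -
  have "(\<Prod>i=0..<2 * n - 1. \<rho> i) \<le> (\<Prod>i=0..<2 * n - 1. exp (V * s ^ nat \<bar>centred n i\<bar>))"
  proof (rule prod_mono)
    fix i assume "i \<in> {0..<2 * n - 1}"
    then have i: "i < 2 * n - 1" by simp
    show "0 \<le> \<rho> i \<and> \<rho> i \<le> exp (V * s ^ nat \<bar>centred n i\<bar>)"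
      using \<beta>[OF i] order_trans[OF le[OF i] exp_ge_add_one_self] by blast
  qed
  also have "\<dots> = exp (V * (\<Sum>i=0..<2 * n - 1. s ^ nat \<bar>centred n i\<bar>))"
    by (simp add: exp_sum sum_distrib_left)
  also have "\<dots> \<le> exp (V * geo_sum s)"
    using mult_left_mono[OF sum_power_centred_le[OF s] V] by simp
  finally show ?thesis .
qed

definition centred_mat :: "nat \<Rightarrow> (int \<Rightarrow> int \<Rightarrow> complex) \<Rightarrow> complex mat" where
  "centred_mat n B = Matrix.mat (2 * n - 1) (2 * n - 1) (\<lambda>(i, j). B (centred n i) (centred n j))"

lemma centred_mat_carrier [simp]: "centred_mat n B \<in> carrier_mat (2 * n - 1) (2 * n - 1)"
  and centred_mat_dim [simp]: "dim_row (centred_mat n B) = 2 * n - 1" "dim_col (centred_mat n B) = 2 * n - 1"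
  and centred_mat_index [simp]: "i < 2 * n - 1 \<Longrightarrow> j < 2 * n - 1 \<Longrightarrow>
    centred_mat n B $$ (i, j) = B (centred n i) (centred n j)"
  by (auto simp: centred_mat_def)

text \<open>Bordering by rows and columns of the identity makes determinants of consecutive sections
  comparable at the same size. The case n = 0 is excluded because 2 * n - 1 is truncated there and
  the size would grow by one instead of two.\<close>

lemma det_centred_mat_Suc:
  assumes n: "1 \<le> n" and B: "\<And>l k. \<not> (\<bar>l\<bar> < int n \<and> \<bar>k\<bar> < int n) \<Longrightarrow> B l k = (if l = k then 1 else 0)"
  shows "Determinant.det (centred_mat (Suc n) B) = Determinant.det (centred_mat n B)"
proof -
  let ?N = "2 * n - 1"
  \<comment> \<open>The new index n sits at the last position and the new index -n at position 0, so
    two nested block decompositions are needed; \<open>M\<close> is the inner one.\<close>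
  define M where "M = four_block_mat (centred_mat n B) (0\<^sub>m ?N 1) (0\<^sub>m 1 ?N) (1\<^sub>m 1)"
  have M: "M \<in> carrier_mat (?N + 1) (?N + 1)" unfolding M_def by auto
  have eq: "centred_mat (Suc n) B = four_block_mat (1\<^sub>m 1) (0\<^sub>m 1 (?N + 1)) (0\<^sub>m (?N + 1) 1) M"
  proof (rule eq_matI)
    fix i j
    assume "i < dim_row (four_block_mat (1\<^sub>m 1) (0\<^sub>m 1 (?N + 1)) (0\<^sub>m (?N + 1) 1) M)"
      "j < dim_col (four_block_mat (1\<^sub>m 1) (0\<^sub>m 1 (?N + 1)) (0\<^sub>m (?N + 1) 1) M)"
    then have ij: "i < 2 * n + 1" "j < 2 * n + 1" using M n by auto
    have c: "centred (Suc n) i = centred n (i - 1)" if "1 \<le> i" for i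
      using that by (simp add: centred_def)
    show "centred_mat (Suc n) B $$ (i, j)
        = four_block_mat (1\<^sub>m 1) (0\<^sub>m 1 (?N + 1)) (0\<^sub>m (?N + 1) 1) M $$ (i, j)"
    proof (cases "1 \<le> i \<and> i < 2 * n \<and> 1 \<le> j \<and> j < 2 * n")
      case True
      then have "i - 1 < ?N" "j - 1 < ?N" by auto
      then show ?thesis using ij M True unfolding M_def by (simp add: c del: One_nat_def)
    next
      case False
      then have "\<not> (\<bar>centred (Suc n) i\<bar> < int n \<and> \<bar>centred (Suc n) j\<bar> < int n)"
        using ij by (auto simp: centred_def)
      then have "centred_mat (Suc n) B $$ (i, j) = (if i = j then 1 else 0)"
        using ij by (simp add: B centred_eq_iff)
      moreover have "four_block_mat (1\<^sub>m 1) (0\<^sub>m 1 (?N + 1)) (0\<^sub>m (?N + 1) 1) M $$ (i, j)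
          = (if i = j then 1 else 0)"
      proof (cases "i = 0 \<or> j = 0")
        case True
        then show ?thesis using ij M n by auto
      next
        case nz: False
        have "M $$ (i - 1, j - 1) = (if i = j then 1 else 0)"
        proof -
          have le: "i - 1 < ?N + 1" "j - 1 < ?N + 1" using ij nz n by auto
          have "\<not> (i - 1 < ?N \<and> j - 1 < ?N)" "i - 1 = j - 1 \<longleftrightarrow> i = j" using False nz ij by auto
          then show ?thesis using le unfolding M_def by (auto simp del: One_nat_def)
        qed
        then show ?thesis using ij M nz n by (simp del: One_nat_def)
      qed
      ultimately show ?thesis by simp
    qed
  qed (use M n in auto)
  have "Determinant.det (centred_mat (Suc n) B) = Determinant.det (1\<^sub>m 1) * Determinant.det M"
    unfolding eq by (rule det_four_block_mat_lower_left_zero) (use M in auto)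
  also have "Determinant.det M = Determinant.det (centred_mat n B) * Determinant.det (1\<^sub>m 1)"
    unfolding M_def by (rule det_four_block_mat_lower_left_zero) auto
  finally show ?thesis by simp
qed

lemma row_sum_le:
  assumes "0 \<le> s" "s < 1" "0 \<le> V" "i < 2 * n - 1"
  shows "(\<Sum>j=0..<2 * n - 1. (if i = j then 1 else 0) + V * s ^ nat \<bar>centred n i\<bar> * s ^ nat \<bar>centred n j\<bar>)
    \<le> 1 + V * geo_sum s * s ^ nat \<bar>centred n i\<bar>"
proof -
  have "V * s ^ nat \<bar>centred n i\<bar> * (\<Sum>j=0..<2 * n - 1. s ^ nat \<bar>centred n j\<bar>) \<le> V * s ^ nat \<bar>centred n i\<bar> * geo_sum s"
    using assms by (intro mult_left_mono sum_power_centred_le) auto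
  then show ?thesis
    using assms by (simp add: sum.distrib sum_distrib_left mult_ac)
qed

lemma norm_det_diff_centred_le:
  assumes s: "0 \<le> s" "s < 1" and V: "0 \<le> V" and e: "0 \<le> e"
    and A: "\<And>l k. cmod (A l k) \<le> (if l = k then 1 else 0) + V * s ^ nat \<bar>l\<bar> * s ^ nat \<bar>k\<bar>"
    and B: "\<And>l k. cmod (B l k) \<le> (if l = k then 1 else 0) + V * s ^ nat \<bar>l\<bar> * s ^ nat \<bar>k\<bar>"
    and d: "\<And>l k. cmod (A l k - B l k) \<le> e * (V * s ^ nat \<bar>l\<bar> * s ^ nat \<bar>k\<bar>)"
  shows "cmod (Determinant.det (centred_mat n A) - Determinant.det (centred_mat n B))
    \<le> real (2 * n - 1) * e * exp (V * geo_sum s * geo_sum s)"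
proof -
  let ?\<beta> = "\<lambda>i j. (if i = j then 1 else 0) + V * s ^ nat \<bar>centred n i\<bar> * s ^ nat \<bar>centred n j\<bar>"
  have "cmod (Determinant.det (centred_mat n A) - Determinant.det (centred_mat n B))
      \<le> real (2 * n - 1) * e * (\<Prod>i=0..<2 * n - 1. \<Sum>j=0..<2 * n - 1. ?\<beta> i j)"
  proof (rule norm_det_diff_le[OF centred_mat_carrier centred_mat_carrier e])
    fix i j assume ij: "i < 2 * n - 1" "j < 2 * n - 1"
    show "cmod (centred_mat n A $$ (i, j)) \<le> ?\<beta> i j" "cmod (centred_mat n B $$ (i, j)) \<le> ?\<beta> i j"
      using ij A[of "centred n i" "centred n j"] B[of "centred n i" "centred n j"]
      by (simp_all add: centred_eq_iff)
    have "e * (V * s ^ nat \<bar>centred n i\<bar> * s ^ nat \<bar>centred n j\<bar>) \<le> e * ?\<beta> i j"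
      using e by (intro mult_left_mono) auto
    then show "cmod (centred_mat n A $$ (i, j) - centred_mat n B $$ (i, j)) \<le> e * ?\<beta> i j"
      using ij d[of "centred n i" "centred n j"] by simp
  qed
  also have "\<dots> \<le> real (2 * n - 1) * e * exp (V * geo_sum s * geo_sum s)"
    using s V e geo_sum_ge_1[OF s]
    by (intro mult_left_mono prod_rows_le_exp row_sum_le) (auto intro!: add_nonneg_nonneg sum_nonneg)
  finally show ?thesis .
qed

text \<open>Cramer's rule gives a bound on the inverse of \<open>B\<close> that does not depend on the dimension.\<close>

lemma cramer_centred_le:
  assumes s: "0 < s" "s < 1" and V: "0 \<le> V" and b: "0 \<le> b"
    and B: "\<And>l k. cmod (B l k) \<le> (if l = k then 1 else 0) + V * s ^ nat \<bar>l\<bar> * s ^ nat \<bar>k\<bar>"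
    and x: "x \<in> carrier_vec (2 * n - 1)" and m: "m < 2 * n - 1"
    and g: "\<And>i. i < 2 * n - 1 \<Longrightarrow> cmod (vec_index (centred_mat n B *\<^sub>v x) i) \<le> b * s ^ nat \<bar>centred n i\<bar>"
  shows "cmod (vec_index x m) * cmod (Determinant.det (centred_mat n B))
    \<le> b * exp ((V * geo_sum s + 1) * geo_sum s)"
proof -
  let ?N = "2 * n - 1" and ?M = "centred_mat n B"
  \<comment> \<open>The proof divides by the bound on the right-hand side, which may be zero; hence
    a positive b' \<ge> b, which is let tend to b at the end.\<close>
  have bound: "cmod (vec_index x m) * cmod (Determinant.det ?M) \<le> b' * exp ((V * geo_sum s + 1) * geo_sum s)"
    if b': "b \<le> b'" "0 < b'" for b'
  proof -
    \<comment> \<open>After this scaling the column inserted by Cramer's rule has entries at most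
      s^|i|. It then raises the sum of a row by no more than this, and the estimate by row sums
      still applies with V g + 1 in place of V g, where g is the geometric sum.\<close>
    define y where "y = complex_of_real (1 / b') \<cdot>\<^sub>v x"
    have y: "y \<in> carrier_vec ?N" using x by (simp add: y_def)
    have My: "?M *\<^sub>v y = complex_of_real (1 / b') \<cdot>\<^sub>v (?M *\<^sub>v x)"
      unfolding y_def by (rule mult_mat_vec[OF centred_mat_carrier x])
    let ?\<beta> = "\<lambda>i j. ((if i = j then 1 else 0) + V * s ^ nat \<bar>centred n i\<bar> * s ^ nat \<bar>centred n j\<bar>)
      + (if j = m then s ^ nat \<bar>centred n i\<bar> else 0)"
    have "cmod (Determinant.det (replace_col ?M (?M *\<^sub>v y) m)) \<le> (\<Prod>i=0..<?N. \<Sum>j=0..<?N. ?\<beta> i j)"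
    proof (rule norm_det_le)
      show "replace_col ?M (?M *\<^sub>v y) m \<in> carrier_mat ?N ?N" by (simp add: replace_col_def)
      fix i j assume ij: "i < ?N" "j < ?N"
      show "cmod (replace_col ?M (?M *\<^sub>v y) m $$ (i, j)) \<le> ?\<beta> i j"
      proof (cases "j = m")
        case True
        have "cmod (vec_index (?M *\<^sub>v y) i) = cmod (vec_index (?M *\<^sub>v x) i) / b'"
          using ij b' unfolding My by (simp add: norm_divide)
        also have "\<dots> \<le> (b' * s ^ nat \<bar>centred n i\<bar>) / b'"
          using order_trans[OF g[OF ij(1)] mult_right_mono[OF b'(1)]] b' s by (intro divide_right_mono) auto
        also have "\<dots> = s ^ nat \<bar>centred n i\<bar>" using b' by simp
        also have "\<dots> \<le> ?\<beta> i j" using True V s by simp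
        finally show ?thesis using ij True by (simp add: replace_col_def del: index_mult_mat_vec)
      next
        case False
        then show ?thesis
          using ij B[of "centred n i" "centred n j"] by (simp add: replace_col_def centred_eq_iff)
      qed
    qed
    also have "\<dots> \<le> exp ((V * geo_sum s + 1) * geo_sum s)"
    proof (rule prod_rows_le_exp)
      fix i assume i: "i < ?N"
      show "0 \<le> (\<Sum>j=0..<?N. ?\<beta> i j)" using V s by (intro sum_nonneg) auto
      have "(\<Sum>j=0..<?N. if j = m then s ^ nat \<bar>centred n i\<bar> else 0) = s ^ nat \<bar>centred n i\<bar>"
        using m by simp
      then show "(\<Sum>j=0..<?N. ?\<beta> i j) \<le> 1 + (V * geo_sum s + 1) * s ^ nat \<bar>centred n i\<bar>"
        using row_sum_le[OF less_imp_le[OF s(1)] s(2) V i] by (subst sum.distrib) (simp add: algebra_simps)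
    qed (use s V geo_sum_ge_1[of s] in auto)
    finally have "cmod (vec_index y m * Determinant.det ?M) \<le> exp ((V * geo_sum s + 1) * geo_sum s)"
      unfolding cramer_lemma_mat[OF centred_mat_carrier y m] .
    then show ?thesis using b' m x by (simp add: y_def norm_mult norm_divide field_simps)
  qed
  let ?E = "exp ((V * geo_sum s + 1) * geo_sum s)"
  show ?thesis
  proof (rule field_le_epsilon)
    fix e :: real assume "0 < e"
    then have "cmod (vec_index x m) * cmod (Determinant.det ?M) \<le> (b + e / ?E) * ?E"
      using b by (intro bound) (auto intro: add_nonneg_pos)
    also have "\<dots> = b * ?E + e" by (simp add: field_simps)
    finally show "cmod (vec_index x m) * cmod (Determinant.det ?M) \<le> b * ?E + e" .
  qed
qed

section \<open>Exponentially convergent finite sections\<close>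

text \<open>The setting for all spectral arguments: \<open>T\<close> is the kernel of the limit
  operator, \<open>A n\<close> a section supported on |l|, |k| < n. The section need not be the
  compression of \<open>T\<close>; it only has to be close to \<open>T\<close> in the weighted
  sense, at a geometric rate. A single s < 1 serves as decay of the entries and as rate of
  approximation.\<close>

locale finite_sections =
  fixes r s c :: real and T :: "int \<Rightarrow> int \<Rightarrow> complex" and A :: "nat \<Rightarrow> int \<Rightarrow> int \<Rightarrow> complex"
  assumes r: "0 < r" and s: "0 < s" "s < 1" and c: "0 < c"
    and T_bound: "kernel_bound r s c T"
    and A_support: "\<And>n l k. \<not> (\<bar>l\<bar> < int n \<and> \<bar>k\<bar> < int n) \<Longrightarrow> A n l k = 0"
    and diff_bound: "\<And>n. kernel_bound r s (c * s ^ n) (\<lambda>l k. T l k - A n l k)"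
begin

abbreviation "g \<equiv> geo_sum s"
abbreviation "kT \<equiv> kernel_operator T"
abbreviation "kA n \<equiv> kernel_operator (A n)"

lemma g1: "1 \<le> g"
  using geo_sum_ge_1 s by simp

lemma c0: "0 \<le> c" "0 \<le> c * s ^ n"
  using c s by auto

lemma A_bound: "kernel_bound r s (2 * c) (A n)"
  unfolding kernel_bound_def
proof (intro allI)
  fix l k :: int
  let ?w = "s ^ nat \<bar>l\<bar> * (s ^ nat \<bar>k\<bar> * r ^ nat \<bar>k\<bar>)"
  have "cmod (A n l k) = cmod (T l k - (T l k - A n l k))" by simp
  also have "\<dots> \<le> cmod (T l k) + cmod (T l k - A n l k)" by (rule norm_triangle_ineq4)
  finally have "cmod (A n l k) * r ^ nat \<bar>l\<bar>
      \<le> cmod (T l k) * r ^ nat \<bar>l\<bar> + cmod (T l k - A n l k) * r ^ nat \<bar>l\<bar>"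
    using r by (simp add: distrib_right[symmetric])
  also have "\<dots> \<le> c * ?w + c * s ^ n * ?w"
    using T_bound diff_bound[of n] unfolding kernel_bound_def by (intro add_mono) (simp_all add: mult.assoc)
  also have "\<dots> \<le> c * ?w + c * 1 * ?w"
    using s r c by (intro add_left_mono mult_right_mono mult_left_mono) (auto intro: power_le_one)
  finally show "cmod (A n l k) * r ^ nat \<bar>l\<bar> \<le> 2 * c * s ^ nat \<bar>l\<bar> * (s ^ nat \<bar>k\<bar> * r ^ nat \<bar>k\<bar>)"
    by (simp add: algebra_simps)
qed

lemmas T_H2 = kernel_operator_H2[OF r s c0(1) T_bound]
lemmas A_H2 = kernel_operator_H2[OF r s mult_nonneg_nonneg[OF zero_le_numeral c0(1)] A_bound]
lemmas D_H2 = kernel_operator_H2[OF r s c0(2) diff_bound]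

lemma A_diff:
  assumes "f \<in> H2 r"
  shows "kernel_operator (\<lambda>l k. T l k - A n l k) f = (\<lambda>l. kT f l - kA n f l)"
  by (rule ext, rule kernel_operator_kernel_diff[OF T_H2(1) A_H2(1)]) (use assms in auto)

lemma T_minus_A:
  assumes "f \<in> H2 r"
  shows "(\<lambda>l. kT f l - kA n f l) \<in> H2 r"
    "H2_norm r (\<lambda>l. kT f l - kA n f l) \<le> c * g\<^sup>2 * s ^ n * H2_norm r f"
    "cmod (kT f l - kA n f l) * r ^ nat \<bar>l\<bar> \<le> c * g * s ^ n * H2_norm r f * s ^ nat \<bar>l\<bar>"
  using D_H2(2)[OF assms, of n l] D_H2(3,4)[OF assms, of n] unfolding A_diff[OF assms]
  by (auto simp: mult_ac)

lemma kT_add: "f \<in> H2 r \<Longrightarrow> h \<in> H2 r \<Longrightarrow> kT (\<lambda>k. f k + h k) l = kT f l + kT h l"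
  by (intro kernel_operator_add T_H2(1))

lemma kA_add: "f \<in> H2 r \<Longrightarrow> h \<in> H2 r \<Longrightarrow> kA n (\<lambda>k. f k + h k) l = kA n f l + kA n h l"
  by (intro kernel_operator_add A_H2(1))

lemma kernel_operator_uminus: "kernel_operator K (\<lambda>k. - f k) l = - kernel_operator K f l"
  using kernel_operator_scale[of K "-1" f l] by simp

lemma kT_diff: "f \<in> H2 r \<Longrightarrow> h \<in> H2 r \<Longrightarrow> kT (\<lambda>k. f k - h k) l = kT f l - kT h l"
  using kT_add[of f "\<lambda>k. - h k" l] H2_uminus(1)[of h r] by (simp add: kernel_operator_uminus)

lemma kA_diff: "f \<in> H2 r \<Longrightarrow> h \<in> H2 r \<Longrightarrow> kA n (\<lambda>k. f k - h k) l = kA n f l - kA n h l"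
  using kA_add[of f "\<lambda>k. - h k" n l] H2_uminus(1)[of h r] by (simp add: kernel_operator_uminus)

lemma kA_support: "\<not> \<bar>l\<bar> < int n \<Longrightarrow> kA n f l = 0"
  by (simp add: kernel_operator_def A_support)

lemma kA_sum: "kA n f l = (\<Sum>k | \<bar>k\<bar> < int n. A n l k * f k)"
  by (rule kernel_operator_finite[OF finite_abs_less]) (auto simp: A_support)

lemma H2_I_support:
  assumes "\<And>k. \<not> \<bar>k\<bar> < int n \<Longrightarrow> f k = 0"
  shows "f \<in> H2 r"
  by (rule H2_I_finite(1)[OF finite_abs_less]) (use assms in auto)

text \<open>The eigenvector must be supported in the block. Otherwise 0 would always be an
  eigenvalue, since \<open>kA n\<close> annihilates all sequences vanishing on the block.\<close>

definition is_eigenvalue :: "nat \<Rightarrow> complex \<Rightarrow> bool" where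
  "is_eigenvalue n \<mu> \<longleftrightarrow> (\<exists>h. h \<noteq> (\<lambda>_. 0) \<and> (\<forall>k. \<not> \<bar>k\<bar> < int n \<longrightarrow> h k = 0) \<and> kA n h = (\<lambda>k. \<mu> * h k))"

text \<open>Boundedness from below, without any claim of surjectivity: this half of invertibility is
  stable under limits and perturbations and is handled separately.\<close>

definition resolvent_bound :: "complex \<Rightarrow> real \<Rightarrow> bool" where
  "resolvent_bound z B \<longleftrightarrow> (\<forall>f\<in>H2 r. H2_norm r f \<le> B * H2_norm r (\<lambda>l. z * f l - kT f l))"

lemma zT_H2: "f \<in> H2 r \<Longrightarrow> (\<lambda>l. z * f l - kT f l) \<in> H2 r"
  by (intro H2_diff(1) H2_scale(1) T_H2(3) r)

lemma not_in_spectrumD: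
  assumes "z \<notin> H2_spectrum r kT"
  obtains B where "0 < B" "resolvent_bound z B" "\<And>f. f \<in> H2 r \<Longrightarrow> \<exists>x\<in>H2 r. (\<lambda>l. z * x l - kT x l) = f"
proof -
  obtain R where R: "H2_bounded_operator r R" "\<And>f. f \<in> H2 r \<Longrightarrow> R (\<lambda>n. z * f n - kT f n) = f"
    "\<And>f. f \<in> H2 r \<Longrightarrow> (\<lambda>n. z * R f n - kT (R f) n) = f"
    using assms unfolding H2_spectrum_def by auto
  obtain B where B: "\<And>f. f \<in> H2 r \<Longrightarrow> H2_norm r (R f) \<le> B * H2_norm r f"
    using R(1) unfolding H2_bounded_operator_def by blast
  have "resolvent_bound z (\<bar>B\<bar> + 1)"
    unfolding resolvent_bound_def
  proof
    fix f assume f: "f \<in> H2 r"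
    have "H2_norm r f \<le> B * H2_norm r (\<lambda>l. z * f l - kT f l)"
      using B[OF zT_H2[OF f, of z]] R(2)[OF f] by simp
    also have "\<dots> \<le> (\<bar>B\<bar> + 1) * H2_norm r (\<lambda>l. z * f l - kT f l)"
      by (intro mult_right_mono H2_norm_nonneg r) auto
    finally show "H2_norm r f \<le> (\<bar>B\<bar> + 1) * H2_norm r (\<lambda>l. z * f l - kT f l)" .
  qed
  moreover have "\<exists>x\<in>H2 r. (\<lambda>l. z * x l - kT x l) = f" if "f \<in> H2 r" for f
    using R(1,3) that unfolding H2_bounded_operator_def by blast
  ultimately show ?thesis using that[of "\<bar>B\<bar> + 1"] by auto
qed

lemma resolvent_bound_inj:
  assumes "resolvent_bound z B" "x \<in> H2 r" "y \<in> H2 r" "(\<lambda>l. z * x l - kT x l) = (\<lambda>l. z * y l - kT y l)"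
  shows "x = y"
proof -
  let ?d = "\<lambda>l. x l - y l"
  have d: "?d \<in> H2 r" by (rule H2_diff(1)[OF r assms(2,3)])
  have "(\<lambda>l. z * ?d l - kT ?d l) = (\<lambda>_. 0)"
    using assms(4) by (auto simp: kT_diff[OF assms(2,3)] fun_eq_iff algebra_simps)
  then have "H2_norm r ?d \<le> 0"
    using assms(1) d unfolding resolvent_bound_def by (metis H2_zero(2) mult_zero_right)
  from H2_norm_eq_0[OF r d this] show ?thesis by (auto simp: fun_eq_iff)
qed

text \<open>Boundedness from below makes preimages unique, which forces the chosen right inverse to
  be linear, and the same bound makes it continuous.\<close>

lemma not_in_spectrumI:
  assumes B: "resolvent_bound z B"
    and surj: "\<And>f. f \<in> H2 r \<Longrightarrow> \<exists>x\<in>H2 r. (\<lambda>l. z * x l - kT x l) = f"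
  shows "z \<notin> H2_spectrum r kT"
proof -
  define R where "R f = (SOME x. x \<in> H2 r \<and> (\<lambda>l. z * x l - kT x l) = f)" for f
  have R: "R f \<in> H2 r \<and> (\<lambda>l. z * R f l - kT (R f) l) = f" if "f \<in> H2 r" for f
  proof -
    have "\<exists>x. x \<in> H2 r \<and> (\<lambda>l. z * x l - kT x l) = f" using surj[OF that] by blast
    from someI_ex[OF this] show ?thesis unfolding R_def .
  qed
  have R_eq: "R f = x" if "f \<in> H2 r" "x \<in> H2 r" "(\<lambda>l. z * x l - kT x l) = f" for f x
    using resolvent_bound_inj[OF B, of "R f" x] R[OF that(1)] that by auto
  have Rl: "z * R f l - kT (R f) l = f l" if "f \<in> H2 r" for f l
    using R[OF that] by (simp add: fun_eq_iff)
  have "H2_bounded_operator r R"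
    unfolding H2_bounded_operator_def
  proof (intro conjI ballI allI exI[of _ B])
    fix f h assume fh: "f \<in> H2 r" "h \<in> H2 r"
    show "R (\<lambda>n. f n + h n) = (\<lambda>n. R f n + R h n)"
    proof (rule R_eq)
      show "(\<lambda>n. f n + h n) \<in> H2 r" by (rule H2_add(1)[OF r fh])
      show "(\<lambda>n. R f n + R h n) \<in> H2 r" using R fh by (intro H2_add(1)[OF r]) auto
      show "(\<lambda>l. z * (R f l + R h l) - kT (\<lambda>n. R f n + R h n) l) = (\<lambda>n. f n + h n)"
        using kT_add[of "R f" "R h"] R fh Rl[OF fh(1)] Rl[OF fh(2)]
        by (auto simp: fun_eq_iff algebra_simps)
    qed
  next
    fix a f assume f: "f \<in> H2 r"
    show "R (\<lambda>n. a * f n) = (\<lambda>n. a * R f n)"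
    proof (rule R_eq)
      show "(\<lambda>l. z * (a * R f l) - kT (\<lambda>n. a * R f n) l) = (\<lambda>n. a * f n)"
        using kernel_operator_scale[of T a "R f"] Rl[OF f]
        by (auto simp: fun_eq_iff right_diff_distrib[symmetric] mult.left_commute[of z])
    qed (use H2_scale(1)[OF r] f R in auto)
  next
    fix f assume f: "f \<in> H2 r"
    show "H2_norm r (R f) \<le> B * H2_norm r f"
      using B R[OF f] unfolding resolvent_bound_def by metis
  qed (use R in blast)
  moreover have "R (\<lambda>n. z * f n - kT f n) = f" if "f \<in> H2 r" for f
    by (rule R_eq[OF zT_H2[OF that] that]) simp
  ultimately show ?thesis
    unfolding H2_spectrum_def using R by blast
qed

lemma zA_zT:
  assumes "f \<in> H2 r"
  shows "(\<lambda>l. z * f l - kA n f l) \<in> H2 r"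
    "H2_norm r (\<lambda>l. z * f l - kT f l) \<le> H2_norm r (\<lambda>l. z * f l - kA n f l) + c * g\<^sup>2 * s ^ n * H2_norm r f"
    "H2_norm r (\<lambda>l. z * f l - kA n f l) \<le> H2_norm r (\<lambda>l. z * f l - kT f l) + c * g\<^sup>2 * s ^ n * H2_norm r f"
proof -
  note D = T_minus_A(1,2)[OF assms, of n]
  show A: "(\<lambda>l. z * f l - kA n f l) \<in> H2 r"
    by (intro H2_diff(1) H2_scale(1) A_H2(3) r assms)
  show "H2_norm r (\<lambda>l. z * f l - kT f l) \<le> H2_norm r (\<lambda>l. z * f l - kA n f l) + c * g\<^sup>2 * s ^ n * H2_norm r f"
    using H2_diff(2)[OF r A D(1)] D(2) by simp
  show "H2_norm r (\<lambda>l. z * f l - kA n f l) \<le> H2_norm r (\<lambda>l. z * f l - kT f l) + c * g\<^sup>2 * s ^ n * H2_norm r f"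
    using H2_add(2)[OF r zT_H2[OF assms, of z] D(1)] D(2) by simp
qed

section \<open>Limits of eigenvalues of the sections, and the spectral point 0\<close>

lemma tendsto_error: "(\<lambda>n. C * s ^ n) \<longlonglongrightarrow> 0"
  using tendsto_mult_right_zero[OF LIMSEQ_realpow_zero[of s]] s by simp

text \<open>An eigenvector of a section is an approximate eigenvector of the operator, with relative
  defect |lam - \<mu> n| + c g^2 s^n. As the defect tends to 0, lam - T cannot be bounded
  below.\<close>

lemma eigenvalue_limit_in_spectrum:
  assumes ev: "\<And>n. n \<ge> 1 \<Longrightarrow> is_eigenvalue n (\<mu> n)" and lim: "\<mu> \<longlonglongrightarrow> lam"
  shows "lam \<in> H2_spectrum r kT"
proof (rule ccontr)
  assume "lam \<notin> H2_spectrum r kT"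
  from not_in_spectrumD[OF this] obtain B where B: "0 < B" "resolvent_bound lam B"
    by blast
  have "(\<lambda>n. B * (cmod (lam - \<mu> n) + c * g\<^sup>2 * s ^ n)) \<longlonglongrightarrow> B * (cmod (lam - lam) + 0)"
    by (intro tendsto_intros lim tendsto_error)
  then have "\<forall>\<^sub>F n in sequentially. B * (cmod (lam - \<mu> n) + c * g\<^sup>2 * s ^ n) < 1"
    by (rule order_tendstoD) simp
  from eventually_happens'[OF sequentially_bot eventually_conj[OF this eventually_ge_at_top[of 1]]]
  obtain n where n: "B * (cmod (lam - \<mu> n) + c * g\<^sup>2 * s ^ n) < 1" "1 \<le> n"
    by blast
  obtain h where h: "h \<noteq> (\<lambda>_. 0)" "\<And>k. \<not> \<bar>k\<bar> < int n \<Longrightarrow> h k = 0" "kA n h = (\<lambda>k. \<mu> n * h k)"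
    using ev[OF n(2)] unfolding is_eigenvalue_def by auto
  have hH: "h \<in> H2 r" by (rule H2_I_support) (use h in auto)
  have pos: "0 < H2_norm r h"
    using H2_norm_eq_0[OF r hH] h(1) by (meson not_le)
  have "H2_norm r h \<le> B * H2_norm r (\<lambda>l. lam * h l - kT h l)"
    using B(2) hH by (auto simp: resolvent_bound_def)
  also have "\<dots> \<le> B * (H2_norm r (\<lambda>l. lam * h l - kA n h l) + c * g\<^sup>2 * s ^ n * H2_norm r h)"
    using B zA_zT(2)[OF hH] by (intro mult_left_mono) auto
  also have "(\<lambda>l. lam * h l - kA n h l) = (\<lambda>l. (lam - \<mu> n) * h l)"
    unfolding h(3) by (simp add: left_diff_distrib)
  also have "H2_norm r \<dots> = cmod (lam - \<mu> n) * H2_norm r h" by (rule H2_scale(2)[OF r hH])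
  also have "B * (cmod (lam - \<mu> n) * H2_norm r h + c * g\<^sup>2 * s ^ n * H2_norm r h)
     = B * (cmod (lam - \<mu> n) + c * g\<^sup>2 * s ^ n) * H2_norm r h" by (simp add: algebra_simps)
  also have "\<dots> < 1 * H2_norm r h" using n pos by (intro mult_strict_right_mono)
  finally show False by simp
qed

lemma zero_in_spectrum: "0 \<in> H2_spectrum r kT"
proof (rule ccontr)
  assume "0 \<notin> H2_spectrum r kT"
  from not_in_spectrumD[OF this] obtain B where B: "0 < B" "resolvent_bound 0 B"
    by blast
  have "\<forall>\<^sub>F n in sequentially. B * (c * g\<^sup>2) * s ^ n < 1"
    by (rule order_tendstoD(2)[OF tendsto_error]) simp
  from eventually_happens'[OF sequentially_bot this]
  obtain n where n: "B * (c * g\<^sup>2) * s ^ n < 1" by blast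
  \<comment> \<open>The monomial z^n lies just outside the block |k| < n and is annihilated by the
    section; hence the operator nearly annihilates it, relative to its norm.\<close>
  define h :: "int \<Rightarrow> complex" where "h k = (if k = int n then 1 else 0)" for k
  have hH: "h \<in> H2 r" by (rule H2_I_finite(1)[of "{int n}"]) (auto simp: h_def)
  have "h (int n) \<noteq> 0" by (simp add: h_def)
  then have pos: "0 < H2_norm r h"
    using H2_norm_eq_0[OF r hH] by (metis not_le)
  have "kA n h = (\<lambda>_. 0)"
    unfolding kA_sum h_def by (intro ext sum.neutral) auto
  then have "(\<lambda>l. 0 * h l - kA n h l) = (\<lambda>_. 0)" by (simp only: mult_zero_left diff_zero)
  from zA_zT(2)[OF hH, of 0 n, unfolded this H2_zero(2)]
  have "H2_norm r (\<lambda>l. 0 * h l - kT h l) \<le> c * g\<^sup>2 * s ^ n * H2_norm r h"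
    by (simp only: add_0)
  then have "H2_norm r h \<le> B * (c * g\<^sup>2 * s ^ n * H2_norm r h)"
    by (rule order_trans[OF bspec[OF B(2)[unfolded resolvent_bound_def] hH] mult_left_mono])
       (use B(1) in simp)
  also have "\<dots> = (B * (c * g\<^sup>2) * s ^ n) * H2_norm r h" by simp
  also have "\<dots> < 1 * H2_norm r h" using n pos by (intro mult_strict_right_mono)
  finally show False by simp
qed

end

section \<open>Geometric rates\<close>

lemma eventually_geometric_less:
  fixes q :: real
  assumes "0 < q" "q < 1" "0 < e"
  shows "\<forall>\<^sub>F n in sequentially. C * q ^ n < e"
proof (rule order_tendstoD(2)[OF _ assms(3)])
  show "(\<lambda>n. C * q ^ n) \<longlonglongrightarrow> 0"
    using assms by (intro tendsto_mult_right_zero LIMSEQ_realpow_zero) auto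
qed

lemma geometric_limit:
  fixes u :: "nat \<Rightarrow> complex"
  assumes q: "0 < q" "q < 1" and C: "0 \<le> C"
    and step: "\<And>n. 1 \<le> n \<Longrightarrow> cmod (u n - u (Suc n)) \<le> C * q ^ n"
  shows "u \<longlonglongrightarrow> lim u" and "1 \<le> n \<Longrightarrow> cmod (u n - lim u) \<le> C / (1 - q) * q ^ n"
proof -
  \<comment> \<open>The factor 1 - q^k, the exact partial geometric sum, is what makes the induction
    on k close.\<close>
  have tail: "cmod (u n - u (n + k)) \<le> C / (1 - q) * q ^ n * (1 - q ^ k)" if n: "1 \<le> n" for n k
  proof (induction k)
    case (Suc k)
    have "cmod (u n - u (n + Suc k)) \<le> cmod (u n - u (n + k)) + cmod (u (n + k) - u (Suc (n + k)))"
      using norm_triangle_ineq[of "u n - u (n + k)" "u (n + k) - u (Suc (n + k))"] by simp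
    also have "\<dots> \<le> C / (1 - q) * q ^ n * (1 - q ^ k) + C * q ^ (n + k)"
      using Suc step[of "n + k"] n by (intro add_mono) auto
    also have "\<dots> = C / (1 - q) * q ^ n * (1 - q ^ Suc k)"
      using q by (simp add: field_simps power_add)
    finally show ?case .
  qed simp
  have bound: "cmod (u n - u m) \<le> C / (1 - q) * q ^ n" if "1 \<le> n" "n \<le> m" for n m
  proof -
    have "cmod (u n - u m) \<le> C / (1 - q) * q ^ n * (1 - q ^ (m - n))"
      using tail[OF that(1), of "m - n"] that(2) by simp
    also have "\<dots> \<le> C / (1 - q) * q ^ n * 1"
      using q C by (intro mult_left_mono) auto
    finally show ?thesis by simp
  qed
  have "Cauchy u"
  proof (rule metric_CauchyI)
    fix e :: real assume "0 < e"
    have "\<forall>\<^sub>F n in sequentially. C / (1 - q) * q ^ n < e / 2"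
      by (rule eventually_geometric_less) (use q \<open>0 < e\<close> in auto)
    from eventually_happens'[OF sequentially_bot eventually_conj[OF this eventually_ge_at_top[of 1]]]
    obtain N where N: "C / (1 - q) * q ^ N < e / 2" "1 \<le> N" by blast
    have "dist (u k) (u l) < e" if kl: "N \<le> k" "N \<le> l" for k l
    proof -
      have "cmod (u N - u k) < e / 2" "cmod (u N - u l) < e / 2"
        using bound[OF N(2) kl(1)] bound[OF N(2) kl(2)] N by linarith+
      then have "dist (u N) (u k) < e / 2" "dist (u N) (u l) < e / 2" by (simp_all add: dist_norm)
      then show ?thesis using dist_triangle3[of "u k" "u l" "u N"] by linarith
    qed
    then show "\<exists>N. \<forall>k\<ge>N. \<forall>l\<ge>N. dist (u k) (u l) < e" by blast
  qed
  then show lim: "u \<longlonglongrightarrow> lim u"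
    using Cauchy_convergent[of u] by (simp only: convergent_LIMSEQ_iff)
  show "cmod (u n - lim u) \<le> C / (1 - q) * q ^ n" if n: "1 \<le> n"
  proof (rule LIMSEQ_le_const2)
    show "(\<lambda>m. cmod (u n - u m)) \<longlonglongrightarrow> cmod (u n - lim u)"
      by (intro tendsto_intros lim)
    show "\<exists>N. \<forall>m\<ge>N. cmod (u n - u m) \<le> C / (1 - q) * q ^ n"
      using bound[OF n] by blast
  qed
qed

text \<open>Half of the exponential rate absorbs the linear factor coming from the dimension; this
  is the origin of \<open>sqrt s\<close> below. The constant is Bernoulli's inequality for 1 / sqrt
  s = 1 + h.\<close>

lemma linear_times_power_le:
  fixes s :: real
  assumes "0 < s" "s < 1"
  obtains K where "0 < K" "\<And>n. real (2 * n + 1) * s ^ n \<le> K * sqrt s ^ n"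
proof -
  define q where "q = sqrt s"
  have q: "0 < q" "q < 1" "s = q * q" using assms by (auto simp: q_def)
  define h where "h = 1 / q - 1"
  have h: "0 < h" using q by (simp add: h_def field_simps)
  show ?thesis
  proof (rule that[of "1 + 2 / h"])
    show "0 < 1 + 2 / h" using h by (simp add: add_pos_pos)
    fix n
    have "1 + real n * h \<le> (1 + h) ^ n"
      using h by (intro Bernoulli_inequality) auto
    also have "\<dots> = 1 / q ^ n" using q by (simp add: h_def power_divide)
    finally have "q ^ n * (1 + real n * h) \<le> 1" using q by (simp add: field_simps)
    moreover have "real (2 * n + 1) \<le> (1 + 2 / h) * (1 + real n * h)"
      using h by (simp add: field_simps)
    moreover have "0 \<le> 1 + 2 / h" "0 \<le> q ^ n" using h q by auto
    ultimately have "real (2 * n + 1) * q ^ n \<le> ((1 + 2 / h) * (1 + real n * h)) * q ^ n"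
      "(1 + 2 / h) * (q ^ n * (1 + real n * h)) \<le> (1 + 2 / h) * 1"
      by (blast intro: mult_right_mono mult_left_mono)+
    then have "real (2 * n + 1) * q ^ n \<le> 1 + 2 / h"
      by (simp add: mult_ac)
    then have "real (2 * n + 1) * q ^ n * q ^ n \<le> (1 + 2 / h) * q ^ n"
      using q by (intro mult_right_mono) auto
    moreover have "s ^ n = q ^ n * q ^ n" unfolding q(3) by (rule power_mult_distrib)
    ultimately show "real (2 * n + 1) * s ^ n \<le> (1 + 2 / h) * sqrt s ^ n"
      unfolding q_def[symmetric] by (simp only: mult.assoc)
  qed
qed

section \<open>The Fredholm determinant\<close>

context finite_sections
begin

text \<open>Conjugation by the weight turns the kernel bound into a symmetric decay of the entries.\<close>

definition weighted :: "nat \<Rightarrow> int \<Rightarrow> int \<Rightarrow> complex" where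
  "weighted n l k = A n l k * of_real (r ^ nat \<bar>l\<bar> / r ^ nat \<bar>k\<bar>)"

lemma weighted_kernel_le:
  assumes "kernel_bound r s C K"
  shows "cmod (K l k * of_real (r ^ nat \<bar>l\<bar> / r ^ nat \<bar>k\<bar>)) \<le> C * s ^ nat \<bar>l\<bar> * s ^ nat \<bar>k\<bar>"
proof -
  have "cmod (K l k * of_real (r ^ nat \<bar>l\<bar> / r ^ nat \<bar>k\<bar>)) = (cmod (K l k) * r ^ nat \<bar>l\<bar>) / r ^ nat \<bar>k\<bar>"
    using r by (simp add: norm_mult norm_divide norm_power)
  also have "\<dots> \<le> (C * s ^ nat \<bar>l\<bar> * (s ^ nat \<bar>k\<bar> * r ^ nat \<bar>k\<bar>)) / r ^ nat \<bar>k\<bar>"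
    using assms r unfolding kernel_bound_def by (intro divide_right_mono) auto
  finally show ?thesis using r by simp
qed

lemma weighted_le: "cmod (weighted n l k) \<le> 2 * c * s ^ nat \<bar>l\<bar> * s ^ nat \<bar>k\<bar>"
  unfolding weighted_def by (rule weighted_kernel_le[OF A_bound])

lemma weighted_diff_le:
  "cmod (weighted n l k - weighted (Suc n) l k) \<le> s ^ n * (2 * c * s ^ nat \<bar>l\<bar> * s ^ nat \<bar>k\<bar>)"
proof -
  let ?w = "of_real (r ^ nat \<bar>l\<bar> / r ^ nat \<bar>k\<bar>)" and ?s = "s ^ nat \<bar>l\<bar> * s ^ nat \<bar>k\<bar>"
  have "weighted n l k - weighted (Suc n) l k = (T l k - A (Suc n) l k) * ?w - (T l k - A n l k) * ?w"
    unfolding weighted_def left_diff_distrib by simp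
  then have "cmod (weighted n l k - weighted (Suc n) l k)
      \<le> cmod ((T l k - A (Suc n) l k) * ?w) + cmod ((T l k - A n l k) * ?w)"
    by (metis norm_triangle_ineq4)
  also have "\<dots> \<le> c * s ^ Suc n * s ^ nat \<bar>l\<bar> * s ^ nat \<bar>k\<bar> + c * s ^ n * s ^ nat \<bar>l\<bar> * s ^ nat \<bar>k\<bar>"
    by (rule add_mono[OF weighted_kernel_le[OF diff_bound] weighted_kernel_le[OF diff_bound]])
  also have "\<dots> \<le> c * s ^ n * s ^ nat \<bar>l\<bar> * s ^ nat \<bar>k\<bar> + c * s ^ n * s ^ nat \<bar>l\<bar> * s ^ nat \<bar>k\<bar>"
    using s c by (intro add_right_mono mult_right_mono mult_left_mono) (auto intro: mult_left_le_one_le)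
  finally show ?thesis by (simp add: mult_ac)
qed

definition one_minus :: "nat \<Rightarrow> complex \<Rightarrow> int \<Rightarrow> int \<Rightarrow> complex" where
  "one_minus n w l k = (if l = k then 1 else 0) - w * weighted n l k"

lemma one_minus_le:
  assumes "cmod w \<le> R"
  shows "cmod (one_minus n w l k) \<le> (if l = k then 1 else 0) + 2 * c * R * s ^ nat \<bar>l\<bar> * s ^ nat \<bar>k\<bar>"
proof -
  have "cmod (w * weighted n l k) \<le> R * (2 * c * s ^ nat \<bar>l\<bar> * s ^ nat \<bar>k\<bar>)"
    unfolding norm_mult using assms order_trans[OF norm_ge_zero assms]
    by (intro mult_mono weighted_le norm_ge_zero)
  then show ?thesis
    using norm_triangle_ineq4[of "if l = k then 1 else 0" "w * weighted n l k"]
    unfolding one_minus_def by (auto simp: mult_ac split: if_splits)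
qed

text \<open>The determinant of 1 - w A n, a polynomial in w. Its zeros are the reciprocals of the
  non-zero eigenvalues of the section; conjugation by the weights leaves its value
  unchanged.\<close>

definition fdet :: "nat \<Rightarrow> complex \<Rightarrow> complex" where
  "fdet n w = Determinant.det (centred_mat n (one_minus n w))"

text \<open>The n-th matrix is first bordered to the size of its successor; then both have the same
  size and their entries differ by a factor s^n times the common decay.\<close>

lemma fdet_Suc_diff:
  assumes n: "1 \<le> n" and w: "cmod w \<le> R"
  shows "cmod (fdet n w - fdet (Suc n) w) \<le> real (2 * n + 1) * s ^ n * exp (2 * c * R * g * g)"
proof -
  have R: "0 \<le> R" using w norm_ge_zero order_trans by blast
  have "fdet n w = Determinant.det (centred_mat (Suc n) (one_minus n w))"
    unfolding fdet_def by (rule det_centred_mat_Suc[OF n, symmetric])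
      (auto simp: one_minus_def weighted_def A_support)
  moreover have "cmod (Determinant.det (centred_mat (Suc n) (one_minus n w))
        - Determinant.det (centred_mat (Suc n) (one_minus (Suc n) w)))
      \<le> real (2 * Suc n - 1) * s ^ n * exp (2 * c * R * g * g)"
  proof (rule norm_det_diff_centred_le)
    fix l k
    have "one_minus n w l k - one_minus (Suc n) w l k = - (w * (weighted n l k - weighted (Suc n) l k))"
      by (simp add: one_minus_def algebra_simps)
    then have "cmod (one_minus n w l k - one_minus (Suc n) w l k)
        = cmod w * cmod (weighted n l k - weighted (Suc n) l k)" by (simp add: norm_mult)
    also have "\<dots> \<le> R * (s ^ n * (2 * c * s ^ nat \<bar>l\<bar> * s ^ nat \<bar>k\<bar>))"
      using w R weighted_diff_le by (intro mult_mono) auto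
    finally show "cmod (one_minus n w l k - one_minus (Suc n) w l k)
        \<le> s ^ n * (2 * c * R * s ^ nat \<bar>l\<bar> * s ^ nat \<bar>k\<bar>)" by (simp add: mult_ac)
  qed (use s c R one_minus_le[OF w] in auto)
  ultimately show ?thesis by (simp add: fdet_def)
qed

definition fdet_limit :: "complex \<Rightarrow> complex" where
  "fdet_limit w = lim (\<lambda>n. fdet n w)"

text \<open>The constant depends on R only, so the convergence is uniform on discs. This gives an
  entire limit and, later, the input for locating zeros.\<close>

lemma fdet_limit_rate:
  assumes "0 \<le> R"
  obtains C where "0 < C" "\<And>w n. cmod w \<le> R \<Longrightarrow> 1 \<le> n \<Longrightarrow> cmod (fdet n w - fdet_limit w) \<le> C * sqrt s ^ n"
proof -
  obtain K where K: "0 < K" "\<And>n. real (2 * n + 1) * s ^ n \<le> K * sqrt s ^ n"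
    using linear_times_power_le[OF s] by blast
  let ?E = "exp (2 * c * R * g * g)"
  have q: "0 < sqrt s" "sqrt s < 1" using s by auto
  have "cmod (fdet n w - fdet_limit w) \<le> K * ?E / (1 - sqrt s) * sqrt s ^ n" if "cmod w \<le> R" "1 \<le> n" for w n
    unfolding fdet_limit_def
  proof (rule geometric_limit(2)[OF q])
    fix n :: nat assume "1 \<le> n"
    from order_trans[OF fdet_Suc_diff[OF this that(1)] mult_right_mono[OF K(2), of ?E]]
    show "cmod (fdet n w - fdet (Suc n) w) \<le> K * ?E * sqrt s ^ n" by (simp add: mult_ac)
  qed (use K that in auto)
  then show ?thesis using that[of "K * ?E / (1 - sqrt s)"] K q by simp
qed

lemma fdet_holomorphic: "fdet n holomorphic_on S"
proof -
  let ?N = "2 * n - 1"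
  have "fdet n w = (\<Sum>p | p permutes {0..<?N}. of_int (sign p) *
      (\<Prod>i=0..<?N. one_minus n w (centred n i) (centred n (p i))))" for w
    unfolding fdet_def Determinant.det_def'[OF centred_mat_carrier]
  proof (intro sum.cong refl arg_cong2[where f = times] prod.cong)
    fix p i assume "p \<in> {p. p permutes {0..<?N}}" "i \<in> {0..<?N}"
    then show "centred_mat n (one_minus n w) $$ (i, p i) = one_minus n w (centred n i) (centred n (p i))"
      using permutes_in_image[of p "{0..<?N}" i] by simp
  qed
  then have eq: "fdet n = (\<lambda>w. \<Sum>p | p permutes {0..<?N}. of_int (sign p) *
      (\<Prod>i=0..<?N. one_minus n w (centred n i) (centred n (p i))))" by (rule ext)
  show ?thesis
    unfolding eq one_minus_def by (intro holomorphic_intros)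
qed

lemma fdet_limit_holomorphic: "fdet_limit holomorphic_on UNIV"
proof (rule holomorphic_uniform_sequence[OF open_UNIV fdet_holomorphic])
  fix x :: complex
  obtain C where C: "0 < C" "\<And>w n. cmod w \<le> cmod x + 1 \<Longrightarrow> 1 \<le> n \<Longrightarrow>
      cmod (fdet n w - fdet_limit w) \<le> C * sqrt s ^ n"
    using fdet_limit_rate[of "cmod x + 1"] by auto
  have "uniform_limit (cball x 1) fdet fdet_limit sequentially"
  proof (rule uniform_limitI)
    fix e :: real assume "0 < e"
    have "\<forall>\<^sub>F n in sequentially. C * sqrt s ^ n < e"
      by (rule eventually_geometric_less) (use s \<open>0 < e\<close> in auto)
    then show "\<forall>\<^sub>F n in sequentially. \<forall>w\<in>cball x 1. dist (fdet n w) (fdet_limit w) < e"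
      using eventually_ge_at_top[of 1]
    proof eventually_elim
      case (elim n)
      have "cmod w \<le> cmod x + 1" if "w \<in> cball x 1" for w
        using that norm_triangle_ineq[of x "w - x"] by (simp add: dist_norm norm_minus_commute)
      then show ?case using C(2)[OF _ elim(2)] elim(1) by (force simp: dist_norm)
    qed
  qed
  then show "\<exists>d>0. cball x d \<subseteq> UNIV \<and> uniform_limit (cball x d) fdet fdet_limit sequentially"
    by (intro exI[of _ 1]) auto
qed

lemma fdet_0: "fdet n 0 = 1"
proof -
  have "centred_mat n (one_minus n 0) = 1\<^sub>m (2 * n - 1)"
    by (rule eq_matI) (auto simp: one_minus_def centred_eq_iff)
  then show ?thesis by (simp add: fdet_def)
qed

text \<open>This excludes that the limit vanishes identically; its zeros are therefore isolated and
  of finite order.\<close>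

lemma fdet_limit_0: "fdet_limit 0 = 1"
  by (simp add: fdet_limit_def fdet_0)

text \<open>The coordinates of \<open>f\<close> in the orthonormal basis of normalised monomials,
  restricted to the block. In these coordinates the section acts by the matrix of
  \<open>weighted n\<close>.\<close>

definition weighted_vec :: "nat \<Rightarrow> (int \<Rightarrow> complex) \<Rightarrow> complex Matrix.vec" where
  "weighted_vec n f = Matrix.vec (2 * n - 1) (\<lambda>i. f (centred n i) * of_real (r ^ nat \<bar>centred n i\<bar>))"

lemma weighted_vec_carrier [simp]: "weighted_vec n f \<in> carrier_vec (2 * n - 1)"
  by (simp add: weighted_vec_def)

lemma weighted_vec_surj:
  assumes "v \<in> carrier_vec (2 * n - 1)"
  obtains f where "\<And>k. \<not> \<bar>k\<bar> < int n \<Longrightarrow> f k = 0" "weighted_vec n f = v"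
proof -
  define f where "f k = (if \<bar>k\<bar> < int n then vec_index v (nat (k + int n - 1)) / of_real (r ^ nat \<bar>k\<bar>) else 0)" for k
  have "weighted_vec n f = v"
  proof (rule eq_vecI)
    fix i assume "i < dim_vec v"
    then have i: "i < 2 * n - 1" using assms by simp
    have "nat (centred n i + int n - 1) = i" by (simp add: centred_def)
    then show "vec_index (weighted_vec n f) i = vec_index v i"
      using i abs_centred[OF i] r by (simp add: weighted_vec_def f_def)
  qed (use assms in \<open>simp add: weighted_vec_def\<close>)
  moreover have "f k = 0" if "\<not> \<bar>k\<bar> < int n" for k using that by (simp add: f_def)
  ultimately show ?thesis using that by blast
qed

lemma centred_mat_mult_index:
  assumes "i < 2 * n - 1"
  shows "vec_index (centred_mat n B *\<^sub>v weighted_vec n f) i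
    = (\<Sum>k | \<bar>k\<bar> < int n. B (centred n i) k * (f k * of_real (r ^ nat \<bar>k\<bar>)))"
proof -
  have "vec_index (centred_mat n B *\<^sub>v weighted_vec n f) i
      = (\<Sum>j=0..<2 * n - 1. B (centred n i) (centred n j) * (f (centred n j) * of_real (r ^ nat \<bar>centred n j\<bar>)))"
    using assms by (simp add: weighted_vec_def scalar_prod_def)
  then show ?thesis
    by (simp only: sum_centred[of "\<lambda>k. B (centred n i) k * (f k * of_real (r ^ nat \<bar>k\<bar>))"])
qed

lemma weighted_mult_index:
  assumes i: "i < 2 * n - 1"
  shows "vec_index (centred_mat n (weighted n) *\<^sub>v weighted_vec n f) i
    = kA n f (centred n i) * of_real (r ^ nat \<bar>centred n i\<bar>)"
  unfolding centred_mat_mult_index[OF i] kA_sum sum_distrib_right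
  using r by (intro sum.cong) (auto simp: weighted_def)

lemma one_minus_mult_index:
  assumes i: "i < 2 * n - 1"
  shows "vec_index (centred_mat n (one_minus n w) *\<^sub>v weighted_vec n f) i
    = (f (centred n i) - w * kA n f (centred n i)) * of_real (r ^ nat \<bar>centred n i\<bar>)"
proof -
  let ?l = "centred n i"
  have "vec_index (centred_mat n (one_minus n w) *\<^sub>v weighted_vec n f) i
      = (\<Sum>k | \<bar>k\<bar> < int n. (if ?l = k then f k * of_real (r ^ nat \<bar>k\<bar>) else 0))
        - w * (\<Sum>k | \<bar>k\<bar> < int n. weighted n ?l k * (f k * of_real (r ^ nat \<bar>k\<bar>)))"
    unfolding centred_mat_mult_index[OF i] sum_distrib_left sum_subtractf[symmetric]
    by (intro sum.cong) (auto simp: one_minus_def algebra_simps)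
  also have "(\<Sum>k | \<bar>k\<bar> < int n. (if ?l = k then f k * of_real (r ^ nat \<bar>k\<bar>) else 0)) = f ?l * of_real (r ^ nat \<bar>?l\<bar>)"
    using abs_centred[OF i] by (simp add: finite_abs_less)
  also have "(\<Sum>k | \<bar>k\<bar> < int n. weighted n ?l k * (f k * of_real (r ^ nat \<bar>k\<bar>))) = kA n f ?l * of_real (r ^ nat \<bar>?l\<bar>)"
    using weighted_mult_index[OF i, of f] unfolding centred_mat_mult_index[OF i] .
  finally show ?thesis by (simp add: algebra_simps)
qed

section \<open>Solving the section equations with bounds uniform in n\<close>

lemma obtain_centred:
  assumes "\<bar>l\<bar> < int n"
  obtains i where "i < 2 * n - 1" "l = centred n i"
proof -
  have "l \<in> centred n ` {0..<2 * n - 1}"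
    using assms bij_betw_imp_surj_on[OF centred_bij[of n]] by simp
  then show ?thesis using that by auto
qed

lemma section_bound:
  assumes w: "cmod w \<le> R" and b: "0 \<le> b" and m: "\<bar>m\<bar> < int n"
    and f: "\<And>l. \<bar>l\<bar> < int n \<Longrightarrow> cmod (f l - w * kA n f l) * r ^ nat \<bar>l\<bar> \<le> b * s ^ nat \<bar>l\<bar>"
  shows "cmod (f m) * r ^ nat \<bar>m\<bar> * cmod (fdet n w) \<le> b * exp ((2 * c * R * g + 1) * g)"
proof -
  obtain j where j: "j < 2 * n - 1" "m = centred n j" using obtain_centred[OF m] .
  have R: "0 \<le> R" using w norm_ge_zero order_trans by blast
  have "cmod (vec_index (weighted_vec n f) j) * cmod (Determinant.det (centred_mat n (one_minus n w)))
      \<le> b * exp ((2 * c * R * g + 1) * g)"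
  proof (rule cramer_centred_le[OF s _ b one_minus_le[OF w] weighted_vec_carrier j(1)])
    show "0 \<le> 2 * c * R" using c R by simp
    fix i assume i: "i < 2 * n - 1"
    show "cmod (vec_index (centred_mat n (one_minus n w) *\<^sub>v weighted_vec n f) i) \<le> b * s ^ nat \<bar>centred n i\<bar>"
      unfolding one_minus_mult_index[OF i] using f[OF abs_centred[OF i]] r by (simp add: norm_mult norm_power)
  qed
  then show ?thesis
    unfolding fdet_def[symmetric] using j r by (simp add: weighted_vec_def norm_mult norm_power)
qed

text \<open>The right-hand side lives on all indices, but A f lives on the block. With y the
  finitely supported solution of (1 - w A) y = A f, the sequence x = f + w y solves the equation on
  the whole space.\<close>

lemma section_solvable:
  assumes d: "fdet n w \<noteq> 0" and f: "f \<in> H2 r"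
  obtains x where "x \<in> H2 r" "(\<lambda>l. x l - w * kA n x l) = f"
proof -
  let ?M = "centred_mat n (one_minus n w)" and ?t = "weighted_vec n (kA n f)"
  have "?M \<in> Units (ring_mat TYPE(complex) (2 * n - 1) ())"
    using det_non_zero_imp_unit[OF centred_mat_carrier, of n "one_minus n w" "()"] d by (simp add: fdet_def)
  then obtain B where B: "B \<in> carrier_mat (2 * n - 1) (2 * n - 1)" "?M * B = 1\<^sub>m (2 * n - 1)"
    by (auto simp: Units_def ring_mat_def)
  have Bt: "B *\<^sub>v ?t \<in> carrier_vec (2 * n - 1)"
    by (rule mult_mat_vec_carrier[OF B(1) weighted_vec_carrier])
  obtain y where y: "\<And>k. \<not> \<bar>k\<bar> < int n \<Longrightarrow> y k = 0" "weighted_vec n y = B *\<^sub>v ?t"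
    using weighted_vec_surj[OF Bt] by blast
  have "?M *\<^sub>v weighted_vec n y = (?M * B) *\<^sub>v ?t"
    unfolding y(2) by (rule assoc_mult_mat_vec[OF centred_mat_carrier B(1) weighted_vec_carrier, symmetric])
  then have M: "?M *\<^sub>v weighted_vec n y = ?t"
    unfolding B(2) one_mult_mat_vec[OF weighted_vec_carrier] .
  have yl: "y l - w * kA n y l = kA n f l" for l
  proof (cases "\<bar>l\<bar> < int n")
    case True
    then obtain i where i: "i < 2 * n - 1" "l = centred n i" using obtain_centred by blast
    have "vec_index (?M *\<^sub>v weighted_vec n y) i = kA n f l * of_real (r ^ nat \<bar>l\<bar>)"
      unfolding M using i by (simp add: weighted_vec_def)
    then show ?thesis unfolding one_minus_mult_index[OF i(1)] using i r by simp
  qed (use y kA_support in auto)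
  have yH: "y \<in> H2 r" by (rule H2_I_support) (use y in auto)
  have wy: "(\<lambda>l. w * y l) \<in> H2 r" by (rule H2_scale(1)[OF r yH])
  have "(f l + w * y l) - w * kA n (\<lambda>k. f k + w * y k) l = f l" for l
  proof -
    have "(f l + w * y l) - w * kA n (\<lambda>k. f k + w * y k) l = f l + w * (y l - w * kA n y l) - w * kA n f l"
      unfolding kA_add[OF f wy] kernel_operator_scale by (simp add: algebra_simps)
    then show ?thesis unfolding yl by simp
  qed
  then show ?thesis using that[OF H2_add(1)[OF r f wy]] by (simp add: fun_eq_iff)
qed

text \<open>Put h = (1 - w A) x and y = A x. Then (1 - w A) y = A h, and A h decays, so Cramer's
  rule bounds the weighted entries of y. This is only a supremum bound, but y = A h + w A y, and
  applying A to y restores decay and with it a bound in norm; finally x = h + w y.\<close>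

lemma section_lower_bound:
  assumes \<kappa>: "0 < \<kappa>" and R: "0 \<le> R"
  obtains K where "0 < K" "\<And>n w x. \<lbrakk>cmod w \<le> R; \<kappa> \<le> cmod (fdet n w); x \<in> H2 r\<rbrakk> \<Longrightarrow>
    H2_norm r x \<le> K * H2_norm r (\<lambda>l. x l - w * kA n x l)"
proof -
  \<comment> \<open>\<open>b\<close> bounds the weighted entries of y per unit norm of h, by
    Cramer's rule with the determinant at least \<kappa>; \<open>K\<close> collects the two
    substitutions y = A h + w A y and x = h + w y.\<close>
  define b where "b = 2 * c * g * exp ((2 * c * R * g + 1) * g) / \<kappa>"
  define K where "K = 1 + R * (2 * c * g\<^sup>2 + R * (2 * c * g\<^sup>2 * b))"
  have b0: "0 \<le> b" using c g1 \<kappa> by (simp add: b_def)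
  have K0: "0 < K" unfolding K_def using R c b0 by (intro add_pos_nonneg) auto
  have "H2_norm r x \<le> K * H2_norm r (\<lambda>l. x l - w * kA n x l)"
    if w: "cmod w \<le> R" and d: "\<kappa> \<le> cmod (fdet n w)" and x: "x \<in> H2 r" for n w x
  proof -
    define h where "h = (\<lambda>l. x l - w * kA n x l)"
    define y where "y = kA n x"
    have y: "y \<in> H2 r" unfolding y_def by (rule A_H2(3)[OF x])
    have wy: "(\<lambda>l. w * y l) \<in> H2 r" by (rule H2_scale(1)[OF r y])
    have h: "h \<in> H2 r" unfolding h_def by (intro H2_diff(1)[OF r x] H2_scale(1)[OF r] A_H2(3)[OF x])
    let ?N = "H2_norm r h"
    have N: "0 \<le> ?N" by (rule H2_norm_nonneg[OF r])
    have Ah: "kA n h l = y l - w * kA n y l" for l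
      unfolding h_def using kA_diff[OF x wy] by (simp add: kernel_operator_scale y_def)
    have ym: "cmod (y m) * r ^ nat \<bar>m\<bar> \<le> b * ?N" for m
    proof (cases "\<bar>m\<bar> < int n")
      case True
      have "cmod (y m) * r ^ nat \<bar>m\<bar> * cmod (fdet n w) \<le> 2 * c * g * ?N * exp ((2 * c * R * g + 1) * g)"
        using A_H2(2)[OF h, of n] c g1 N by (intro section_bound[OF w _ True]) (auto simp: Ah)
      moreover have "cmod (y m) * r ^ nat \<bar>m\<bar> * \<kappa> \<le> cmod (y m) * r ^ nat \<bar>m\<bar> * cmod (fdet n w)"
        using d r by (intro mult_left_mono) auto
      ultimately have "cmod (y m) * r ^ nat \<bar>m\<bar> * \<kappa> \<le> 2 * c * g * ?N * exp ((2 * c * R * g + 1) * g)"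
        by linarith
      then have "cmod (y m) * r ^ nat \<bar>m\<bar> \<le> 2 * c * g * ?N * exp ((2 * c * R * g + 1) * g) / \<kappa>"
        using \<kappa> by (simp add: pos_le_divide_eq)
      then show ?thesis by (simp add: b_def mult_ac)
    next
      case False
      then show ?thesis using b0 N by (simp add: y_def kA_support)
    qed
    have Ay: "cmod (kA n y l) * r ^ nat \<bar>l\<bar> \<le> 2 * c * g * (b * ?N) * s ^ nat \<bar>l\<bar>" for l
      by (rule kernel_operator_bounded_seq(2)[OF r s _ A_bound ym]) (use c in simp)
    have AyH: "kA n y \<in> H2 r" by (rule A_H2(3)[OF y])
    have Ayn: "H2_norm r (kA n y) \<le> 2 * c * g\<^sup>2 * (b * ?N)"
      using H2_I_decay(2)[OF r less_imp_le[OF s(1)] s(2) _ Ay] c g1 b0 N by (simp add: power2_eq_square mult_ac)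
    have "y = (\<lambda>l. kA n h l + w * kA n y l)" using Ah by auto
    then have "H2_norm r y \<le> H2_norm r (kA n h) + cmod w * H2_norm r (kA n y)"
      using H2_add(2)[OF r A_H2(3)[OF h, of n] H2_scale(1)[OF r AyH, of w]] H2_scale(2)[OF r AyH, of w] by simp
    also have "\<dots> \<le> 2 * c * g\<^sup>2 * ?N + R * (2 * c * g\<^sup>2 * (b * ?N))"
      using A_H2(4)[OF h, of n] w R Ayn by (intro add_mono mult_mono H2_norm_nonneg r) auto
    finally have yn: "H2_norm r y \<le> 2 * c * g\<^sup>2 * ?N + R * (2 * c * g\<^sup>2 * (b * ?N))" .
    have "x = (\<lambda>l. h l + w * y l)" by (auto simp: h_def y_def)
    then have "H2_norm r x \<le> ?N + cmod w * H2_norm r y"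
      using H2_add(2)[OF r h wy] H2_scale(2)[OF r y, of w] by simp
    also have "\<dots> \<le> ?N + R * (2 * c * g\<^sup>2 * ?N + R * (2 * c * g\<^sup>2 * (b * ?N)))"
      using w R yn by (intro add_left_mono mult_mono H2_norm_nonneg r) auto
    also have "\<dots> = K * ?N" by (simp add: K_def algebra_simps)
    finally show ?thesis unfolding h_def .
  qed
  then show ?thesis using that[OF K0] by blast
qed

lemma zT_norm_le:
  assumes "f \<in> H2 r"
  shows "H2_norm r (\<lambda>l. z * f l - kT f l) \<le> (cmod z + c * g\<^sup>2) * H2_norm r f"
  using H2_diff(2)[OF r H2_scale(1)[OF r assms] T_H2(3)[OF assms], of z] H2_scale(2)[OF r assms, of z]
    T_H2(4)[OF assms] by (simp add: distrib_right)

lemma zT_diff: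
  assumes "f \<in> H2 r" "h \<in> H2 r"
  shows "(\<lambda>l. z * (f l - h l) - kT (\<lambda>k. f k - h k) l) = (\<lambda>l. (z * f l - kT f l) - (z * h l - kT h l))"
  using kT_diff[OF assms] by (auto simp: algebra_simps)

text \<open>Both halves of invertibility are inherited from the sections. The lower bound, uniform
  in n, passes to the limit. For surjectivity, the solutions of the section equations are
  approximate solutions of the limit equation and, by the lower bound, a Cauchy sequence.\<close>

lemma fdet_limit_nonzero_resolvent:
  assumes z: "z \<noteq> 0" and nz: "fdet_limit (1 / z) \<noteq> 0"
  shows "z \<notin> H2_spectrum r kT"
proof -
  define w where "w = 1 / z"
  \<comment> \<open>Half of the limit value: for large n the determinants of the sections stay above
    it.\<close>
  define \<kappa> where "\<kappa> = cmod (fdet_limit w) / 2"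
  have \<kappa>: "0 < \<kappa>" using nz by (simp add: \<kappa>_def w_def)
  obtain C where C: "0 < C" "\<And>n. 1 \<le> n \<Longrightarrow> cmod (fdet n w - fdet_limit w) \<le> C * sqrt s ^ n"
    using fdet_limit_rate[OF norm_ge_zero] order_refl by metis
  have "\<forall>\<^sub>F n in sequentially. C * sqrt s ^ n < \<kappa>"
    by (rule eventually_geometric_less) (use s \<kappa> in auto)
  then have "\<forall>\<^sub>F n in sequentially. \<kappa> \<le> cmod (fdet n w)"
    using eventually_ge_at_top[of 1]
  proof eventually_elim
    case (elim n)
    have "cmod (fdet_limit w) \<le> cmod (fdet n w) + cmod (fdet n w - fdet_limit w)"
      using norm_triangle_ineq4[of "fdet n w" "fdet n w - fdet_limit w"] by simp
    then show ?case using C(2)[OF elim(2)] elim(1) by (simp add: \<kappa>_def)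
  qed
  then obtain n0 where n0: "\<And>n. n0 \<le> n \<Longrightarrow> \<kappa> \<le> cmod (fdet n w)"
    by (auto simp: eventually_sequentially)
  obtain K where K: "0 < K" "\<And>n w' x. \<lbrakk>cmod w' \<le> cmod w; \<kappa> \<le> cmod (fdet n w'); x \<in> H2 r\<rbrakk> \<Longrightarrow>
      H2_norm r x \<le> K * H2_norm r (\<lambda>l. x l - w' * kA n x l)"
    using section_lower_bound[OF \<kappa>, of "cmod w"] by auto
  define B where "B = K * cmod w"
  have B0: "0 \<le> B" using K by (simp add: B_def)
  have eq: "x l - w * kA n x l = w * (z * x l - kA n x l)" for n x l
    using z by (simp add: w_def field_simps)
  have lower: "H2_norm r x \<le> B * H2_norm r (\<lambda>l. z * x l - kA n x l)" if "n0 \<le> n" "x \<in> H2 r" for n x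
    using K(2)[OF order_refl n0[OF that(1)] that(2)] H2_scale(2)[OF r zA_zT(1)[OF that(2)], of w z n]
    unfolding eq by (simp add: B_def mult.assoc)
  have rb: "resolvent_bound z B"
    unfolding resolvent_bound_def
  proof
    fix x assume x: "x \<in> H2 r"
    let ?t = "H2_norm r (\<lambda>l. z * x l - kT x l)"
    have "(\<lambda>n. B * (?t + c * g\<^sup>2 * H2_norm r x * s ^ n)) \<longlonglongrightarrow> B * (?t + 0)"
      by (intro tendsto_intros tendsto_error)
    moreover have "H2_norm r x \<le> B * (?t + c * g\<^sup>2 * H2_norm r x * s ^ n)" if "n0 \<le> n" for n
      using order_trans[OF lower[OF that x] mult_left_mono[OF zA_zT(3)[OF x] B0]] by (simp add: mult_ac)
    ultimately show "H2_norm r x \<le> B * ?t"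
      using LIMSEQ_le_const[of _ "B * (?t + 0)" "H2_norm r x"] by auto
  qed
  show ?thesis
  proof (rule not_in_spectrumI[OF rb])
    fix f assume f: "f \<in> H2 r"
    have "\<exists>x. x \<in> H2 r \<and> (\<lambda>l. z * x l - kA n x l) = f" if n: "n0 \<le> n" for n
    proof -
      have "fdet n w \<noteq> 0" using n0[OF n] \<kappa> by auto
      moreover have "(\<lambda>l. w * f l) \<in> H2 r" by (rule H2_scale(1)[OF r f])
      ultimately obtain x where x: "x \<in> H2 r" "(\<lambda>l. x l - w * kA n x l) = (\<lambda>l. w * f l)"
        using section_solvable by blast
      have "w \<noteq> 0" using z by (simp add: w_def)
      then have "(\<lambda>l. z * x l - kA n x l) = f" using x(2) unfolding eq by (simp add: fun_eq_iff)
      then show ?thesis using x by blast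
    qed
    then obtain x where x: "\<And>n. n0 \<le> n \<Longrightarrow> x n \<in> H2 r"
      "\<And>n. n0 \<le> n \<Longrightarrow> (\<lambda>l. z * x n l - kA n (x n) l) = f" by metis
    have xb: "H2_norm r (x n) \<le> B * H2_norm r f" if "n0 \<le> n" for n
      using lower[OF that x(1)[OF that]] x(2)[OF that] by simp
    let ?D = "c * g\<^sup>2 * (B * H2_norm r f)"
    have D0: "0 \<le> ?D" using c B0 H2_norm_nonneg[OF r] by simp
    have resid: "H2_norm r (\<lambda>l. (z * x n l - kT (x n) l) - f l) \<le> ?D * s ^ n" if n: "n0 \<le> n" for n
    proof -
      have "(\<lambda>l. (z * x n l - kT (x n) l) - f l) = (\<lambda>l. - (kT (x n) l - kA n (x n) l))"
        using fun_cong[OF x(2)[OF n]] by (auto simp: fun_eq_iff algebra_simps)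
      then have "H2_norm r (\<lambda>l. (z * x n l - kT (x n) l) - f l) \<le> c * g\<^sup>2 * s ^ n * H2_norm r (x n)"
        using T_minus_A(2)[OF x(1)[OF n], of n] by (simp only: H2_uminus(2))
      also have "\<dots> \<le> c * g\<^sup>2 * s ^ n * (B * H2_norm r f)"
        using xb[OF n] c s by (intro mult_left_mono) auto
      finally show ?thesis by (simp add: mult_ac)
    qed
    \<comment> \<open>Both section equations have the same right-hand side, so z - T maps the
      difference of the solutions to the difference of the two residuals.\<close>
    have cauchy: "H2_norm r (\<lambda>l. x n l - x m l) \<le> B * (?D * s ^ n + ?D * s ^ m)" if nm: "n0 \<le> n" "n0 \<le> m" for n m
    proof -
      have xn: "x n \<in> H2 r" and xm: "x m \<in> H2 r" using x(1) nm by auto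
      have d: "(\<lambda>l. x n l - x m l) \<in> H2 r" by (rule H2_diff(1)[OF r xn xm])
      have "H2_norm r (\<lambda>l. x n l - x m l)
          \<le> B * H2_norm r (\<lambda>l. z * (x n l - x m l) - kT (\<lambda>k. x n k - x m k) l)"
        using rb d unfolding resolvent_bound_def by blast
      also have "(\<lambda>l. z * (x n l - x m l) - kT (\<lambda>k. x n k - x m k) l)
          = (\<lambda>l. ((z * x n l - kT (x n) l) - f l) - ((z * x m l - kT (x m) l) - f l))"
        unfolding zT_diff[OF xn xm] by auto
      also have "H2_norm r \<dots> \<le> H2_norm r (\<lambda>l. (z * x n l - kT (x n) l) - f l)
          + H2_norm r (\<lambda>l. (z * x m l - kT (x m) l) - f l)"
        by (intro H2_diff(2)[OF r] H2_diff(1)[OF r] zT_H2 xn xm f)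
      also have "\<dots> \<le> ?D * s ^ n + ?D * s ^ m"
        using resid nm by (intro add_mono) auto
      finally show ?thesis using B0 by (simp add: mult_left_mono)
    qed
    have "\<exists>y\<in>H2 r. (\<lambda>k. H2_norm r (\<lambda>l. x (k + n0) l - y l)) \<longlonglongrightarrow> 0"
    proof (rule H2_complete[OF r])
      show "x (k + n0) \<in> H2 r" for k using x(1) by simp
      fix e :: real assume e: "0 < e"
      have "(\<lambda>n. B * (?D * s ^ n + ?D * s ^ n)) \<longlonglongrightarrow> B * (0 + 0)"
        by (intro tendsto_intros tendsto_error)
      then have "\<forall>\<^sub>F n in sequentially. B * (?D * s ^ n + ?D * s ^ n) < e"
        using e by (intro order_tendstoD(2)) auto
      then obtain N where N: "B * (?D * s ^ N + ?D * s ^ N) < e"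
        using eventually_happens'[OF sequentially_bot] by blast
      have "H2_norm r (\<lambda>l. x (k + n0) l - x (j + n0) l) < e" if "N \<le> k" "N \<le> j" for k j
      proof -
        have "B * (?D * s ^ (k + n0) + ?D * s ^ (j + n0)) \<le> B * (?D * s ^ N + ?D * s ^ N)"
          using s D0 B0 that by (intro mult_left_mono add_mono power_decreasing) auto
        then show ?thesis using cauchy[of "k + n0" "j + n0"] N by auto
      qed
      then show "\<exists>N. \<forall>k\<ge>N. \<forall>j\<ge>N. H2_norm r (\<lambda>l. x (k + n0) l - x (j + n0) l) < e" by blast
    qed
    then obtain y where y: "y \<in> H2 r" "(\<lambda>k. H2_norm r (\<lambda>l. x (k + n0) l - y l)) \<longlonglongrightarrow> 0" by blast
    let ?e = "\<lambda>l. (z * y l - kT y l) - f l"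
    have e: "?e \<in> H2 r" by (intro H2_diff(1)[OF r] zT_H2 y f)
    have "H2_norm r ?e \<le> 0"
    proof (rule LIMSEQ_le_const)
      have "(\<lambda>k. ?D * s ^ (k + n0) + (cmod z + c * g\<^sup>2) * H2_norm r (\<lambda>l. x (k + n0) l - y l))
          \<longlonglongrightarrow> 0 + (cmod z + c * g\<^sup>2) * 0"
        by (intro tendsto_intros y LIMSEQ_ignore_initial_segment[OF tendsto_error])
      then show "(\<lambda>k. ?D * s ^ (k + n0) + (cmod z + c * g\<^sup>2) * H2_norm r (\<lambda>l. x (k + n0) l - y l)) \<longlonglongrightarrow> 0"
        by simp
      have "H2_norm r ?e \<le> ?D * s ^ (k + n0) + (cmod z + c * g\<^sup>2) * H2_norm r (\<lambda>l. x (k + n0) l - y l)" for k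
      proof -
        let ?x = "x (k + n0)"
        have xk: "?x \<in> H2 r" using x(1) by simp
        have d: "(\<lambda>l. ?x l - y l) \<in> H2 r" by (rule H2_diff(1)[OF r xk y(1)])
        have "?e = (\<lambda>l. ((z * ?x l - kT ?x l) - f l) - (z * (?x l - y l) - kT (\<lambda>k. ?x k - y k) l))"
          using fun_cong[OF zT_diff[OF xk y(1), of z]] by (auto simp: fun_eq_iff algebra_simps)
        then have "H2_norm r ?e \<le> H2_norm r (\<lambda>l. (z * ?x l - kT ?x l) - f l)
            + H2_norm r (\<lambda>l. z * (?x l - y l) - kT (\<lambda>k. ?x k - y k) l)"
          using H2_diff(2)[OF r H2_diff(1)[OF r zT_H2[OF xk, of z] f] zT_H2[OF d, of z]] by simp
        then show ?thesis using resid[of "k + n0"] zT_norm_le[OF d, of z] by simp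
      qed
      then show "\<exists>N. \<forall>k\<ge>N. H2_norm r ?e \<le> ?D * s ^ (k + n0) + (cmod z + c * g\<^sup>2) * H2_norm r (\<lambda>l. x (k + n0) l - y l)"
        by blast
    qed
    from H2_norm_eq_0[OF r e this] have "(\<lambda>l. z * y l - kT y l) = f" by (auto simp: fun_eq_iff)
    then show "\<exists>x\<in>H2 r. (\<lambda>l. z * x l - kT x l) = f" using y by blast
  qed
qed

end

section \<open>Eigenvalues as zeros of the Fredholm determinants\<close>

text \<open>Near a zero of order \<nu> the limit is at least \<kappa> |w - w0|^\<nu>. On a circle
  where this equals 3 C q^n, the approximants are at least 2 C q^n, but at the centre they are at
  most C q^n. Without a zero in the disc, the maximum principle for the reciprocal would be
  violated.\<close>

lemma nearby_zeros:
  fixes p :: "complex \<Rightarrow> complex" and f :: "nat \<Rightarrow> complex \<Rightarrow> complex"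
  assumes p: "p holomorphic_on UNIV" "p w0 = 0" "p 0 \<noteq> 0"
    and f: "\<And>n. f n holomorphic_on UNIV"
    and q: "0 < q" "q < 1" and C: "0 < C"
    and rate: "\<And>w n. cmod w \<le> cmod w0 + 1 \<Longrightarrow> 1 \<le> n \<Longrightarrow> cmod (f n w - p w) \<le> C * q ^ n"
  obtains K q' n0 where "0 < K" "0 < q'" "q' < 1"
    "\<And>n::nat. n0 \<le> n \<Longrightarrow> \<exists>w. f n w = 0 \<and> cmod (w - w0) \<le> K * q' ^ n"
proof -
  have nc: "\<not> p constant_on UNIV" using p by (metis UNIV_I constant_on_def)
  obtain h e \<nu> where h: "0 < \<nu>" "0 < e" "h holomorphic_on ball w0 e"
    "\<And>w. w \<in> ball w0 e \<Longrightarrow> p w = (w - w0) ^ \<nu> * h w" "\<And>w. w \<in> ball w0 e \<Longrightarrow> h w \<noteq> 0"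
    using holomorphic_factor_zero_nonconstant[OF p(1) open_UNIV connected_UNIV UNIV_I p(2) nc] by metis
  \<comment> \<open>The cap at 1 keeps the disc inside the region where \<open>rate\<close> is
    available; e / 2 makes the closed disc fit into the open one, so that the cofactor attains a
    positive minimum.\<close>
  define d where "d = min (e / 2) 1"
  have d: "0 < d" "d \<le> 1" "cball w0 d \<subseteq> ball w0 e" using h(2) by (auto simp: d_def)
  have "continuous_on (cball w0 d) (\<lambda>w. cmod (h w))"
    using holomorphic_on_imp_continuous_on[OF h(3)] d(3) by (auto intro!: continuous_on_norm intro: continuous_on_subset)
  moreover have "cball w0 d \<noteq> {}" using d by auto
  ultimately obtain x where x: "x \<in> cball w0 d" "\<And>y. y \<in> cball w0 d \<Longrightarrow> cmod (h x) \<le> cmod (h y)"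
    using continuous_attains_inf[OF compact_cball] by metis
  define \<kappa> where "\<kappa> = cmod (h x)"
  have \<kappa>: "0 < \<kappa>" using x d h(5) by (auto simp: \<kappa>_def)
  have lower: "\<kappa> * cmod (w - w0) ^ \<nu> \<le> cmod (p w)" if "w \<in> cball w0 d" for w
    using x(2)[OF that] h(4)[of w] that d mult_right_mono[of \<kappa> "cmod (h w)" "cmod (w - w0) ^ \<nu>"]
    by (auto simp: norm_mult norm_power \<kappa>_def mult.commute)
  \<comment> \<open>Solving \<kappa> \<rho>^\<nu> = 3 C q^n for the radius gives \<rho> = K q'^n;
    the multiplicity \<nu> costs its root in the rate.\<close>
  define K where "K = root \<nu> (3 * C / \<kappa>)"
  define q' where "q' = root \<nu> q"
  have K: "0 < K" using h C \<kappa> by (simp add: K_def real_root_gt_zero)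
  have q': "0 < q'" "q' < 1" using h q by (auto simp: q'_def)
  have pow: "(K * q' ^ n) ^ \<nu> = 3 * C / \<kappa> * q ^ n" for n
  proof -
    have "(K * q' ^ n) ^ \<nu> = K ^ \<nu> * (q' ^ \<nu>) ^ n"
      by (simp add: power_mult_distrib power_mult[symmetric] mult.commute)
    moreover have "K ^ \<nu> = 3 * C / \<kappa>" "q' ^ \<nu> = q"
      unfolding K_def q'_def using h C \<kappa> q by (auto intro!: real_root_pow_pos2)
    ultimately show ?thesis by simp
  qed
  have "\<forall>\<^sub>F n in sequentially. K * q' ^ n < d"
    by (rule eventually_geometric_less) (use q' d in auto)
  then obtain n1 where n1: "\<And>n. n1 \<le> n \<Longrightarrow> K * q' ^ n < d"
    by (auto simp: eventually_sequentially)
  have "\<exists>w. f n w = 0 \<and> cmod (w - w0) \<le> K * q' ^ n" if n: "max 1 n1 \<le> n" for n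
  proof (rule ccontr)
    assume *: "\<nexists>w. f n w = 0 \<and> cmod (w - w0) \<le> K * q' ^ n"
    define \<rho> where "\<rho> = K * q' ^ n"
    have \<rho>: "0 < \<rho>" "\<rho> < d" using K q' n1 n by (auto simp: \<rho>_def)
    have nz: "f n w \<noteq> 0" if "w \<in> cball w0 \<rho>" for w
      using * that by (auto simp: \<rho>_def dist_norm norm_minus_commute)
    have close: "cmod (f n w - p w) \<le> C * q ^ n" if "w \<in> cball w0 \<rho>" for w
    proof (rule rate)
      show "cmod w \<le> cmod w0 + 1"
        using that \<rho> d norm_triangle_ineq[of w0 "w - w0"] by (simp add: dist_norm norm_minus_commute)
    qed (use n in simp)
    have pos: "0 < C * q ^ n" using C q by simp
    have "cmod (1 / f n w0) \<le> 1 / (2 * (C * q ^ n))"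
    proof (rule maximum_modulus_frontier[where S = "cball w0 \<rho>" and f = "\<lambda>w. 1 / f n w" and \<xi> = w0])
      show "(\<lambda>w. 1 / f n w) holomorphic_on interior (cball w0 \<rho>)"
        using nz interior_subset by (intro holomorphic_intros holomorphic_on_subset[OF f]) auto
      have "continuous_on (cball w0 \<rho>) (f n)"
        by (rule holomorphic_on_imp_continuous_on[OF holomorphic_on_subset[OF f]]) auto
      then show "continuous_on (closure (cball w0 \<rho>)) (\<lambda>w. 1 / f n w)"
        using nz by (auto intro!: continuous_intros)
      fix w assume "w \<in> frontier (cball w0 \<rho>)"
      then have w: "cmod (w - w0) = \<rho>" "w \<in> cball w0 \<rho>" by (auto simp: dist_norm norm_minus_commute)
      have "3 * (C * q ^ n) = \<kappa> * \<rho> ^ \<nu>" using \<kappa> by (simp add: \<rho>_def pow)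
      also have "\<dots> \<le> cmod (p w)" using lower[of w] w \<rho> by auto
      also have "\<dots> \<le> cmod (f n w) + cmod (f n w - p w)"
        using norm_triangle_ineq4[of "f n w" "f n w - p w"] by simp
      finally have "2 * (C * q ^ n) \<le> cmod (f n w)" using close[OF w(2)] by simp
      then show "cmod (1 / f n w) \<le> 1 / (2 * (C * q ^ n))"
        using pos by (simp add: norm_divide frac_le)
    qed (use \<rho> in auto)
    moreover have "0 < cmod (f n w0)" "cmod (f n w0) \<le> C * q ^ n" using nz[of w0] close[of w0] \<rho> p(2) by auto
    ultimately have "1 / (C * q ^ n) \<le> 1 / (2 * (C * q ^ n))"
      using frac_le[of 1 1 "cmod (f n w0)" "C * q ^ n"] by (simp add: norm_divide)
    moreover have "\<not> 1 / X \<le> 1 / (2 * X)" if "0 < X" for X :: real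
      using that by (simp add: field_simps)
    ultimately show False using pos by blast
  qed
  then show ?thesis using that K q' by blast
qed

lemma prod_list_gt_power:
  fixes b :: real
  assumes "0 \<le> b" "as \<noteq> []" "\<And>a. a \<in> set as \<Longrightarrow> b < f a"
  shows "b ^ length as < prod_list (map f as)"
  using assms(2,3)
proof (induction as)
  case (Cons a as)
  show ?case
  proof (cases "as = []")
    case False
    then have "b ^ length as < prod_list (map f as)" using Cons by simp
    moreover have "b < f a" using Cons by simp
    ultimately show ?thesis using assms(1) by (simp add: mult_strict_mono')
  qed (use Cons in simp)
qed simp

lemma sum_abs_centred: "(\<Sum>j=0..<2 * n - 1. nat \<bar>centred n j\<bar>) = n * (n - 1)"
proof -
  have "(\<Sum>k | \<bar>k\<bar> < int n. nat \<bar>k\<bar>) = n * (n - 1)"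
  proof (induction n)
    case (Suc n)
    show ?case
    proof (cases "n = 0")
      case True
      have "{k::int. \<bar>k\<bar> < int (Suc 0)} = {0}" by auto
      then show ?thesis using True by simp
    next
      case False
      have "{k. \<bar>k\<bar> < int (Suc n)} = insert (int n) (insert (- int n) {k. \<bar>k\<bar> < int n})" by auto
      then have "(\<Sum>k | \<bar>k\<bar> < int (Suc n). nat \<bar>k\<bar>) = n + (n + (\<Sum>k | \<bar>k\<bar> < int n. nat \<bar>k\<bar>))"
        using False by (simp add: finite_abs_less)
      also have "\<dots> = Suc n * (Suc n - 1)" unfolding Suc.IH using False by (cases n) auto
      finally show ?thesis .
    qed
  qed simp
  then show ?thesis by (simp only: sum_centred[of "\<lambda>k. nat \<bar>k\<bar>"])
qed

context finite_sections
begin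

lemma weighted_vec_eq_0: "weighted_vec n (\<lambda>_. 0) = 0\<^sub>v (2 * n - 1)"
  by (rule eq_vecI) (auto simp: weighted_vec_def)

lemma fdet_zero_eigenvalue:
  assumes z: "fdet n w = 0" and w: "w \<noteq> 0"
  shows "is_eigenvalue n (1 / w)"
proof -
  obtain v where v: "v \<in> carrier_vec (2 * n - 1)" "v \<noteq> 0\<^sub>v (2 * n - 1)"
    "centred_mat n (one_minus n w) *\<^sub>v v = 0\<^sub>v (2 * n - 1)"
    using z unfolding fdet_def det_0_iff_vec_prod_zero_field[OF centred_mat_carrier] by blast
  obtain f where f: "\<And>k. \<not> \<bar>k\<bar> < int n \<Longrightarrow> f k = 0" "weighted_vec n f = v"
    using weighted_vec_surj[OF v(1)] by blast
  have "kA n f l = 1 / w * f l" for l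
  proof (cases "\<bar>l\<bar> < int n")
    case True
    then obtain i where i: "i < 2 * n - 1" "l = centred n i" using obtain_centred by blast
    have "(f l - w * kA n f l) * of_real (r ^ nat \<bar>l\<bar>) = 0"
      using one_minus_mult_index[OF i(1), of w f] i v(3) f(2) by simp
    then show ?thesis using r w by (simp add: field_simps)
  qed (use f kA_support in auto)
  moreover have "f \<noteq> (\<lambda>_. 0)" using f(2) v(2) weighted_vec_eq_0 by auto
  ultimately show ?thesis unfolding is_eigenvalue_def using f(1) by blast
qed

lemma eigenvalue_weighted:
  assumes "eigenvalue (centred_mat n (weighted n)) \<mu>"
  shows "is_eigenvalue n \<mu>"
proof -
  obtain v where v: "v \<in> carrier_vec (2 * n - 1)" "v \<noteq> 0\<^sub>v (2 * n - 1)"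
    "centred_mat n (weighted n) *\<^sub>v v = \<mu> \<cdot>\<^sub>v v"
    using assms unfolding eigenvalue_def eigenvector_def by auto
  obtain f where f: "\<And>k. \<not> \<bar>k\<bar> < int n \<Longrightarrow> f k = 0" "weighted_vec n f = v"
    using weighted_vec_surj[OF v(1)] by blast
  have "kA n f l = \<mu> * f l" for l
  proof (cases "\<bar>l\<bar> < int n")
    case True
    then obtain i where i: "i < 2 * n - 1" "l = centred n i" using obtain_centred by blast
    have "vec_index (centred_mat n (weighted n) *\<^sub>v weighted_vec n f) i = \<mu> * vec_index (weighted_vec n f) i"
      unfolding f(2) v(3) using i(1) v(1) by simp
    then have "kA n f l * of_real (r ^ nat \<bar>l\<bar>) = \<mu> * (f l * of_real (r ^ nat \<bar>l\<bar>))"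
      unfolding weighted_mult_index[OF i(1)] using i by (simp add: weighted_vec_def)
    then show ?thesis using r by simp
  qed (use f kA_support in auto)
  moreover have "f \<noteq> (\<lambda>_. 0)" using f(2) v(2) weighted_vec_eq_0 by auto
  ultimately show ?thesis unfolding is_eigenvalue_def using f(1) by blast
qed

text \<open>The determinant is the product of the eigenvalues, and it decays superexponentially.\<close>

lemma small_eigenvalue:
  assumes n: "1 \<le> n"
  obtains \<mu> where "is_eigenvalue n \<mu>" "cmod \<mu> \<le> 2 * c * g * sqrt s ^ (n - 1)"
proof -
  \<comment> \<open>The row bounds multiply to (2 c g)^N s^(n (n - 1)). Spread over the N = 2 n - 1
    eigenvalues, the exponent n (n - 1) is more than (n - 1) / 2 for each, whence sqrt s^(n - 1).
    Not all eigenvalues can exceed this bound in modulus.\<close>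
  let ?N = "2 * n - 1" and ?M = "centred_mat n (weighted n)" and ?b = "2 * c * g * sqrt s ^ (n - 1)"
  have b0: "0 \<le> ?b" using c g1 s by simp
  obtain as where as: "char_poly ?M = (\<Prod>a\<leftarrow>as. [:- a, 1:])" "length as = ?N"
    using char_poly_factorized[OF centred_mat_carrier] by blast
  have ev: "is_eigenvalue n a" if "a \<in> set as" for a
    using that by (intro eigenvalue_weighted)
      (auto simp: eigenvalue_root_char_poly[OF centred_mat_carrier] as poly_prod_list prod_list_zero_iff image_iff)
  have "cmod (poly (char_poly ?M) 0) = cmod (Determinant.det (- char_matrix ?M 0))"
    unfolding char_poly_matrix[OF centred_mat_carrier] ..
  also have "\<dots> \<le> (\<Prod>i=0..<?N. \<Sum>j=0..<?N. 2 * c * s ^ nat \<bar>centred n i\<bar> * s ^ nat \<bar>centred n j\<bar>)"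
    by (rule norm_det_le) (auto simp: char_matrix_def intro!: weighted_le)
  also have "\<dots> \<le> (\<Prod>i=0..<?N. 2 * c * g * s ^ nat \<bar>centred n i\<bar>)"
  proof (rule prod_mono, rule conjI)
    fix i
    show "0 \<le> (\<Sum>j=0..<?N. 2 * c * s ^ nat \<bar>centred n i\<bar> * s ^ nat \<bar>centred n j\<bar>)"
      using c s by (intro sum_nonneg) auto
    have "2 * c * s ^ nat \<bar>centred n i\<bar> * (\<Sum>j=0..<?N. s ^ nat \<bar>centred n j\<bar>) \<le> 2 * c * s ^ nat \<bar>centred n i\<bar> * g"
      using c s by (intro mult_left_mono sum_power_centred_le) auto
    then show "(\<Sum>j=0..<?N. 2 * c * s ^ nat \<bar>centred n i\<bar> * s ^ nat \<bar>centred n j\<bar>) \<le> 2 * c * g * s ^ nat \<bar>centred n i\<bar>"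
      by (simp add: sum_distrib_left mult_ac)
  qed
  also have "\<dots> = (2 * c * g) ^ ?N * s ^ (n * (n - 1))"
    by (simp add: prod.distrib power_sum[symmetric] sum_abs_centred del: One_nat_def)
  also have "s ^ (n * (n - 1)) = sqrt s ^ (2 * (n * (n - 1)))"
    using s by (simp add: power_mult)
  also have "\<dots> \<le> sqrt s ^ ((n - 1) * ?N)"
    using s n by (intro power_decreasing) (auto simp: algebra_simps)
  also have "(2 * c * g) ^ ?N * sqrt s ^ ((n - 1) * ?N) = ?b ^ ?N"
    by (simp add: power_mult_distrib power_mult)
  finally have "cmod (poly (char_poly ?M) 0) \<le> ?b ^ ?N"
    using c g1 by (simp add: mult_left_mono)
  moreover have "cmod (poly (char_poly ?M) 0) = prod_list (map cmod as)"
    unfolding as(1) by (induction as) (auto simp: norm_mult)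
  ultimately have "\<not> ?b ^ length as < prod_list (map cmod as)" unfolding as(2) by simp
  moreover have "as \<noteq> []" using as(2) n by auto
  ultimately obtain a where "a \<in> set as" "cmod a \<le> ?b"
    using prod_list_gt_power[OF b0, of as cmod] by (meson not_le)
  then show ?thesis using that ev by blast
qed

text \<open>A non-zero spectral point is the reciprocal of a zero of the limit determinant, and
  inversion carries nearby zeros to nearby eigenvalues. The point 0 has no reciprocal; there
  \<open>small_eigenvalue\<close> applies directly.\<close>

lemma spectrum_approximation:
  assumes lam: "lam \<in> H2_spectrum r kT"
  obtains K q n0 where "0 < K" "0 < q" "q < 1"
    "\<And>n. n0 \<le> n \<Longrightarrow> \<exists>\<mu>. is_eigenvalue n \<mu> \<and> cmod (lam - \<mu>) \<le> K * q ^ n"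
proof (cases "lam = 0")
  case True
  have q: "0 < sqrt s" "sqrt s < 1" using s by auto
  have "\<exists>\<mu>. is_eigenvalue n \<mu> \<and> cmod (lam - \<mu>) \<le> (2 * c * g / sqrt s) * sqrt s ^ n" if n: "1 \<le> n" for n
  proof -
    have "2 * c * g * sqrt s ^ (n - 1) = (2 * c * g / sqrt s) * sqrt s ^ n"
      using q(1) n by (cases n) auto
    then show ?thesis using small_eigenvalue[OF n] True by (metis diff_0 norm_minus_cancel)
  qed
  then show ?thesis using that[of "2 * c * g / sqrt s" "sqrt s" 1] q c g1 by simp
next
  case False
  define w0 where "w0 = 1 / lam"
  have w0: "w0 \<noteq> 0" "lam = 1 / w0" using False by (auto simp: w0_def)
  have z: "fdet_limit w0 = 0" using fdet_limit_nonzero_resolvent[OF False] lam by (auto simp: w0_def)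
  obtain C where C: "0 < C" "\<And>w n. cmod w \<le> cmod w0 + 1 \<Longrightarrow> 1 \<le> n \<Longrightarrow>
      cmod (fdet n w - fdet_limit w) \<le> C * sqrt s ^ n"
    using fdet_limit_rate[of "cmod w0 + 1"] by auto
  have q: "0 < sqrt s" "sqrt s < 1" using s by auto
  obtain K q n0 where K: "0 < K" "0 < q" "q < 1"
    "\<And>n. n0 \<le> n \<Longrightarrow> \<exists>w. fdet n w = 0 \<and> cmod (w - w0) \<le> K * q ^ n"
  proof (rule nearby_zeros[OF fdet_limit_holomorphic z _ fdet_holomorphic q C(1)])
    show "fdet_limit 0 \<noteq> 0" by (simp add: fdet_limit_0)
  qed (use C(2) in blast)+
  \<comment> \<open>Keeps the zeros at distance at least |w0| / 2 from the origin, so that inversion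
    is Lipschitz on them.\<close>
  have "\<forall>\<^sub>F n in sequentially. K * q ^ n < cmod w0 / 2"
    by (rule eventually_geometric_less) (use K w0 in auto)
  then obtain n1 where n1: "\<And>n. n1 \<le> n \<Longrightarrow> K * q ^ n < cmod w0 / 2"
    by (auto simp: eventually_sequentially)
  let ?K = "2 * K / (cmod w0)\<^sup>2"
  have "\<exists>\<mu>. is_eigenvalue n \<mu> \<and> cmod (lam - \<mu>) \<le> ?K * q ^ n" if n: "max n0 n1 \<le> n" for n
  proof -
    obtain w where w: "fdet n w = 0" "cmod (w - w0) \<le> K * q ^ n" using K(4)[of n] n by auto
    have wn: "w \<noteq> 0" using w(1) fdet_0 by auto
    have "cmod w0 \<le> cmod w + cmod (w - w0)" using norm_triangle_ineq4[of w "w - w0"] by simp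
    then have half: "cmod w0 / 2 \<le> cmod w" using w(2) n1[of n] n by simp
    have "lam - 1 / w = (w - w0) / (w * w0)" using w0 wn by (simp add: field_simps)
    then have "cmod (lam - 1 / w) = cmod (w - w0) / (cmod w * cmod w0)" by (simp add: norm_divide norm_mult)
    also have "\<dots> \<le> (K * q ^ n) / (cmod w0 / 2 * cmod w0)"
      using w half w0 K by (intro frac_le mult_right_mono) auto
    also have "\<dots> = ?K * q ^ n" by (simp add: power2_eq_square)
    finally show ?thesis using fdet_zero_eigenvalue[OF w(1) wn] by blast
  qed
  then show ?thesis using that[of ?K q "max n0 n1"] K w0 by auto
qed

text \<open>The non-zero spectrum lies among the reciprocals of the zeros of an entire function that
  does not vanish identically. This guarantees that the circle chosen in
  \<open>riesz_projection\<close> exists.\<close>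

lemma spectrum_isolated:
  assumes lam: "lam \<in> H2_spectrum r kT" "lam \<noteq> 0"
  obtains \<epsilon> where "0 < \<epsilon>" "H2_spectrum r kT \<inter> cball lam \<epsilon> = {lam}"
proof -
  have z: "fdet_limit (1 / lam) = 0" using fdet_limit_nonzero_resolvent[OF lam(2)] lam by auto
  obtain e where e: "0 < e" "\<And>w. w \<in> ball (1 / lam) e - {1 / lam} \<Longrightarrow> fdet_limit w \<noteq> 0"
    using isolated_zeros[OF fdet_limit_holomorphic open_UNIV connected_UNIV UNIV_I z UNIV_I[of 0]] fdet_limit_0
    by (metis zero_neq_one)
  have "((\<lambda>x. 1 / x) \<longlongrightarrow> 1 / lam) (at lam)" using lam(2) by (intro tendsto_intros)
  then have "\<forall>\<^sub>F x in at lam. dist (1 / x) (1 / lam) < e" using e(1) by (rule tendstoD)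
  then obtain d where d: "0 < d" "\<And>x. x \<noteq> lam \<Longrightarrow> dist x lam < d \<Longrightarrow> dist (1 / x) (1 / lam) < e"
    unfolding eventually_at by auto
  \<comment> \<open>The second term keeps the closed disc away from 0, where the determinant
    criterion does not apply.\<close>
  define \<epsilon> where "\<epsilon> = min (d / 2) (cmod lam / 2)"
  have "0 < \<epsilon>" "\<epsilon> \<le> d / 2" "\<epsilon> \<le> cmod lam / 2" using d lam by (auto simp: \<epsilon>_def)
  then have \<epsilon>: "0 < \<epsilon>" "\<epsilon> < d" "\<epsilon> < cmod lam" using d(1) by linarith+
  have "x = lam" if x: "x \<in> H2_spectrum r kT" "x \<in> cball lam \<epsilon>" for x
  proof (rule ccontr)
    assume "x \<noteq> lam"
    have "x \<noteq> 0" using x(2) \<epsilon>(3) by auto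
    have "dist (1 / x) (1 / lam) < e" using d(2)[OF \<open>x \<noteq> lam\<close>] x(2) \<epsilon> by (simp add: dist_commute)
    moreover have "1 / x \<noteq> 1 / lam" using \<open>x \<noteq> lam\<close> by simp
    ultimately have "fdet_limit (1 / x) \<noteq> 0" by (intro e(2)) (simp add: dist_commute)
    then show False using fdet_limit_nonzero_resolvent[OF \<open>x \<noteq> 0\<close>] x by simp
  qed
  moreover have "lam \<in> cball lam \<epsilon>" using \<epsilon>(1) by simp
  ultimately have "H2_spectrum r kT \<inter> cball lam \<epsilon> = {lam}" using lam(1) by blast
  then show ?thesis using that \<epsilon>(1) by blast
qed

section \<open>Spectral projections\<close>

lemma resolvent_bound_mono: "resolvent_bound z B \<Longrightarrow> B \<le> B' \<Longrightarrow> resolvent_bound z B'"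
  unfolding resolvent_bound_def by (meson H2_norm_nonneg[OF r] mult_right_mono order_trans)

text \<open>The term (z - z') f is absorbed into the left-hand side, at the price of doubling the
  bound. No surjectivity enters.\<close>

lemma resolvent_bound_perturb:
  assumes B: "resolvent_bound z B" "0 < B" and z': "cmod (z - z') * B \<le> 1 / 2"
  shows "resolvent_bound z' (2 * B)"
  unfolding resolvent_bound_def
proof
  fix f assume f: "f \<in> H2 r"
  let ?d = "H2_norm r (\<lambda>l. z' * f l - kT f l)"
  have "(\<lambda>l. z * f l - kT f l) = (\<lambda>l. (z' * f l - kT f l) + (z - z') * f l)" by (auto simp: algebra_simps)
  then have "H2_norm r (\<lambda>l. z * f l - kT f l) \<le> ?d + cmod (z - z') * H2_norm r f"
    using H2_add(2)[OF r zT_H2[OF f, of z'] H2_scale(1)[OF r f, of "z - z'"]] H2_scale(2)[OF r f, of "z - z'"]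
    by simp
  then have "H2_norm r f \<le> B * (?d + cmod (z - z') * H2_norm r f)"
    using B f order_trans[OF _ mult_left_mono] unfolding resolvent_bound_def by (meson less_imp_le)
  also have "\<dots> = B * ?d + (cmod (z - z') * B) * H2_norm r f" by (simp add: algebra_simps)
  also have "\<dots> \<le> B * ?d + 1 / 2 * H2_norm r f"
    using z' H2_norm_nonneg[OF r] by (intro add_left_mono mult_right_mono) auto
  finally show "H2_norm r f \<le> 2 * B * ?d" by simp
qed

lemma resolvent_bound_compact:
  assumes S: "compact S" "S \<inter> H2_spectrum r kT = {}"
  obtains B where "0 < B" "\<And>z. z \<in> S \<Longrightarrow> resolvent_bound z B"
proof -
  have "\<exists>b. 0 < b \<and> resolvent_bound z b" if z: "z \<in> S" for z
  proof -
    have "z \<notin> H2_spectrum r kT" using z S by blast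
    from not_in_spectrumD[OF this] show ?thesis by blast
  qed
  then obtain b where b: "\<And>z. z \<in> S \<Longrightarrow> 0 < b z \<and> resolvent_bound z (b z)" by metis
  obtain F where F: "F \<subseteq> S" "finite F" "S \<subseteq> (\<Union>z\<in>F. ball z (1 / (2 * b z)))"
  proof (rule compactE_image[OF S(1), of S "\<lambda>z. ball z (1 / (2 * b z))"])
    have "z \<in> ball z (1 / (2 * b z))" if "z \<in> S" for z using b[OF that] by simp
    then show "S \<subseteq> (\<Union>z\<in>S. ball z (1 / (2 * b z)))" by blast
  qed (use that in auto)
  \<comment> \<open>A common upper bound for the finitely many local bounds; the summand 1 keeps it
    positive if the cover is empty.\<close>
  define B where "B = (\<Sum>z\<in>F. 2 * b z) + 1"
  have nonneg: "0 \<le> 2 * b z" if "z \<in> F" for z using b[of z] that F(1) by auto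
  have "0 < B" unfolding B_def using sum_nonneg[of F "\<lambda>z. 2 * b z"] nonneg by fastforce
  moreover have "resolvent_bound z B" if z: "z \<in> S" for z
  proof -
    obtain y where y: "y \<in> F" "z \<in> ball y (1 / (2 * b y))" using F(3) z by blast
    have by': "0 < b y" "resolvent_bound y (b y)" using b y F by auto
    have "cmod (y - z) * b y \<le> 1 / (2 * b y) * b y"
      using y(2) by' by (intro mult_right_mono) (auto simp: dist_norm)
    then have "resolvent_bound z (2 * b y)"
      using by' by (intro resolvent_bound_perturb) auto
    moreover have "2 * b y \<le> B"
      unfolding B_def using member_le_sum[of y F "\<lambda>z. 2 * b z"] y(1) F(2) nonneg by auto
    ultimately show ?thesis by (rule resolvent_bound_mono)
  qed
  ultimately show ?thesis using that by blast
qed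

lemma H2_resolvent:
  assumes "z \<notin> H2_spectrum r kT" "f \<in> H2 r"
  shows "H2_resolvent r kT z f \<in> H2 r"
    "(\<lambda>l. z * H2_resolvent r kT z f l - kT (H2_resolvent r kT z f) l) = f"
proof -
  from not_in_spectrumD[OF assms(1)] obtain B where
    B: "resolvent_bound z B" "\<And>f. f \<in> H2 r \<Longrightarrow> \<exists>x\<in>H2 r. (\<lambda>l. z * x l - kT x l) = f" by blast
  obtain x where x: "x \<in> H2 r" "(\<lambda>l. z * x l - kT x l) = f" using B(2)[OF assms(2)] by blast
  have "H2_resolvent r kT z f = x"
    unfolding H2_resolvent_def using x resolvent_bound_inj[OF B(1)] by (intro the_equality) auto
  then show "H2_resolvent r kT z f \<in> H2 r"
    "(\<lambda>l. z * H2_resolvent r kT z f l - kT (H2_resolvent r kT z f) l) = f" using x by simp_all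
qed

text \<open>By the resolvent identity x - T maps the difference of the two resolvents at
  \<open>f\<close> to (y - x) times the resolvent at y. Lipschitz continuity of each coefficient
  makes the contour integrals in \<open>riesz_projection\<close> exist.\<close>

lemma H2_resolvent_continuous:
  assumes S: "S \<inter> H2_spectrum r kT = {}" and B: "0 < B" "\<And>z. z \<in> S \<Longrightarrow> resolvent_bound z B" and f: "f \<in> H2 r"
  shows "continuous_on S (\<lambda>z. H2_resolvent r kT z f l)"
proof (rule lipschitz_on_continuous_on, rule lipschitz_onI)
  let ?R = "\<lambda>z. H2_resolvent r kT z f" and ?L = "B * (B * H2_norm r f) / r ^ nat \<bar>l\<bar>"
  show "0 \<le> ?L" using B r H2_norm_nonneg[OF r] by simp
  fix x y assume xy: "x \<in> S" "y \<in> S"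
  have X: "?R x \<in> H2 r" "(\<lambda>l. x * ?R x l - kT (?R x) l) = f"
    and Y: "?R y \<in> H2 r" "(\<lambda>l. y * ?R y l - kT (?R y) l) = f"
    using H2_resolvent[OF _ f] S xy by auto
  have d: "(\<lambda>l. ?R x l - ?R y l) \<in> H2 r" by (rule H2_diff(1)[OF r X(1) Y(1)])
  have "(\<lambda>l. x * (?R x l - ?R y l) - kT (\<lambda>k. ?R x k - ?R y k) l) = (\<lambda>l. (y - x) * ?R y l)"
    unfolding zT_diff[OF X(1) Y(1)] using fun_cong[OF X(2)] fun_cong[OF Y(2)]
    by (auto simp: fun_eq_iff algebra_simps)
  then have "H2_norm r (\<lambda>l. ?R x l - ?R y l) \<le> B * (cmod (y - x) * H2_norm r (?R y))"
    using B(2)[OF xy(1)] d H2_scale(2)[OF r Y(1), of "y - x"] unfolding resolvent_bound_def by fastforce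
  also have "\<dots> \<le> B * (cmod (y - x) * (B * H2_norm r f))"
    using B(2)[OF xy(2)] Y B(1) unfolding resolvent_bound_def by (intro mult_left_mono) auto
  finally have "cmod (?R x l - ?R y l) * r ^ nat \<bar>l\<bar> \<le> B * (cmod (y - x) * (B * H2_norm r f))"
    using H2_coeff_le[OF d r, of l] by linarith
  then show "dist (?R x l) (?R y l) \<le> ?L * dist x y"
    using r by (simp add: dist_norm norm_minus_commute field_simps)
qed

text \<open>On a generalised eigenvector the resolvent of a matrix is an explicit finite Laurent expansion.\<close>

definition shift :: "nat \<Rightarrow> complex \<Rightarrow> (int \<Rightarrow> complex) \<Rightarrow> int \<Rightarrow> complex" where
  "shift n \<mu> f = (\<lambda>l. \<mu> * f l - kA n f l)"

definition laurent_resolvent :: "nat \<Rightarrow> complex \<Rightarrow> nat \<Rightarrow> (int \<Rightarrow> complex) \<Rightarrow> complex \<Rightarrow> int \<Rightarrow> complex" where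
  "laurent_resolvent n \<mu> \<nu> h z = (\<lambda>k. \<Sum>j<\<nu>. (- 1) ^ j * (shift n \<mu> ^^ j) h k / (z - \<mu>) ^ Suc j)"

lemma shift_pow_support:
  assumes "\<forall>k. \<not> \<bar>k\<bar> < int n \<longrightarrow> h k = 0" "\<not> \<bar>k\<bar> < int n"
  shows "(shift n \<mu> ^^ j) h k = 0"
  using assms by (induction j) (auto simp: shift_def kA_support)

lemma laurent_resolvent_H2:
  assumes "\<forall>k. \<not> \<bar>k\<bar> < int n \<longrightarrow> h k = 0"
  shows "laurent_resolvent n \<mu> \<nu> h z \<in> H2 r"
  unfolding laurent_resolvent_def
  by (intro H2_I_support[of n] sum.neutral ballI) (simp add: shift_pow_support[OF assms])

text \<open>With N = \<mu> - A, the operator \<open>shift n \<mu>\<close>, one has z - A = (z -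
  \<mu>) + N. The sum is the Neumann series of the inverse, with alternating signs because N carries
  -A; it is finite since N is nilpotent on \<open>h\<close>, and the product with z - A
  telescopes.\<close>

lemma laurent_resolvent_inverse:
  assumes nil: "(shift n \<mu> ^^ \<nu>) h = (\<lambda>_. 0)" and z: "z \<noteq> \<mu>"
  shows "(\<lambda>l. z * laurent_resolvent n \<mu> \<nu> h z l - kA n (laurent_resolvent n \<mu> \<nu> h z) l) = h"
proof
  fix l
  let ?N = "shift n \<mu>" and ?u = "laurent_resolvent n \<mu> \<nu> h z"
  let ?c = "\<lambda>j. (- 1) ^ j / (z - \<mu>) ^ Suc j" and ?d = "\<lambda>j. (- 1) ^ j / (z - \<mu>) ^ j * (?N ^^ j) h l"
  have "kA n ?u l = (\<Sum>j<\<nu>. ?c j * kA n ((?N ^^ j) h) l)"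
    unfolding kA_sum laurent_resolvent_def sum_distrib_left by (subst sum.swap) (simp add: mult_ac)
  then have "z * ?u l - kA n ?u l = (\<Sum>j<\<nu>. z * (?c j * (?N ^^ j) h l) - ?c j * kA n ((?N ^^ j) h) l)"
    by (simp add: laurent_resolvent_def sum_distrib_left sum_subtractf)
  also have "\<dots> = (\<Sum>j<\<nu>. ?d j - ?d (Suc j))"
  proof (rule sum.cong[OF refl])
    fix j
    have N: "kA n ((?N ^^ j) h) l = \<mu> * (?N ^^ j) h l - (?N ^^ Suc j) h l" by (simp add: shift_def)
    have alg: "z * (e * a) - e * (\<mu> * a - b) = e * (z - \<mu>) * a + e * b" for e a b
      by (simp add: algebra_simps)
    have "?c j * (z - \<mu>) = (- 1) ^ j / (z - \<mu>) ^ j" using z by simp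
    then show "z * (?c j * (?N ^^ j) h l) - ?c j * kA n ((?N ^^ j) h) l = ?d j - ?d (Suc j)"
      unfolding N alg by (simp del: funpow.simps)
  qed
  also have "\<dots> = ?d 0 - ?d \<nu>" by (rule sum_lessThan_telescope')
  finally show "z * ?u l - kA n ?u l = h l" using nil by simp
qed

text \<open>Only the simple pole has a residue, and its coefficient is \<open>h\<close>: the Riesz
  projection of the section fixes its generalised eigenvectors.\<close>

lemma laurent_resolvent_contour_integral:
  assumes "0 < \<nu>" and \<mu>: "\<mu> \<in> ball a \<epsilon>"
  shows "((\<lambda>z. laurent_resolvent n \<mu> \<nu> h z k) has_contour_integral 2 * of_real pi * \<i> * h k) (circlepath a \<epsilon>)"
proof -
  let ?g = "\<lambda>j. (- 1) ^ j * (shift n \<mu> ^^ j) h k"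
  have int: "((\<lambda>z. \<Sum>j<\<nu>. ?g j / (z - \<mu>) ^ Suc j) has_contour_integral
      (\<Sum>j<\<nu>. 2 * of_real pi * \<i> / fact j * (deriv ^^ j) (\<lambda>_. ?g j) \<mu>)) (circlepath a \<epsilon>)"
  proof (rule has_contour_integral_sum)
    fix j
    show "((\<lambda>z. ?g j / (z - \<mu>) ^ Suc j) has_contour_integral
        2 * of_real pi * \<i> / fact j * (deriv ^^ j) (\<lambda>_. ?g j) \<mu>) (circlepath a \<epsilon>)"
      \<comment> \<open>The numerator is constant in z, so its derivatives of positive order, and
        with them the integrals over the higher poles, vanish.\<close>
      using Cauchy_has_contour_integral_higher_derivative_circlepath[OF continuous_on_const holomorphic_on_const \<mu>,
          of "?g j" j]
      by (simp only: of_real_mult of_real_numeral)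
  qed simp
  have "(\<Sum>j<\<nu>. 2 * of_real pi * \<i> / fact j * (deriv ^^ j) (\<lambda>_. ?g j) \<mu>)
      = (\<Sum>j<\<nu>. if j = 0 then 2 * of_real pi * \<i> * h k else 0)"
    by (intro sum.cong) auto
  also have "\<dots> = 2 * of_real pi * \<i> * h k" using assms(1) by simp
  finally show ?thesis using int unfolding laurent_resolvent_def by (simp only:)
qed

text \<open>On the circle the resolvent of the operator at \<open>h n\<close> is compared with that
  of the section, whose integral returns exactly \<open>h n\<close> once \<open>\<mu> n\<close> lies
  inside. Since the projection is integrated coefficientwise, the comparison needs a bound that is
  summable over the coefficients; a bound in norm would not suffice.\<close>

lemma riesz_projection_generalised_eigenvectors:
  assumes lam: "lam \<in> H2_spectrum r kT" "lam \<noteq> 0" and \<mu>: "\<mu> \<longlonglongrightarrow> lam"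
    and h: "\<And>n k. 1 \<le> n \<Longrightarrow> \<not> \<bar>k\<bar> < int n \<Longrightarrow> h n k = 0" "\<And>n. 1 \<le> n \<Longrightarrow> H2_norm r (h n) = 1"
    and nil: "\<And>n. 1 \<le> n \<Longrightarrow> \<exists>\<nu>. (shift n (\<mu> n) ^^ \<nu>) (h n) = (\<lambda>_. 0)"
  obtains K where
    "\<forall>\<^sub>F n in sequentially. H2_norm r (\<lambda>k. riesz_projection r kT lam (h n) k - h n k) \<le> K * s ^ n"
proof -
  define \<epsilon> where "\<epsilon> = (SOME \<epsilon>. \<epsilon> > 0 \<and> H2_spectrum r kT \<inter> cball lam \<epsilon> = {lam})"
  have "\<exists>\<epsilon>. \<epsilon> > 0 \<and> H2_spectrum r kT \<inter> cball lam \<epsilon> = {lam}" using spectrum_isolated[OF lam] by blast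
  from someI_ex[OF this] have \<epsilon>: "0 < \<epsilon>" "H2_spectrum r kT \<inter> cball lam \<epsilon> = {lam}" by (simp_all add: \<epsilon>_def)
  let ?S = "sphere lam \<epsilon>" and ?R = "H2_resolvent r kT"
  have riesz: "riesz_projection r kT lam f k
      = 1 / (2 * of_real pi * \<i>) * contour_integral (circlepath lam \<epsilon>) (\<lambda>z. ?R z f k)" for f k
    by (simp add: riesz_projection_def \<epsilon>_def Let_def)
  have S: "?S \<inter> H2_spectrum r kT = {}" using \<epsilon> by (auto simp: set_eq_iff)
  obtain B where B: "0 < B" "\<And>z. z \<in> ?S \<Longrightarrow> resolvent_bound z B"
    using resolvent_bound_compact[OF compact_sphere S] by blast
  have "0 \<notin> cball lam \<epsilon>"
  proof
    assume "0 \<in> cball lam \<epsilon>"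
    then have "0 \<in> H2_spectrum r kT \<inter> cball lam \<epsilon>" using zero_in_spectrum by simp
    then show False using \<epsilon>(2) lam(2) by simp
  qed
  \<comment> \<open>The distance of the circle from the origin. It is positive because 0 is a
    spectral point other than lam and hence lies outside the closed disc.\<close>
  define z0 where "z0 = cmod lam - \<epsilon>"
  have z0: "0 < z0" using \<open>0 \<notin> cball lam \<epsilon>\<close> by (simp add: z0_def)
  have z0_le: "z0 \<le> cmod z" if "z \<in> ?S" for z
    using that norm_triangle_ineq2[of lam "lam - z"] by (simp add: z0_def dist_norm)
  \<comment> \<open>The two summands bound (T - A) u and T d in the identity z d = (T - A) u + T d
    for the difference d of the resolvents, where u has norm at most 2 B; dividing by z costs 1 /
    z0.\<close>
  define M where "M = (c * g * (2 * B) + c * g * (B * (c * g\<^sup>2 * (2 * B)))) / z0"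
  have M0: "0 \<le> M" using B c g1 z0 by (simp add: M_def)
  have "(\<lambda>n. B * (c * g\<^sup>2) * s ^ n) \<longlonglongrightarrow> 0" by (rule tendsto_error)
  then have "\<forall>\<^sub>F n in sequentially. B * (c * g\<^sup>2) * s ^ n < 1 / 2" by (rule order_tendstoD(2)) simp
  moreover have "\<forall>\<^sub>F n in sequentially. dist (\<mu> n) lam < \<epsilon>" by (rule tendstoD[OF \<mu> \<epsilon>(1)])
  moreover note eventually_ge_at_top[of 1]
  ultimately have "\<forall>\<^sub>F n in sequentially.
      H2_norm r (\<lambda>k. riesz_projection r kT lam (h n) k - h n k) \<le> \<epsilon> * M * g * s ^ n"
  proof eventually_elim
    case (elim n)
    obtain \<nu> where "(shift n (\<mu> n) ^^ \<nu>) (h n) = (\<lambda>_. 0)" using nil[OF elim(3)] by blast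
    moreover have "shift n (\<mu> n) (\<lambda>_. 0) = (\<lambda>_. 0)" by (auto simp: shift_def kernel_operator_def)
    \<comment> \<open>Raising the exponent by one makes it positive, so that the expansion contains
      the simple pole.\<close>
    ultimately have nil': "(shift n (\<mu> n) ^^ Suc \<nu>) (h n) = (\<lambda>_. 0)" by simp
    define u where "u = laurent_resolvent n (\<mu> n) (Suc \<nu>) (h n)"
    have h0: "\<forall>k. \<not> \<bar>k\<bar> < int n \<longrightarrow> h n k = 0" using h(1)[OF elim(3)] by blast
    have hH: "h n \<in> H2 r" by (rule H2_I_support[OF h(1)[OF elim(3)]])
    have dbound: "cmod (?R z (h n) l - u z l) \<le> M * s ^ n * (s ^ nat \<bar>l\<bar> / r ^ nat \<bar>l\<bar>)" if z: "z \<in> ?S" for z l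
    proof -
      have "z \<noteq> \<mu> n" using z elim(2) by (auto simp: dist_commute)
      note u = laurent_resolvent_H2[OF h0, of "\<mu> n" "Suc \<nu>" z, folded u_def]
        laurent_resolvent_inverse[OF nil' this, folded u_def]
      have zs: "z \<notin> H2_spectrum r kT" using z S by blast
      have Rz: "?R z (h n) \<in> H2 r" "(\<lambda>l. z * ?R z (h n) l - kT (?R z (h n)) l) = h n"
        using H2_resolvent[OF zs hH] .
      have "H2_norm r (u z) \<le> B * H2_norm r (\<lambda>l. z * u z l - kT (u z) l)"
        using B(2)[OF z] u(1) by (simp add: resolvent_bound_def)
      also have "\<dots> \<le> B * (1 + c * g\<^sup>2 * s ^ n * H2_norm r (u z))"
        using zA_zT(2)[OF u(1), of z n] h(2)[OF elim(3)] B(1) unfolding u(2) by (intro mult_left_mono) auto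
      also have "\<dots> = B + (B * (c * g\<^sup>2) * s ^ n) * H2_norm r (u z)" by (simp add: algebra_simps)
      also have "\<dots> \<le> B + 1 / 2 * H2_norm r (u z)"
        using elim(1) H2_norm_nonneg[OF r] by (intro add_left_mono mult_right_mono) auto
      finally have ub: "H2_norm r (u z) \<le> 2 * B" by simp
      define d where "d = (\<lambda>l. ?R z (h n) l - u z l)"
      have dH: "d \<in> H2 r" unfolding d_def by (rule H2_diff(1)[OF r Rz(1) u(1)])
      have eq: "z * d l - kT d l = kT (u z) l - kA n (u z) l" for l
        using fun_cong[OF zT_diff[OF Rz(1) u(1), of z], of l] fun_cong[OF Rz(2), of l] fun_cong[OF u(2), of l]
        unfolding d_def by (simp add: algebra_simps)
      have "H2_norm r d \<le> B * H2_norm r (\<lambda>l. z * d l - kT d l)"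
        using B(2)[OF z] dH by (simp add: resolvent_bound_def)
      also have "\<dots> \<le> B * (c * g\<^sup>2 * s ^ n * H2_norm r (u z))"
        unfolding eq using B(1) T_minus_A(2)[OF u(1)] by (intro mult_left_mono) auto
      also have "\<dots> \<le> B * (c * g\<^sup>2 * s ^ n * (2 * B))"
        using B(1) ub c s by (intro mult_left_mono) auto
      finally have db: "H2_norm r d \<le> B * (c * g\<^sup>2 * s ^ n * (2 * B))" .
      \<comment> \<open>The norm bound on d carries no decay in l. Solving for z d exhibits d as an
        image under kernels, and these supply the factor s^|l|.\<close>
      have "z * d l = (kT (u z) l - kA n (u z) l) + kT d l" using eq[of l] by (simp add: algebra_simps)
      then have "cmod z * cmod (d l) \<le> cmod (kT (u z) l - kA n (u z) l) + cmod (kT d l)"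
        by (metis norm_mult norm_triangle_ineq)
      then have "cmod z * cmod (d l) * r ^ nat \<bar>l\<bar>
          \<le> cmod (kT (u z) l - kA n (u z) l) * r ^ nat \<bar>l\<bar> + cmod (kT d l) * r ^ nat \<bar>l\<bar>"
        using r by (simp add: distrib_right[symmetric])
      also have "\<dots> \<le> c * g * s ^ n * H2_norm r (u z) * s ^ nat \<bar>l\<bar> + c * g * H2_norm r d * s ^ nat \<bar>l\<bar>"
        by (intro add_mono T_minus_A(3) T_H2(2) u dH)
      also have "\<dots> \<le> c * g * s ^ n * (2 * B) * s ^ nat \<bar>l\<bar> + c * g * (B * (c * g\<^sup>2 * s ^ n * (2 * B))) * s ^ nat \<bar>l\<bar>"
        using ub db c g1 s by (intro add_mono mult_right_mono mult_left_mono) auto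
      also have "\<dots> = (c * g * (2 * B) + c * g * (B * (c * g\<^sup>2 * (2 * B)))) * s ^ n * s ^ nat \<bar>l\<bar>"
        by (simp add: algebra_simps)
      also have "\<dots> = z0 * M * s ^ n * s ^ nat \<bar>l\<bar>" using z0 by (simp add: M_def)
      finally have "cmod z * cmod (d l) * r ^ nat \<bar>l\<bar> \<le> z0 * M * s ^ n * s ^ nat \<bar>l\<bar>" .
      moreover have "z0 * cmod (d l) * r ^ nat \<bar>l\<bar> \<le> cmod z * cmod (d l) * r ^ nat \<bar>l\<bar>"
        using z0_le[OF z] r by (intro mult_right_mono) auto
      ultimately have "z0 * (cmod (d l) * r ^ nat \<bar>l\<bar>) \<le> z0 * (M * s ^ n * s ^ nat \<bar>l\<bar>)" by (simp add: mult_ac)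
      then have "cmod (d l) * r ^ nat \<bar>l\<bar> \<le> M * s ^ n * s ^ nat \<bar>l\<bar>"
        using z0 by simp
      then show ?thesis using r by (simp add: d_def field_simps)
    qed
    have le: "cmod (riesz_projection r kT lam (h n) l - h n l) * r ^ nat \<bar>l\<bar> \<le> \<epsilon> * M * s ^ n * s ^ nat \<bar>l\<bar>" for l
    proof -
      let ?I = "contour_integral (circlepath lam \<epsilon>) (\<lambda>z. ?R z (h n) l)"
      let ?m = "M * s ^ n * (s ^ nat \<bar>l\<bar> / r ^ nat \<bar>l\<bar>)"
      have m0: "0 \<le> ?m" using M0 s r by simp
      have "(\<lambda>z. ?R z (h n) l) contour_integrable_on circlepath lam \<epsilon>"
        using H2_resolvent_continuous[OF S B hH] \<epsilon>(1) by (intro contour_integrable_continuous_circlepath) auto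
      then have "((\<lambda>z. ?R z (h n) l) has_contour_integral ?I) (circlepath lam \<epsilon>)"
        by (rule has_contour_integral_integral)
      moreover have "\<mu> n \<in> ball lam \<epsilon>" using elim(2) by (simp add: dist_commute)
      ultimately have int: "((\<lambda>z. ?R z (h n) l - u z l) has_contour_integral (?I - 2 * of_real pi * \<i> * h n l)) (circlepath lam \<epsilon>)"
        unfolding u_def by (intro has_contour_integral_diff laurent_resolvent_contour_integral) auto
      have "cmod (?I - 2 * of_real pi * \<i> * h n l) \<le> ?m * (2 * pi * \<epsilon>)"
      proof (rule has_contour_integral_bound_circlepath[OF int m0 \<epsilon>(1)])
        fix x assume "cmod (x - lam) = \<epsilon>"
        then show "cmod (?R x (h n) l - u x l) \<le> ?m"
          by (intro dbound) (simp add: dist_norm norm_minus_commute)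
      qed
      moreover have "riesz_projection r kT lam (h n) l - h n l
          = 1 / (2 * of_real pi * \<i>) * (?I - 2 * of_real pi * \<i> * h n l)"
        unfolding riesz by (simp add: field_simps)
      then have "cmod (riesz_projection r kT lam (h n) l - h n l) = 1 / (2 * pi) * cmod (?I - 2 * of_real pi * \<i> * h n l)"
        by (simp only: norm_mult norm_divide) simp
      ultimately have "cmod (riesz_projection r kT lam (h n) l - h n l) \<le> 1 / (2 * pi) * (?m * (2 * pi * \<epsilon>))"
        by (simp only:) (intro mult_left_mono, auto)
      also have "\<dots> = \<epsilon> * ?m" by simp
      finally show ?thesis using r by (simp add: field_simps)
    qed
    have "H2_norm r (\<lambda>k. riesz_projection r kT lam (h n) k - h n k) \<le> \<epsilon> * M * s ^ n * g"
      using M0 \<epsilon>(1) s by (intro H2_I_decay(2)[OF r less_imp_le[OF s(1)] s(2) _ le]) simp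
    then show ?case by (simp add: mult_ac)
  qed
  then show ?thesis using that by blast
qed

end

section \<open>Analytic expanding circle maps near the circle\<close>

text \<open>A connected set with more than one point has no isolated points. This makes the
  derivative along the circle unique.\<close>

lemma islimpt_unit_circle:
  assumes "z \<in> sphere (0::complex) 1"
  shows "z islimpt sphere 0 1"
proof (rule connected_imp_perfect[OF connected_sphere assms])
  show "sphere (0::complex) 1 \<noteq> {x}" for x
  proof
    assume "sphere (0::complex) 1 = {x}"
    moreover have "1 \<in> sphere (0::complex) 1" "-1 \<in> sphere (0::complex) 1" by auto
    ultimately show False by auto
  qed
qed simp

lemma circle_deriv_eq:
  assumes g: "g holomorphic_on U" "open U" "sphere 0 1 \<subseteq> U" "\<And>w. w \<in> sphere 0 1 \<Longrightarrow> g w = \<tau> w"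
    and z: "z \<in> sphere 0 1"
  shows "circle_deriv \<tau> z = deriv g z"
proof -
  have "(g has_field_derivative deriv g z) (at z)"
    using g z by (intro holomorphic_derivI) auto
  then have "(g has_field_derivative deriv g z) (at z within sphere 0 1)"
    by (rule has_field_derivative_at_within)
  then have D: "(\<tau> has_field_derivative deriv g z) (at z within sphere 0 1)"
    by (rule has_field_derivative_transform_within[where d = 1]) (use g z in auto)
  have "at z within sphere 0 1 \<noteq> bot"
    using islimpt_unit_circle[OF z] by (simp add: trivial_limit_within)
  then show ?thesis
    unfolding circle_deriv_def using D has_field_derivative_unique by (intro the_equality) blast+
qed

text \<open>Differentiating \<open>\<bar>g(e\<^sup>i\<^sup>t)\<bar>\<^sup>2 = 1\<close> shows that \<open>z g'(z) / g(z)\<close> is real on the circle.\<close>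

lemma log_deriv_real_on_circle:
  assumes g: "g holomorphic_on U" "open U" "sphere 0 1 \<subseteq> U" "\<And>w. w \<in> sphere 0 1 \<Longrightarrow> cmod (g w) = 1"
    and z: "z \<in> sphere 0 1"
  shows "Im (z * deriv g z / g z) = 0"
proof -
  obtain t where t: "z = cis t"
    using z by (metis complex_norm_eq_1_exp cis_conv_exp mem_sphere_0)
  define G where "G = (\<lambda>t. g (cis t))"
  define D where "D = deriv g z * (\<i> * z)"
  have "(cis has_vector_derivative \<i> * cis t) (at t)"
    unfolding has_vector_derivative_complex_iff by (auto intro!: derivative_eq_intros)
  moreover have "(g has_field_derivative deriv g z) (at (cis t))"
    using holomorphic_derivI[OF g(1,2), of z] g(3) z unfolding t by blast
  ultimately have "((g \<circ> cis) has_vector_derivative (\<i> * cis t) * deriv g z) (at t)"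
    by (rule field_vector_diff_chain_at)
  then have G: "(G has_vector_derivative D) (at t)"
    by (simp add: G_def D_def t o_def mult_ac)
  have "((\<lambda>t. G t * cnj (G t)) has_vector_derivative G t * cnj D + D * cnj (G t)) (at t)"
    by (intro has_vector_derivative_mult has_vector_derivative_cnj G)
  moreover have "(\<lambda>t. G t * cnj (G t)) = (\<lambda>_. 1)"
    using g(4) by (auto simp: G_def complex_norm_square[symmetric])
  ultimately have "G t * cnj D + D * cnj (G t) = 0"
    using vector_derivative_unique_at[of "\<lambda>_. 1" _ t 0] has_vector_derivative_const by metis
  then have 0: "g z * cnj D + D * cnj (g z) = 0" by (simp add: G_def t)
  have gz: "g z * cnj (g z) = 1" using g(4)[OF z] by (simp add: complex_norm_square[symmetric])
  then have nz: "g z \<noteq> 0" by auto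
  have "z * deriv g z / g z = - \<i> * D * cnj (g z)"
    using gz nz by (simp add: D_def field_simps)
  then have "Im (z * deriv g z / g z) = - Re (D * cnj (g z))" by simp
  also have "\<dots> = - Re (g z * cnj D + D * cnj (g z)) / 2" by (simp add: algebra_simps)
  also have "\<dots> = 0" unfolding 0 by simp
  finally show ?thesis .
qed

lemma nonvanishing_constant_sign:
  fixes f :: "'a::topological_space \<Rightarrow> real"
  assumes "connected S" "continuous_on S f" "\<And>x. x \<in> S \<Longrightarrow> f x \<noteq> 0"
  obtains e where "e = 1 \<or> e = (- 1 :: real)" "\<And>x. x \<in> S \<Longrightarrow> e * f x = \<bar>f x\<bar>"
proof -
  have conn: "connected (f ` S)" by (rule connected_continuous_image[OF assms(2,1)])
  have "(\<forall>x\<in>S. 0 < f x) \<or> (\<forall>x\<in>S. f x < 0)"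
  proof (rule ccontr)
    assume "\<not> ?thesis"
    then obtain x y where "x \<in> S" "y \<in> S" "f x \<le> 0" "0 \<le> f y" by (auto simp: not_less)
    then have "0 \<in> f ` S" using connectedD_interval[OF conn, of "f x" "f y" 0] by auto
    then show False using assms(3) by auto
  qed
  then show ?thesis
  proof
    assume *: "\<forall>x\<in>S. 0 < f x"
    show ?thesis by (rule that[of 1]) (use * in auto)
  next
    assume *: "\<forall>x\<in>S. f x < 0"
    show ?thesis by (rule that[of "-1"]) (use * in auto)
  qed
qed

lemma DERIV_ln_sum_squares:
  fixes P Q :: "real \<Rightarrow> real"
  assumes "(P has_real_derivative p) (at x)" "(Q has_real_derivative q) (at x)" "0 < (P x)\<^sup>2 + (Q x)\<^sup>2"
  shows "((\<lambda>x. ln ((P x)\<^sup>2 + (Q x)\<^sup>2)) has_real_derivative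
    1 / ((P x)\<^sup>2 + (Q x)\<^sup>2) * (2 * P x * p + 2 * Q x * q)) (at x)"
  using assms(3) by (auto intro!: derivative_eq_intros assms(1,2))

text \<open>The radial logarithmic derivative of |g| is the real part of z g' / g. The squared
  modulus is used because it is the sum of squares of the real and imaginary parts and can be
  differentiated directly.\<close>

lemma log_norm_radial_derivative:
  assumes g: "(g has_field_derivative g') (at (of_real (exp x) * w))" and nz: "g (of_real (exp x) * w) \<noteq> 0"
  shows "((\<lambda>x. ln ((cmod (g (of_real (exp x) * w)))\<^sup>2)) has_real_derivative
    2 * Re (of_real (exp x) * w * g' / g (of_real (exp x) * w))) (at x)"
proof -
  let ?z = "of_real (exp x) * w"
  define G where "G = (\<lambda>x. g (of_real (exp x) * w))"
  define D where "D = (?z) * g'"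
  have "((\<lambda>x. exp (of_real x) * w) has_vector_derivative exp (of_real x) * w) (at x)"
    by (rule has_vector_derivative_real_field[of "\<lambda>u. exp u * w"]) (auto intro!: derivative_eq_intros)
  then have "((\<lambda>x. of_real (exp x) * w) has_vector_derivative ?z) (at x)" by (simp add: exp_of_real)
  from field_vector_diff_chain_at[OF this g] have G: "(G has_vector_derivative D) (at x)"
    by (simp add: G_def D_def o_def)
  have Gx: "G x = g ?z" by (simp add: G_def)
  have ReIm: "((\<lambda>x. Re (G x)) has_real_derivative Re D) (at x)" "((\<lambda>x. Im (G x)) has_real_derivative Im D) (at x)"
    using G unfolding has_vector_derivative_complex_iff by auto
  have pos: "0 < (Re (G x))\<^sup>2 + (Im (G x))\<^sup>2" using nz by (simp add: Gx complex_neq_0)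
  have "((\<lambda>x. ln ((Re (G x))\<^sup>2 + (Im (G x))\<^sup>2)) has_real_derivative
      1 / ((Re (G x))\<^sup>2 + (Im (G x))\<^sup>2) * (2 * Re (G x) * Re D + 2 * Im (G x) * Im D)) (at x)"
    by (rule DERIV_ln_sum_squares[OF ReIm pos])
  moreover have "1 / ((Re (G x))\<^sup>2 + (Im (G x))\<^sup>2) * (2 * Re (G x) * Re D + 2 * Im (G x) * Im D) = 2 * Re (D / G x)"
    using pos by (simp add: Re_divide field_simps)
  ultimately show ?thesis by (simp add: G_def D_def cmod_power2)
qed

text \<open>\<open>e\<close> is the orientation of \<open>\<tau>\<close>.\<close>

lemma expanding_radial_growth:
  assumes \<tau>: "analytic_expanding_circle_map \<tau>" and \<delta>: "\<delta> > 1 + max_expansion \<tau>"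
  obtains g e \<kappa>1 \<kappa>2 x0 where "0 < x0" "1 < \<kappa>1" "\<kappa>2 < \<delta> - 1" "0 < \<kappa>2" "e = 1 \<or> e = (- 1 :: real)"
    "g holomorphic_on {z. exp (- x0) < cmod z \<and> cmod z < exp x0}"
    "\<And>z. z \<in> sphere 0 1 \<Longrightarrow> g z = \<tau> z"
    "\<And>z x. cmod z = exp x \<Longrightarrow> \<bar>x\<bar> < x0 \<Longrightarrow> \<exists>\<kappa>. \<kappa>1 \<le> \<kappa> \<and> \<kappa> \<le> \<kappa>2 \<and> cmod (g z) = exp (e * x * \<kappa>)"
proof -
  obtain r g where r: "0 < r" "r < 1" and g: "g holomorphic_on annulus r"
    and g\<tau>: "\<And>z. z \<in> sphere 0 1 \<Longrightarrow> g z = \<tau> z"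
    using \<tau> unfolding analytic_expanding_circle_map_def by blast
  have op: "open (annulus r)"
    unfolding annulus_def by (intro open_Collect_conj open_Collect_less continuous_intros)
  have sub: "sphere 0 1 \<subseteq> annulus r" using r by (auto simp: annulus_def one_less_inverse)
  have norm1: "cmod (g z) = 1" if "z \<in> sphere 0 1" for z
  proof -
    have "\<tau> ` sphere 0 1 \<subseteq> sphere 0 1" using \<tau> unfolding analytic_expanding_circle_map_def by blast
    then have "\<tau> z \<in> sphere 0 1" using that by blast
    then show ?thesis using g\<tau>[OF that] by simp
  qed
  have cd: "circle_deriv \<tau> z = deriv g z" if "z \<in> sphere 0 1" for z
    by (rule circle_deriv_eq[OF g op sub g\<tau> that])
  have dg: "deriv g holomorphic_on annulus r" by (rule holomorphic_deriv[OF g op])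
  have "continuous_on (sphere 0 1) (\<lambda>z. cmod (deriv g z))"
    by (intro continuous_on_norm holomorphic_on_imp_continuous_on holomorphic_on_subset[OF dg sub])
  then have cont: "continuous_on (sphere 0 1) (\<lambda>z. cmod (circle_deriv \<tau> z))"
    by (rule continuous_on_eq) (simp add: cd)
  have "bdd_above ((\<lambda>z. cmod (circle_deriv \<tau> z)) ` sphere 0 1)"
    by (intro bounded_imp_bdd_above compact_imp_bounded compact_continuous_image cont compact_sphere)
  then have max: "cmod (deriv g z) \<le> max_expansion \<tau>" if "z \<in> sphere 0 1" for z
    unfolding max_expansion_def cd[OF that, symmetric] by (intro cSUP_upper that)
  have min: "min_expansion \<tau> \<le> cmod (deriv g z)" if "z \<in> sphere 0 1" for z
    unfolding min_expansion_def cd[OF that, symmetric] by (intro cINF_lower bdd_belowI2[of _ 0] that) auto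
  have min1: "1 < min_expansion \<tau>" using \<tau> by (simp add: analytic_expanding_circle_map_def)
  define U where "U = {z \<in> annulus r. g z \<noteq> 0}"
  define \<phi> where "\<phi> = (\<lambda>z. z * deriv g z / g z)"
  have U: "open U"
  proof -
    have "U = annulus r \<inter> g -` (- {0})" by (auto simp: U_def)
    then show ?thesis
      using continuous_open_preimage[OF holomorphic_on_imp_continuous_on[OF g] op, of "- {0}"] by auto
  qed
  have subU: "sphere 0 1 \<subseteq> U" using sub norm1 by (force simp: U_def)
  have \<phi>: "continuous_on U \<phi>"
  proof -
    have "U \<subseteq> annulus r" by (auto simp: U_def)
    then have "continuous_on U g" "continuous_on U (deriv g)"
      using g dg by (auto intro: holomorphic_on_imp_continuous_on holomorphic_on_subset)
    then show ?thesis unfolding \<phi>_def by (intro continuous_intros) (auto simp: U_def)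
  qed
  have Re\<phi>: "\<bar>Re (\<phi> z)\<bar> = cmod (deriv g z)" if "z \<in> sphere 0 1" for z
  proof -
    have "Im (\<phi> z) = 0"
      unfolding \<phi>_def by (rule log_deriv_real_on_circle[OF g op sub norm1 that])
    then have "\<bar>Re (\<phi> z)\<bar> = cmod (\<phi> z)" by (simp add: cmod_def)
    then show ?thesis using that norm1[OF that] by (simp add: \<phi>_def norm_divide norm_mult)
  qed
  have "continuous_on (sphere 0 1) (\<lambda>z. Re (\<phi> z))"
    by (intro continuous_on_Re continuous_on_subset[OF \<phi> subU])
  moreover have "Re (\<phi> z) \<noteq> 0" if "z \<in> sphere 0 1" for z using Re\<phi>[OF that] min[OF that] min1 by auto
  moreover have "connected (sphere (0::complex) 1)" by (rule connected_sphere) simp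
  ultimately obtain e where e: "e = 1 \<or> e = (- 1 :: real)"
    "\<And>z. z \<in> sphere 0 1 \<Longrightarrow> e * Re (\<phi> z) = \<bar>Re (\<phi> z)\<bar>"
    using nonvanishing_constant_sign[of "sphere 0 1" "\<lambda>z. Re (\<phi> z)"] by metis
  \<comment> \<open>Midpoints of the gaps left by the hypotheses, between 1 and the smallest and
    between the largest expansion and \<delta> - 1: they leave room for the growth rate to vary off
    the circle.\<close>
  define \<kappa>1 where "\<kappa>1 = (1 + min_expansion \<tau>) / 2"
  define \<kappa>2 where "\<kappa>2 = (max_expansion \<tau> + (\<delta> - 1)) / 2"
  have one: "(1::complex) \<in> sphere 0 1" by simp
  have \<kappa>: "1 < \<kappa>1" "\<kappa>1 < min_expansion \<tau>" "max_expansion \<tau> < \<kappa>2" "\<kappa>2 < \<delta> - 1"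
    using min1 \<delta> by (auto simp: \<kappa>1_def \<kappa>2_def)
  have "0 < \<kappa>2" using \<kappa> min[OF one] max[OF one] by linarith
  \<comment> \<open>The open set of points with growth rate between the two constants. It contains
    the circle, so by compactness it contains a whole annulus.\<close>
  define W where "W = U \<inter> (\<lambda>z. e * Re (\<phi> z)) -` {\<kappa>1<..<\<kappa>2}"
  have W: "open W" unfolding W_def
    by (intro continuous_open_preimage U continuous_on_mult continuous_on_const continuous_on_Re \<phi>) auto
  have "sphere 0 1 \<subseteq> W"
  proof
    fix z :: complex assume z: "z \<in> sphere 0 1"
    have "e * Re (\<phi> z) = cmod (deriv g z)" using e(2)[OF z] Re\<phi>[OF z] by simp
    then show "z \<in> W" using z subU min[OF z] max[OF z] \<kappa> unfolding W_def by auto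
  qed
  then obtain d where d: "0 < d" "(\<Union>x\<in>sphere 0 1. ball x d) \<subseteq> W"
    using compact_subset_open_imp_ball_epsilon_subset[OF compact_sphere W] by blast
  define x0 where "x0 = ln (1 + d)"
  have x0: "0 < x0" using d by (simp add: x0_def)
  \<comment> \<open>A point z of the annulus has distance | |z| - 1 | from the point z / |z| of the
    circle. Inside the circle this is below d because 1 - d < 1 / (1 + d).\<close>
  have inW: "z \<in> W" if z: "exp (- x0) < cmod z" "cmod z < exp x0" for z
  proof -
    have z0: "z \<noteq> 0" using z(1) by (auto dest: less_trans[OF exp_gt_zero])
    have "exp (- x0) = 1 / (1 + d)" using d by (simp add: x0_def exp_minus inverse_eq_divide)
    moreover have "1 - d < 1 / (1 + d)" using d by (simp add: field_simps)
    moreover have "exp x0 = 1 + d" using d by (simp add: x0_def)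
    ultimately have "\<bar>cmod z - 1\<bar> < d" using z by auto
    moreover have "z / of_real (cmod z) - z = (1 - of_real (cmod z)) * (z / of_real (cmod z))"
      using z0 by (simp add: field_simps)
    then have "dist (z / of_real (cmod z)) z = cmod (of_real (1 - cmod z)) * cmod (z / of_real (cmod z))"
      unfolding dist_norm by (simp only: norm_mult of_real_diff of_real_1)
    then have "dist (z / of_real (cmod z)) z = \<bar>cmod z - 1\<bar>"
      using z0 unfolding norm_of_real by (simp add: norm_divide abs_minus_commute)
    ultimately have "z \<in> ball (z / of_real (cmod z)) d" by simp
    moreover have "z / of_real (cmod z) \<in> sphere 0 1" using z0 by (simp add: norm_divide)
    ultimately show ?thesis using d(2) by blast
  qed
  have grow: "\<exists>\<kappa>. \<kappa>1 \<le> \<kappa> \<and> \<kappa> \<le> \<kappa>2 \<and> cmod (g z) = exp (e * x * \<kappa>)" if z: "cmod z = exp x" "\<bar>x\<bar> < x0" for z x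
  proof -
    define w where "w = z / of_real (exp x)"
    have w: "w \<in> sphere 0 1" "z = of_real (exp x) * w" using z by (auto simp: w_def norm_divide)
    let ?p = "\<lambda>y. of_real (exp y) * w"
    define f where "f = (\<lambda>y. ln ((cmod (g (?p y)))\<^sup>2))"
    have pW: "?p y \<in> W" if "\<bar>y\<bar> < x0" for y using that w by (intro inW) (auto simp: norm_mult)
    have f: "(f has_real_derivative 2 * Re (\<phi> (?p y))) (at y)" if "\<bar>y\<bar> < x0" for y
    proof -
      have "?p y \<in> annulus r" "g (?p y) \<noteq> 0" using pW[OF that] by (auto simp: W_def U_def)
      then show ?thesis
        unfolding f_def \<phi>_def by (intro log_norm_radial_derivative holomorphic_derivI[OF g op])
    qed
    have f0: "f 0 = 0" using norm1[OF w(1)] by (simp add: f_def)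
    \<comment> \<open>Mean value theorem along the ray through z, starting on the circle, where ln
      |g| = 0. The intermediate point provides \<kappa>.\<close>
    have "\<exists>y. \<bar>y\<bar> < x0 \<and> f x = x * (2 * Re (\<phi> (?p y)))"
    proof (cases "x = 0")
      case True
      then show ?thesis using f0 x0 by (intro exI[of _ 0]) simp
    next
      case False
      consider "0 < x" | "x < 0" using False by linarith
      then show ?thesis
      proof cases
        case 1
        obtain y where "0 < y" "y < x" "f x - f 0 = (x - 0) * (2 * Re (\<phi> (?p y)))"
          using MVT2[OF 1, of f "\<lambda>y. 2 * Re (\<phi> (?p y))"] f z(2) by fastforce
        then show ?thesis using z(2) f0 by (intro exI[of _ y]) auto
      next
        case 2
        obtain y where "x < y" "y < 0" "f 0 - f x = (0 - x) * (2 * Re (\<phi> (?p y)))"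
          using MVT2[OF 2, of f "\<lambda>y. 2 * Re (\<phi> (?p y))"] f z(2) by fastforce
        then show ?thesis using z(2) f0 by (intro exI[of _ y]) auto
      qed
    qed
    then obtain y where y: "\<bar>y\<bar> < x0" "f x = x * (2 * Re (\<phi> (?p y)))" by blast
    define \<kappa> where "\<kappa> = e * Re (\<phi> (?p y))"
    have "\<kappa>1 \<le> \<kappa>" "\<kappa> \<le> \<kappa>2" using pW[OF y(1)] by (auto simp: W_def \<kappa>_def)
    moreover have "cmod (g z) = exp (e * x * \<kappa>)"
    proof -
      have nz: "g z \<noteq> 0" using pW[OF z(2)] w by (auto simp: W_def U_def)
      have "ln ((cmod (g z))\<^sup>2) = x * (2 * Re (\<phi> (?p y)))" using y(2) w by (simp add: f_def)
      then have "ln (cmod (g z)) = x * Re (\<phi> (?p y))" using nz by (simp add: ln_realpow)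
      also have "\<dots> = e * x * \<kappa>" using e(1) by (auto simp: \<kappa>_def)
      finally show ?thesis using nz by (metis exp_ln zero_less_norm_iff)
    qed
    ultimately show ?thesis by blast
  qed
  have "g holomorphic_on {z. exp (- x0) < cmod z \<and> cmod z < exp x0}"
    by (rule holomorphic_on_subset[OF g]) (use inW in \<open>auto simp: W_def U_def\<close>)
  then show ?thesis
    using that[OF x0 \<kappa>(1) \<kappa>(4) \<open>0 < \<kappa>2\<close> e(1) _ g\<tau> grow] by blast
qed

section \<open>Contour integrals over concentric circles and the trapezoidal rule\<close>

text \<open>The homotopy joins points of equal argument; the modulus along it is a convex
  combination of the radii and stays in the annulus.\<close>

lemma contour_integral_circles_eq:
  assumes f: "f holomorphic_on {z. a < cmod z \<and> cmod z < b}" and \<rho>: "0 < \<rho>" "a < \<rho>" "\<rho> < b" and \<sigma>: "0 < \<sigma>" "a < \<sigma>" "\<sigma> < b"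
  shows "contour_integral (circlepath 0 \<rho>) f = contour_integral (circlepath 0 \<sigma>) f"
proof (rule Cauchy_theorem_homotopic_loops[where S = "{z. a < cmod z \<and> cmod z < b}"])
  show "open {z::complex. a < cmod z \<and> cmod z < b}"
    by (intro open_Collect_conj open_Collect_less continuous_intros)
  show "homotopic_loops {z. a < cmod z \<and> cmod z < b} (circlepath 0 \<rho>) (circlepath 0 \<sigma>)"
  proof (rule homotopic_loops_linear)
    fix t :: real
    show "closed_segment (circlepath 0 \<rho> t) (circlepath 0 \<sigma> t) \<subseteq> {z. a < cmod z \<and> cmod z < b}"
    proof
      fix z assume "z \<in> closed_segment (circlepath 0 \<rho> t) (circlepath 0 \<sigma> t)"
      then obtain u where u: "0 \<le> u" "u \<le> 1" "z = (1 - u) *\<^sub>R circlepath 0 \<rho> t + u *\<^sub>R circlepath 0 \<sigma> t"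
        by (auto simp: closed_segment_def)
      let ?\<rho> = "(1 - u) * \<rho> + u * \<sigma>"
      have "z = of_real ?\<rho> * exp (2 * of_real pi * \<i> * of_real t)"
        using u by (simp add: circlepath scaleR_conv_of_real algebra_simps)
      moreover have "0 \<le> ?\<rho>" using u \<rho> \<sigma> by simp
      ultimately have z: "cmod z = ?\<rho>" by (simp only: norm_mult norm_of_real) (simp add: norm_exp_eq_Re)
      have "?\<rho> \<in> {a<..<b}"
        using convexD_alt[OF convex_real_interval(8), of \<rho> a b \<sigma> u] u \<rho> \<sigma> by auto
      then show "z \<in> {z. a < cmod z \<and> cmod z < b}" using z by simp
    qed
  qed auto
qed (use f in auto)

lemma circle_in_annulus_integrable:
  assumes f: "f holomorphic_on {z. a < cmod z \<and> cmod z < b}" and \<rho>: "0 < \<rho>" "a < \<rho>" "\<rho> < b"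
  shows "f contour_integrable_on circlepath 0 \<rho>"
  by (rule contour_integrable_continuous_circlepath)
     (use \<rho> in \<open>auto intro: continuous_on_subset[OF holomorphic_on_imp_continuous_on[OF f]]\<close>)

text \<open>\<open>h\<close> matters on the unit circle only, \<open>f\<close> is its holomorphic
  extension. On the unit circle the contour integral is a multiple of the Fourier integral by
  parametrisation; it is then moved to any radius in the annulus.\<close>

lemma fourier_coeff_contour_integral:
  assumes f: "f holomorphic_on {z. a < cmod z \<and> cmod z < b}" and ab: "0 < a" "a < 1" "1 < b"
    and \<rho>: "a < \<rho>" "\<rho> < b" and eq: "\<And>z. z \<in> sphere 0 1 \<Longrightarrow> f z = h z"
  shows "((\<lambda>z. f z * z powi (- l - 1)) has_contour_integral 2 * of_real pi * \<i> * fourier_coeff h l) (circlepath 0 \<rho>)"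
proof -
  let ?f = "\<lambda>z. f z * z powi (- l - 1)" and ?A = "{z. a < cmod z \<and> cmod z < b}"
  have hol: "?f holomorphic_on ?A" using ab by (intro holomorphic_intros f) auto
  have \<rho>0: "0 < \<rho>" using ab \<rho> by linarith
  have "?f contour_integrable_on circlepath 0 1"
    by (rule circle_in_annulus_integrable[OF hol]) (use ab in auto)
  then have "(?f has_contour_integral contour_integral (circlepath 0 1) ?f) (part_circlepath 0 1 0 (2 * pi))"
    unfolding circlepath_def[symmetric] by (rule has_contour_integral_integral)
  then have "((\<lambda>t. ?f (0 + of_real 1 * cis t) * of_real 1 * \<i> * cis t) has_integral
      contour_integral (circlepath 0 1) ?f) {0..2 * pi}"
    by (subst (asm) has_contour_integral_part_circlepath_iff) auto
  moreover have "?f (0 + of_real 1 * cis t) * of_real 1 * \<i> * cis t = \<i> * (h (cis t) * cis (- (of_int l * t)))" for t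
    by (simp add: eq cis_power_int cis_mult algebra_simps)
  ultimately have "((\<lambda>t. \<i> * (h (cis t) * cis (- (of_int l * t)))) has_integral
      contour_integral (circlepath 0 1) ?f) {0..2 * pi}" by (simp only:)
  then have "contour_integral (circlepath 0 1) ?f = integral {0..2 * pi} (\<lambda>t. \<i> * (h (cis t) * cis (- (of_int l * t))))"
    by (rule integral_unique[symmetric])
  then have "contour_integral (circlepath 0 1) ?f = 2 * of_real pi * \<i> * fourier_coeff h l"
    by (simp add: fourier_coeff_def)
  moreover have "contour_integral (circlepath 0 \<rho>) ?f = contour_integral (circlepath 0 1) ?f"
    by (rule contour_integral_circles_eq[OF hol]) (use ab \<rho> \<rho>0 in auto)
  ultimately show ?thesis
    using has_contour_integral_integral[OF circle_in_annulus_integrable[OF hol \<rho>0 \<rho>]] by simp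
qed

lemma fourier_coeff_le:
  assumes f: "f holomorphic_on {z. a < cmod z \<and> cmod z < b}" and ab: "0 < a" "a < 1" "1 < b"
    and \<rho>: "a < \<rho>" "\<rho> < b" and eq: "\<And>z. z \<in> sphere 0 1 \<Longrightarrow> f z = h z"
    and B: "\<And>z. cmod z = \<rho> \<Longrightarrow> cmod (f z) \<le> B"
  shows "cmod (fourier_coeff h l) \<le> B * \<rho> powi (- l)"
proof -
  have \<rho>0: "0 < \<rho>" using ab \<rho> by linarith
  have "0 \<le> B" using order_trans[OF norm_ge_zero B[of "of_real \<rho>"]] \<rho>0 by simp
  have "cmod (2 * of_real pi * \<i> * fourier_coeff h l) \<le> (B * \<rho> powi (- l - 1)) * (2 * pi * \<rho>)"
  proof (rule has_contour_integral_bound_circlepath[OF fourier_coeff_contour_integral[OF f ab \<rho> eq]])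
    show "0 \<le> B * \<rho> powi (- l - 1)" using \<open>0 \<le> B\<close> \<rho>0 by simp
    fix z :: complex assume "cmod (z - 0) = \<rho>"
    then show "cmod (f z * z powi (- l - 1)) \<le> B * \<rho> powi (- l - 1)"
      using B[of z] \<rho>0 by (simp add: norm_mult norm_power_int mult_right_mono)
  qed (use \<rho>0 in auto)
  moreover have "\<rho> powi (- l - 1) * \<rho> = \<rho> powi (- l)" using \<rho>0 by (simp add: power_int_diff)
  ultimately have "2 * pi * cmod (fourier_coeff h l) \<le> 2 * pi * (B * \<rho> powi (- l))"
    by (simp add: norm_mult mult_ac)
  then show ?thesis by simp
qed

section \<open>The nodes as the roots of z^m = exp(i m \<alpha>)\<close>

lemma circle_points_cis:
  "circle_points \<alpha> m j = cis (2 * pi * real j / real m + \<alpha>)"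
  by (simp add: circle_points_def cis_conv_exp algebra_simps)

text \<open>The powers run through a geometric progression whose ratio is an m-th root of unity,
  different from 1 unless m divides p. The phase \<alpha> contributes only a common factor.\<close>

lemma sum_circle_points_powi:
  assumes p: "\<bar>p\<bar> < int m"
  shows "(\<Sum>j<m. circle_points \<alpha> m j powi p) = (if p = 0 then of_nat m else 0)"
proof (cases "p = 0")
  case False
  have m: "0 < m" using p by linarith
  define q where "q = cis (2 * pi * real_of_int p / real m)"
  have "circle_points \<alpha> m j powi p = cis (real_of_int p * \<alpha>) * q ^ j" for j
  proof -
    have "real_of_int p * (2 * pi * real j / real m + \<alpha>)
        = real_of_int p * \<alpha> + real j * (2 * pi * real_of_int p / real m)" by (simp add: algebra_simps)
    then show ?thesis
      unfolding circle_points_cis cis_power_int q_def Complex.DeMoivre cis_mult by (rule arg_cong)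
  qed
  then have "(\<Sum>j<m. circle_points \<alpha> m j powi p) = cis (real_of_int p * \<alpha>) * (\<Sum>j<m. q ^ j)"
    by (simp add: sum_distrib_left)
  moreover have "q \<noteq> 1"
  proof
    assume "q = 1"
    then obtain i :: int where "2 * pi * real_of_int p / real m = of_int (2 * i) * pi"
      unfolding q_def cis_conv_exp exp_eq_1 by auto
    then have "real_of_int p = real_of_int i * real m" using m by (simp add: field_simps)
    then have "p = i * int m" by (metis of_int_eq_iff of_int_mult of_int_of_nat_eq)
    then have "int m dvd p" by simp
    then show False using p False zdvd_imp_le[of "int m" "\<bar>p\<bar>"] by simp
  qed
  moreover have "q ^ m = 1"
  proof -
    have "real m * (2 * pi * real_of_int p / real m) = 2 * pi * real_of_int p" using m by simp
    then show ?thesis unfolding q_def Complex.DeMoivre by (simp only:) (rule cis_multiple_2pi, simp)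
  qed
  ultimately show ?thesis using False by (simp add: geometric_sum)
qed simp

lemma circle_points_power:
  assumes "0 < m"
  shows "circle_points \<alpha> m j ^ m = cis (real m * \<alpha>)"
proof -
  have "real m * (2 * pi * real j / real m + \<alpha>) = 2 * pi * real j + real m * \<alpha>"
    using assms by (simp add: distrib_left)
  then have "circle_points \<alpha> m j ^ m = cis (2 * pi * real j) * cis (real m * \<alpha>)"
    unfolding circle_points_cis Complex.DeMoivre cis_mult by (rule arg_cong)
  then show ?thesis by (simp add: cis_multiple_2pi)
qed

text \<open>This is the partial fraction decomposition of the logarithmic derivative of z^m - exp(i
  m \<alpha>), whose roots are the nodes. After expanding the numerators in powers of the nodes,
  orthogonality leaves only the power 0.\<close>

lemma sum_inverse_circle_points:
  assumes m: "0 < m" and z: "z ^ m \<noteq> cis (real m * \<alpha>)"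
  shows "(\<Sum>j<m. 1 / (z - circle_points \<alpha> m j)) = of_nat m * z ^ (m - 1) / (z ^ m - cis (real m * \<alpha>))"
proof -
  let ?c = "circle_points \<alpha> m"
  have "1 / (z - ?c j) * (z ^ m - cis (real m * \<alpha>)) = (\<Sum>i<m. ?c j ^ i * z ^ (m - Suc i))" for j
  proof -
    have "z \<noteq> ?c j" using z circle_points_power[OF m] by auto
    moreover have "cis (real m * \<alpha>) - z ^ m = (?c j - z) * (\<Sum>i<m. z ^ (m - Suc i) * ?c j ^ i)"
      unfolding circle_points_power[OF m, of \<alpha> j, symmetric] by (rule power_diff_sumr2)
    ultimately show ?thesis by (simp add: field_simps)
  qed
  then have "(\<Sum>j<m. 1 / (z - ?c j)) * (z ^ m - cis (real m * \<alpha>)) = (\<Sum>i<m. (\<Sum>j<m. ?c j ^ i) * z ^ (m - Suc i))"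
    unfolding sum_distrib_right by (subst sum.swap) (simp only:)
  also have "\<dots> = (\<Sum>i<m. if i = 0 then of_nat m * z ^ (m - 1) else 0)"
  proof (rule sum.cong[OF refl])
    fix i assume "i \<in> {..<m}"
    then show "(\<Sum>j<m. ?c j ^ i) * z ^ (m - Suc i) = (if i = 0 then of_nat m * z ^ (m - 1) else 0)"
      using sum_circle_points_powi[of "int i" m \<alpha>] by simp
  qed
  also have "\<dots> = of_nat m * z ^ (m - 1)" using m by simp
  finally show ?thesis using z by (simp add: eq_divide_eq)
qed

text \<open>The difference quotient of \<open>f\<close> at w extends holomorphically to w, so its
  integrals over the two circles agree. Expanding it, the integral of 1 / (z - w) is 2 \<pi> i over
  the outer circle and 0 over the inner one.\<close>

lemma Cauchy_formula_annulus:
  assumes f: "f holomorphic_on {z. a < cmod z \<and> cmod z < b}" and a: "0 < a"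
    and \<rho>: "a < \<rho>" "\<rho> < cmod w" and \<sigma>: "cmod w < \<sigma>" "\<sigma> < b"
  shows "2 * of_real pi * \<i> * f w = contour_integral (circlepath 0 \<sigma>) (\<lambda>z. f z / (z - w))
    - contour_integral (circlepath 0 \<rho>) (\<lambda>z. f z / (z - w))"
proof -
  let ?A = "{z::complex. a < cmod z \<and> cmod z < b}"
  have op: "open ?A" by (intro open_Collect_conj open_Collect_less continuous_intros)
  define \<phi> where "\<phi> = (\<lambda>z. if z = w then deriv f w else (f z - f w) / (z - w))"
  have \<phi>: "\<phi> holomorphic_on ?A" unfolding \<phi>_def by (rule pole_lemma_open[OF f op])
  have eq: "contour_integral (circlepath 0 \<sigma>) \<phi> = contour_integral (circlepath 0 \<rho>) \<phi>"
    by (rule contour_integral_circles_eq[OF \<phi>]) (use a \<rho> \<sigma> in auto)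
  have split: "contour_integral (circlepath 0 t) \<phi>
      = contour_integral (circlepath 0 t) (\<lambda>z. f z / (z - w)) - f w * contour_integral (circlepath 0 t) (\<lambda>z. 1 / (z - w))"
    if t: "a < t" "t < b" "t \<noteq> cmod w" for t
  proof -
    have cont: "continuous_on (path_image (circlepath 0 t)) f"
      using t a by (intro continuous_on_subset[OF holomorphic_on_imp_continuous_on[OF f]]) auto
    have nz: "z - w \<noteq> 0" if "z \<in> path_image (circlepath 0 t)" for z using that t a by auto
    have 1: "(\<lambda>z. f z / (z - w)) contour_integrable_on circlepath 0 t"
      by (intro contour_integrable_continuous_circlepath continuous_on_divide cont continuous_intros) (use nz in auto)
    have 2: "(\<lambda>z. 1 / (z - w)) contour_integrable_on circlepath 0 t"
      by (intro contour_integrable_continuous_circlepath continuous_on_divide continuous_intros) (use nz in auto)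
    have "contour_integral (circlepath 0 t) \<phi> = contour_integral (circlepath 0 t) (\<lambda>z. f z / (z - w) - f w * (1 / (z - w)))"
      using nz by (intro contour_integral_cong) (auto simp: \<phi>_def diff_divide_distrib)
    also have "\<dots> = contour_integral (circlepath 0 t) (\<lambda>z. f z / (z - w))
        - f w * contour_integral (circlepath 0 t) (\<lambda>z. 1 / (z - w))"
      unfolding contour_integral_diff[OF 1 contour_integrable_lmul[OF 2]] contour_integral_lmul[OF 2] ..
    finally show ?thesis .
  qed
  have "contour_integral (circlepath 0 \<sigma>) (\<lambda>z. 1 / (z - w)) = 2 * of_real pi * \<i>"
    using Cauchy_integral_circlepath[of 0 \<sigma> "\<lambda>_. 1" w] \<sigma> by (intro contour_integral_unique) auto
  moreover have "contour_integral (circlepath 0 \<rho>) (\<lambda>z. 1 / (z - w)) = 0"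
  proof (rule contour_integral_unique, rule Cauchy_theorem_convex_simple)
    show "(\<lambda>z. 1 / (z - w)) holomorphic_on ball 0 (cmod w)" by (intro holomorphic_intros) auto
    show "path_image (circlepath 0 \<rho>) \<subseteq> ball 0 (cmod w)" using \<rho> a by auto
  qed auto
  ultimately show ?thesis
    using eq split[of \<sigma>] split[of \<rho>] a \<rho> \<sigma> by (simp add: algebra_simps)
qed

text \<open>
  Summing Cauchy's formula over the nodes turns the kernel into \<open>z\<^sup>m\<^sup>-\<^sup>1 / (z\<^sup>m - w)\<close>, which is
  close to \<open>1 / z\<close> outside and to \<open>0\<close> inside the circle.
\<close>

lemma trapezoidal_rule_error:
  assumes f: "f holomorphic_on {z. a < cmod z \<and> cmod z < b}" and a: "0 < a"
    and \<sigma>: "1 < \<sigma>" "\<sigma> < b" "a < 1 / \<sigma>" and m: "0 < m"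
    and B: "\<And>z. cmod z = \<sigma> \<Longrightarrow> cmod (f z) \<le> B" "\<And>z. cmod z = 1 / \<sigma> \<Longrightarrow> cmod (f z) \<le> B"
  shows "cmod (1 / of_nat m * (\<Sum>j<m. f (circle_points \<alpha> m j)) - fourier_coeff f 0) \<le> 2 * B / (\<sigma> ^ m - 1)"
proof -
  let ?c = "circle_points \<alpha> m" and ?w = "cis (real m * \<alpha>)" and ?I = "\<lambda>t. contour_integral (circlepath 0 t)"
  have \<sigma>m: "1 < \<sigma> ^ m" using \<sigma> m by (simp add: one_less_power)
  have ab: "a < 1" "1 < b" using \<sigma> by (auto intro: less_trans[of a "1 / \<sigma>"])
  have B0: "0 \<le> B" using order_trans[OF norm_ge_zero B(1)[of "of_real \<sigma>"]] \<sigma> by simp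
  have c1: "cmod (?c j) = 1" for j by (simp add: circle_points_cis)
  have zm: "z ^ m \<noteq> ?w" if "cmod z = \<sigma> \<or> cmod z = 1 / \<sigma>" for z
  proof
    assume "z ^ m = ?w"
    then have "cmod z ^ m = 1" by (metis norm_cis norm_power)
    then show False using that \<sigma>m by (auto simp: power_divide)
  qed
  have sums: "(\<Sum>j<m. f z / (z - ?c j)) = f z * (of_nat m * z ^ (m - 1) / (z ^ m - ?w))" if "z ^ m \<noteq> ?w" for z
    unfolding sum_inverse_circle_points[OF m that, symmetric] sum_distrib_left by simp
  have int: "(\<lambda>z. f z / (z - ?c j)) contour_integrable_on circlepath 0 t" if t: "t = \<sigma> \<or> t = 1 / \<sigma>" for t j
  proof -
    have "0 < t" "a < t" "t < b" "t \<noteq> 1" using t \<sigma> ab by (auto simp: less_trans[of _ 1])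
    moreover from this have "continuous_on (path_image (circlepath 0 t)) f"
      using a by (intro continuous_on_subset[OF holomorphic_on_imp_continuous_on[OF f]]) auto
    moreover have "z - ?c j \<noteq> 0" if "z \<in> path_image (circlepath 0 t)" for z
      using that \<open>t \<noteq> 1\<close> \<open>0 < t\<close> c1[of j] by auto
    ultimately show ?thesis
      by (intro contour_integrable_continuous_circlepath continuous_on_divide continuous_intros) auto
  qed
  define q where "q = (\<lambda>z. f z * (z ^ (m - 1) / (z ^ m - ?w)))"
  have q: "(q has_contour_integral (1 / of_nat m * (\<Sum>j<m. ?I t (\<lambda>z. f z / (z - ?c j))))) (circlepath 0 t)"
    if t: "t = \<sigma> \<or> t = 1 / \<sigma>" for t
  proof -
    have "((\<lambda>z. 1 / of_nat m * (\<Sum>j<m. f z / (z - ?c j))) has_contour_integral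
        (1 / of_nat m * (\<Sum>j<m. ?I t (\<lambda>z. f z / (z - ?c j))))) (circlepath 0 t)"
      by (intro has_contour_integral_lmul has_contour_integral_sum has_contour_integral_integral int t) auto
    then show ?thesis
    proof (rule has_contour_integral_eq)
      fix z assume "z \<in> path_image (circlepath 0 t)"
      then have "cmod z = \<sigma> \<or> cmod z = 1 / \<sigma>" using t \<sigma> by auto
      from sums[OF zm[OF this]] show "1 / of_nat m * (\<Sum>j<m. f z / (z - ?c j)) = q z"
        using m by (simp add: q_def)
    qed
  qed
  have sum_f: "2 * of_real pi * \<i> * (1 / of_nat m * (\<Sum>j<m. f (?c j))) = ?I \<sigma> q - ?I (1 / \<sigma>) q"
  proof -
    have "2 * of_real pi * \<i> * f (?c j) = ?I \<sigma> (\<lambda>z. f z / (z - ?c j)) - ?I (1 / \<sigma>) (\<lambda>z. f z / (z - ?c j))" for j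
      by (rule Cauchy_formula_annulus[OF f a]) (use \<sigma> c1 in auto)
    then have "(\<Sum>j<m. 2 * of_real pi * \<i> * f (?c j))
        = (\<Sum>j<m. ?I \<sigma> (\<lambda>z. f z / (z - ?c j))) - (\<Sum>j<m. ?I (1 / \<sigma>) (\<lambda>z. f z / (z - ?c j)))"
      by (simp only: sum_subtractf)
    then show ?thesis
      unfolding contour_integral_unique[OF q[of \<sigma>, simplified]] contour_integral_unique[OF q[of "1 / \<sigma>", simplified]]
      by (simp add: sum_distrib_left[symmetric] right_diff_distrib[symmetric] diff_divide_distrib[symmetric])
  qed
  have c0: "((\<lambda>z. f z * z powi (- 1)) has_contour_integral 2 * of_real pi * \<i> * fourier_coeff f 0) (circlepath 0 \<sigma>)"
    using fourier_coeff_contour_integral[OF f a ab, of \<sigma> f 0] \<sigma> ab by simp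
  \<comment> \<open>With w = exp(i m \<alpha>), the difference of z^(m-1) / (z^m - w) and 1 / z is w
    / (z (z^m - w)), of modulus at most 1 / (\<sigma> (\<sigma>^m - 1)).\<close>
  have outer: "cmod (?I \<sigma> q - 2 * of_real pi * \<i> * fourier_coeff f 0) \<le> B * (1 / (\<sigma> * (\<sigma> ^ m - 1))) * (2 * pi * \<sigma>)"
  proof (rule has_contour_integral_bound_circlepath)
    show "((\<lambda>z. q z - f z * z powi (- 1)) has_contour_integral (?I \<sigma> q - 2 * of_real pi * \<i> * fourier_coeff f 0)) (circlepath 0 \<sigma>)"
      by (intro has_contour_integral_diff c0 has_contour_integral_integral) (use q[of \<sigma>] in \<open>auto simp: contour_integrable_on_def\<close>)
    show "0 \<le> B * (1 / (\<sigma> * (\<sigma> ^ m - 1)))" using B0 \<sigma> \<sigma>m by simp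
    fix z :: complex assume "cmod (z - 0) = \<sigma>"
    then have z: "cmod z = \<sigma>" "z \<noteq> 0" using \<sigma> by auto
    have zm': "z ^ m - ?w \<noteq> 0" using zm z by auto
    have "z ^ m = z ^ (m - 1) * z" using m by (metis Suc_diff_1 power_Suc2)
    then have "q z - f z * z powi (- 1) = f z * (?w / (z * (z ^ m - ?w)))"
      using z(2) zm' by (simp add: q_def field_simps)
    then have "cmod (q z - f z * z powi (- 1)) = cmod (f z) * (1 / (\<sigma> * cmod (z ^ m - ?w)))"
      using z by (simp add: norm_mult norm_divide)
    also have "\<dots> \<le> B * (1 / (\<sigma> * (\<sigma> ^ m - 1)))"
    proof (intro mult_mono divide_left_mono mult_left_mono)
      show "\<sigma> ^ m - 1 \<le> cmod (z ^ m - ?w)"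
        using norm_triangle_ineq2[of "z ^ m" ?w] z by (simp add: norm_power)
    qed (use B(1)[OF z(1)] B0 \<sigma> \<sigma>m zm' in auto)
    finally show "cmod (q z - f z * z powi (- 1)) \<le> B * (1 / (\<sigma> * (\<sigma> ^ m - 1)))" .
  qed (use \<sigma> in auto)
  \<comment> \<open>Here the summed kernel itself is small. Multiplied by the length of the circle,
    the bound equals that for the outer circle, which explains the factor 2 in the result.\<close>
  have inner: "cmod (?I (1 / \<sigma>) q) \<le> B * (\<sigma> / (\<sigma> ^ m - 1)) * (2 * pi * (1 / \<sigma>))"
  proof (rule has_contour_integral_bound_circlepath)
    show "(q has_contour_integral ?I (1 / \<sigma>) q) (circlepath 0 (1 / \<sigma>))"
      using q[of "1 / \<sigma>"] by (intro has_contour_integral_integral) (auto simp: contour_integrable_on_def)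
    show "0 \<le> B * (\<sigma> / (\<sigma> ^ m - 1))" using B0 \<sigma> \<sigma>m by simp
    fix z :: complex assume "cmod (z - 0) = 1 / \<sigma>"
    then have z: "cmod z = 1 / \<sigma>" by simp
    have zm': "z ^ m - ?w \<noteq> 0" using zm z by auto
    have "1 - 1 / \<sigma> ^ m \<le> cmod (z ^ m - ?w)"
      using norm_triangle_ineq2[of ?w "z ^ m"] z by (simp add: norm_power norm_minus_commute power_divide)
    moreover have "0 < 1 - 1 / \<sigma> ^ m" using \<sigma>m by (simp add: field_simps)
    ultimately have "1 / \<sigma> ^ (m - 1) / cmod (z ^ m - ?w) \<le> 1 / \<sigma> ^ (m - 1) / (1 - 1 / \<sigma> ^ m)"
      using \<sigma> zm' by (intro divide_left_mono) auto
    also have "\<dots> = \<sigma> / (\<sigma> ^ m - 1)"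
    proof -
      have "\<sigma> ^ m = \<sigma> ^ (m - 1) * \<sigma>" using m by (metis Suc_diff_1 power_Suc2)
      then show ?thesis using \<sigma> \<sigma>m by (simp add: field_simps)
    qed
    finally have "cmod (f z) * (1 / \<sigma> ^ (m - 1) / cmod (z ^ m - ?w)) \<le> B * (\<sigma> / (\<sigma> ^ m - 1))"
      using B(2)[OF z] B0 \<sigma> by (intro mult_mono) auto
    then show "cmod (q z) \<le> B * (\<sigma> / (\<sigma> ^ m - 1))"
      using z by (simp add: q_def norm_mult norm_divide norm_power power_divide)
  qed (use \<sigma> in auto)
  let ?E = "1 / of_nat m * (\<Sum>j<m. f (?c j)) - fourier_coeff f 0"
  have "2 * of_real pi * \<i> * ?E = (?I \<sigma> q - 2 * of_real pi * \<i> * fourier_coeff f 0) - ?I (1 / \<sigma>) q"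
    unfolding right_diff_distrib sum_f by simp
  then have "cmod (2 * of_real pi * \<i> * ?E) = cmod ((?I \<sigma> q - 2 * of_real pi * \<i> * fourier_coeff f 0) - ?I (1 / \<sigma>) q)"
    by (rule arg_cong)
  moreover have "cmod (2 * of_real pi * \<i> * ?E) = 2 * pi * cmod ?E"
    unfolding norm_mult by simp
  ultimately have "2 * pi * cmod ?E = cmod ((?I \<sigma> q - 2 * of_real pi * \<i> * fourier_coeff f 0) - ?I (1 / \<sigma>) q)"
    by (simp only:)
  also have "\<dots> \<le> B * (1 / (\<sigma> * (\<sigma> ^ m - 1))) * (2 * pi * \<sigma>) + B * (\<sigma> / (\<sigma> ^ m - 1)) * (2 * pi * (1 / \<sigma>))"
    by (rule order_trans[OF norm_triangle_ineq4 add_mono[OF outer inner]])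
  also have "\<dots> = 2 * pi * (2 * B / (\<sigma> ^ m - 1))"
  proof -
    have "B * (1 / (\<sigma> * X)) * (2 * pi * \<sigma>) + B * (\<sigma> / X) * (2 * pi * (1 / \<sigma>)) = 2 * pi * (2 * B / X)"
      if "X \<noteq> 0" for X
      using that \<sigma> by (simp add: field_simps)
    then show ?thesis using \<sigma>m by (metis diff_gt_0_iff_gt less_irrefl)
  qed
  finally show ?thesis using pi_gt_zero by (simp only: mult_le_cancel_left_pos zero_less_mult_iff zero_less_numeral simp_thms)
qed

section \<open>The Koopman operator and its EDMD sections\<close>

definition koopman_kernel :: "(complex \<Rightarrow> complex) \<Rightarrow> int \<Rightarrow> int \<Rightarrow> complex" where
  "koopman_kernel \<tau> l k = fourier_coeff (\<lambda>z. \<tau> z powi k) l"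

text \<open>The trapezoidal approximation of \<open>koopman_kernel\<close>. The row index l belongs
  to the test function and k to the observable, opposite to \<open>edmd_G\<close>; this order makes
  it the kernel of the transposed EDMD matrix.\<close>

definition edmd_kernel :: "(complex \<Rightarrow> complex) \<Rightarrow> real \<Rightarrow> nat \<Rightarrow> nat \<Rightarrow> int \<Rightarrow> int \<Rightarrow> complex" where
  "edmd_kernel \<tau> \<alpha> m n l k = (if \<bar>l\<bar> < int n \<and> \<bar>k\<bar> < int n then
     1 / of_nat m * (\<Sum>j<m. \<tau> (circle_points \<alpha> m j) powi k * cnj (circle_points \<alpha> m j powi l)) else 0)"

lemma cnj_circle_points_powi: "cnj (circle_points \<alpha> m j powi l) = circle_points \<alpha> m j powi (- l)"
  by (simp add: circle_points_cis cis_power_int cis_cnj)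

text \<open>Here all constants are fixed. They are chosen before \<alpha> and m, as one space has to
  serve for all admissible choices of the nodes.\<close>

lemma koopman_kernel_bounds:
  assumes \<tau>: "analytic_expanding_circle_map \<tau>" and \<delta>: "\<delta> > 1 + max_expansion \<tau>"
  obtains r s c where "0 < r" "r < 1" "2 < \<delta>"
    "\<And>\<alpha> m. (\<forall>n\<ge>1. real (m n) \<ge> \<delta> * real n) \<Longrightarrow>
      finite_sections r s c (koopman_kernel \<tau>) (\<lambda>n. edmd_kernel \<tau> \<alpha> (m n) n)"
proof -
  obtain g e \<kappa>1 \<kappa>2 x0 where x0: "0 < x0" and \<kappa>: "1 < \<kappa>1" "\<kappa>2 < \<delta> - 1" "0 < \<kappa>2"
    and e: "e = 1 \<or> e = (- 1 :: real)"
    and g: "g holomorphic_on {z. exp (- x0) < cmod z \<and> cmod z < exp x0}"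
    and g\<tau>: "\<And>z. z \<in> sphere 0 1 \<Longrightarrow> g z = \<tau> z"
    and grow: "\<And>z x. cmod z = exp x \<Longrightarrow> \<bar>x\<bar> < x0 \<Longrightarrow>
      \<exists>\<kappa>. \<kappa>1 \<le> \<kappa> \<and> \<kappa> \<le> \<kappa>2 \<and> cmod (g z) = exp (e * x * \<kappa>)"
    by (rule expanding_radial_growth[OF \<tau> \<delta>]) (rule that)
  have "\<kappa>1 \<le> \<kappa>2" using grow[of 1 0] x0 by force
  \<comment> \<open>The expansion forces \<delta> above 2, so that later m \<ge> 2 n and differences
    of indices from the block stay below m.\<close>
  then have \<delta>2: "2 < \<delta>" using \<kappa> by linarith
  let ?A = "{z::complex. exp (- x0) < cmod z \<and> cmod z < exp x0}"
  have gpow: "cmod (g z powi k) = exp (e * x * \<kappa> * real_of_int k)" if "cmod (g z) = exp (e * x * \<kappa>)" for z x \<kappa> k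
    using that by (simp add: norm_power_int exp_power_int mult_ac)
  have nz: "g z \<noteq> 0" if "z \<in> ?A" for z
  proof -
    have pos: "0 < cmod z" using that exp_gt_zero[of "- x0"] by (auto intro: less_trans)
    then have "- x0 < ln (cmod z)" "ln (cmod z) < x0" using that pos ln_less_cancel_iff[of "exp (- x0)" "cmod z"] ln_less_cancel_iff[of "cmod z" "exp x0"] by auto
    then show ?thesis using grow[of z "ln (cmod z)"] pos by (auto simp: abs_less_iff)
  qed
  have hol: "(\<lambda>z. g z powi k) holomorphic_on ?A" for k
    using nz by (intro holomorphic_intros g) auto
  have ring: "0 < exp (- x0)" "exp (- x0) < 1" "1 < exp x0" using x0 by auto
  have T1: "cmod (koopman_kernel \<tau> l k) \<le> exp (x * \<bar>real_of_int l\<bar> - \<kappa>1 * x * \<bar>real_of_int k\<bar>)"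
    if x: "0 < x" "x < x0" for x l k
  proof -
    \<comment> \<open>The circle of radius exp t is taken on the side where the k-th power of
      \<open>g\<close> is small; this depends on the orientation and on the sign of k.\<close>
    define t where "t = (if 0 \<le> e * real_of_int k then - x else x)"
    have t: "\<bar>t\<bar> = x" "e * t * real_of_int k = - x * \<bar>real_of_int k\<bar>"
      using x e by (auto simp: t_def abs_if)
    have "cmod (koopman_kernel \<tau> l k) \<le> exp (- \<kappa>1 * x * \<bar>real_of_int k\<bar>) * exp t powi (- l)"
      unfolding koopman_kernel_def
    proof (rule fourier_coeff_le[OF hol[of k] ring])
      show "exp (- x0) < exp t" "exp t < exp x0" using t x by auto
      fix z :: complex assume z: "cmod z = exp t"
      then obtain \<kappa> where k: "\<kappa>1 \<le> \<kappa>" "cmod (g z) = exp (e * t * \<kappa>)" using grow[OF z] t x by auto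
      have "e * t * \<kappa> * real_of_int k = - x * \<bar>real_of_int k\<bar> * \<kappa>"
        using t(2) by (metis mult.assoc mult.commute)
      also have "\<dots> \<le> - \<kappa>1 * x * \<bar>real_of_int k\<bar>"
        using k(1) x mult_left_mono[of \<kappa>1 \<kappa> "x * \<bar>real_of_int k\<bar>"] by (simp add: mult_ac)
      finally show "cmod (g z powi k) \<le> exp (- \<kappa>1 * x * \<bar>real_of_int k\<bar>)" using gpow[OF k(2)] by simp
    qed (use g\<tau> in auto)
    also have "\<dots> = exp (- (t * real_of_int l) - \<kappa>1 * x * \<bar>real_of_int k\<bar>)"
      unfolding exp_power_int by (simp add: exp_add[symmetric] mult_ac)
    also have "\<dots> \<le> exp (x * \<bar>real_of_int l\<bar> - \<kappa>1 * x * \<bar>real_of_int k\<bar>)"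
    proof -
      have "\<bar>t * real_of_int l\<bar> = x * \<bar>real_of_int l\<bar>" using t(1) by (simp add: abs_mult)
      then show ?thesis by simp
    qed
    finally show ?thesis .
  qed
  define x1 where "x1 = x0 / 2"
  have x1: "0 < x1" "x1 < x0" using x0 by (auto simp: x1_def)
  \<comment> \<open>Replaces 2 / (\<sigma>^m - 1) by a constant times \<sigma>^(-m) for \<sigma> =
    exp x1 and m \<ge> 1.\<close>
  define C where "C = 2 / (1 - exp (- x1))"
  have C: "0 < C" using x1 by (simp add: C_def)
  have aliasing: "cmod (koopman_kernel \<tau> l k - edmd_kernel \<tau> \<alpha> m n l k)
      \<le> C * exp (\<kappa>2 * x1 * \<bar>real_of_int k\<bar> + x1 * \<bar>real_of_int l\<bar> - x1 * real m)"
    if m: "0 < m" and lk: "\<bar>l\<bar> < int n" "\<bar>k\<bar> < int n" for \<alpha> m n l k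
  proof -
    \<comment> \<open>On the circle conjugation is inversion, so the exact entry is the mean of
      \<open>F\<close> over the circle and the EDMD entry is its mean over the nodes.\<close>
    define F where "F = (\<lambda>z. g z powi k * z powi (- l))"
    let ?B = "exp (\<kappa>2 * x1 * \<bar>real_of_int k\<bar> + x1 * \<bar>real_of_int l\<bar>)"
    have "(\<lambda>z::complex. z powi (- l)) holomorphic_on ?A"
      using ring by (intro holomorphic_intros) auto
    then have F: "F holomorphic_on ?A" unfolding F_def by (intro holomorphic_on_mult hol)
    have FB: "cmod (F z) \<le> ?B" if z: "cmod z = exp t" and t: "\<bar>t\<bar> = x1" for z t
    proof -
      obtain \<kappa>' where k: "\<kappa>1 \<le> \<kappa>'" "\<kappa>' \<le> \<kappa>2" "cmod (g z) = exp (e * t * \<kappa>')" using grow[OF z] t x1 by auto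
      have "e * t * \<kappa>' * real_of_int k \<le> \<bar>e * t * \<kappa>' * real_of_int k\<bar>" by simp
      also have "\<dots> = \<kappa>' * (x1 * \<bar>real_of_int k\<bar>)" using e t k(1) \<kappa>(1) by (auto simp: abs_mult)
      also have "\<dots> \<le> \<kappa>2 * (x1 * \<bar>real_of_int k\<bar>)" using k(2) x1 by (intro mult_right_mono) auto
      finally have 1: "cmod (g z powi k) \<le> exp (\<kappa>2 * x1 * \<bar>real_of_int k\<bar>)" using gpow[OF k(3)] by (simp add: mult_ac)
      have "- (real_of_int l * t) \<le> \<bar>real_of_int l * t\<bar>" by linarith
      also have "\<dots> = x1 * \<bar>real_of_int l\<bar>" using t by (simp add: abs_mult)
      finally have 2: "cmod (z powi (- l)) \<le> exp (x1 * \<bar>real_of_int l\<bar>)"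
        using z by (simp add: norm_power_int exp_power_int del: power_int_minus)
      show ?thesis unfolding F_def norm_mult exp_add by (rule mult_mono[OF 1 2]) auto
    qed
    have c1: "circle_points \<alpha> m j \<in> sphere 0 1" for j by (simp add: circle_points_cis)
    have "edmd_kernel \<tau> \<alpha> m n l k = 1 / of_nat m * (\<Sum>j<m. F (circle_points \<alpha> m j))"
      using lk by (simp add: edmd_kernel_def F_def g\<tau>[OF c1] cnj_circle_points_powi del: complex_cnj_power_int)
    moreover have "koopman_kernel \<tau> l k = fourier_coeff F 0"
      unfolding koopman_kernel_def fourier_coeff_def
      by (simp add: F_def g\<tau> cis_power_int del: power_int_minus)
    ultimately have "cmod (koopman_kernel \<tau> l k - edmd_kernel \<tau> \<alpha> m n l k)
        = cmod (1 / of_nat m * (\<Sum>j<m. F (circle_points \<alpha> m j)) - fourier_coeff F 0)"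
      by (simp only: norm_minus_commute)
    also have "\<dots> \<le> 2 * ?B / (exp x1 ^ m - 1)"
    proof (rule trapezoidal_rule_error[OF F ring(1) _ _ _ m])
      show "1 < exp x1" "exp x1 < exp x0" using x1 by auto
      show "exp (- x0) < 1 / exp x1" using x1 by (simp add: inverse_eq_divide[symmetric] exp_minus[symmetric])
      fix z :: complex
      show "cmod (F z) \<le> ?B" if "cmod z = exp x1" using FB[OF that] x1 by simp
      show "cmod (F z) \<le> ?B" if "cmod z = 1 / exp x1"
        using FB[of z "- x1"] that x1 by (simp add: exp_minus inverse_eq_divide)
    qed
    also have "\<dots> \<le> 2 * ?B / (exp x1 ^ m * (1 - exp (- x1)))"
    proof -
      have "exp x1 ^ m * exp (- x1) = exp x1 ^ (m - 1)"
        using m by (cases m) (auto simp: exp_minus)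
      moreover have "1 \<le> exp x1 ^ (m - 1)" using x1 by (intro one_le_power) auto
      ultimately have "exp x1 ^ m * (1 - exp (- x1)) \<le> exp x1 ^ m - 1" by (simp add: right_diff_distrib)
      moreover have "0 < exp x1 ^ m * (1 - exp (- x1))" using x1 by simp
      ultimately show ?thesis by (intro divide_left_mono) auto
    qed
    also have "\<dots> = C * (?B / exp x1 ^ m)" by (simp add: C_def)
    also have "?B / exp x1 ^ m = exp (\<kappa>2 * x1 * \<bar>real_of_int k\<bar> + x1 * \<bar>real_of_int l\<bar> - x1 * real m)"
      by (simp add: exp_diff exp_of_nat_mult[symmetric] mult.commute)
    finally show ?thesis .
  qed
  \<comment> \<open>The surplus: for |l|, |k| < n and m \<ge> \<delta> n the aliasing error is at
    most C exp(- \<Omega> n).\<close>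
  define \<Omega> where "\<Omega> = x1 * (\<delta> - 1 - \<kappa>2)"
  have \<Omega>: "0 < \<Omega>" using x1 \<kappa> by (simp add: \<Omega>_def)
  \<comment> \<open>The second term gives y \<le> \<Omega> / 2, so the column weight r^|k| costs at
    most half of the surplus.\<close>
  define x where "x = min x1 (\<Omega> / (1 + \<kappa>1))"
  \<comment> \<open>The weight exponent is the midpoint of x and \<kappa>1 x. The weighted entries
    of the Koopman kernel are bounded by exp((x - y) |l| - (\<kappa>1 x - y) |k|) and thus decay at
    rate \<eta> in both indices.\<close>
  define y where "y = x * (1 + \<kappa>1) / 2"
  define \<eta> where "\<eta> = x * (\<kappa>1 - 1) / 2"
  \<comment> \<open>The bound s^(n + |l| + |k|) has to hold in two regions. Outside the block n
    \<le> |l| + |k|, so \<eta> / 2 is affordable; inside, the sum is at most 3 n, and \<Omega> / 6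
    consumes the remaining half of the surplus.\<close>
  define \<theta> where "\<theta> = min (\<eta> / 2) (\<Omega> / 6)"
  have x: "0 < x" "x < x0" using x1 \<Omega> \<kappa> by (auto simp: x_def)
  have y: "0 < y" using x \<kappa> by (simp add: y_def)
  have "x * (1 + \<kappa>1) \<le> \<Omega> / (1 + \<kappa>1) * (1 + \<kappa>1)"
    using \<kappa> by (intro mult_right_mono) (auto simp: x_def)
  then have y\<Omega>: "y \<le> \<Omega> / 2" using \<kappa> by (simp add: y_def)
  have \<eta>: "0 < \<eta>" "x = y - \<eta>" "\<kappa>1 * x = y + \<eta>" using x \<kappa> by (auto simp: \<eta>_def y_def field_simps)
  have \<theta>: "0 < \<theta>" "\<theta> \<le> \<eta> / 2" "\<theta> \<le> \<Omega> / 6" using \<eta> \<Omega> by (auto simp: \<theta>_def)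
  define r where "r = exp (- y)"
  define s where "s = exp (- \<theta>)"
  define c where "c = max 1 C"
  have pow: "exp u ^ nat \<bar>l\<bar> = exp (\<bar>real_of_int l\<bar> * u)" for u :: real and l
    by (simp add: exp_of_nat_mult[symmetric])
  have pown: "exp u ^ n = exp (real n * u)" for u :: real and n
    by (simp add: exp_of_nat_mult)
  have T2: "cmod (koopman_kernel \<tau> l k) * r ^ nat \<bar>l\<bar> \<le> exp (- \<eta> * (\<bar>real_of_int l\<bar> + \<bar>real_of_int k\<bar>) - y * \<bar>real_of_int k\<bar>)" for l k
  proof -
    have "cmod (koopman_kernel \<tau> l k) * r ^ nat \<bar>l\<bar>
        \<le> exp (x * \<bar>real_of_int l\<bar> - \<kappa>1 * x * \<bar>real_of_int k\<bar>) * exp (\<bar>real_of_int l\<bar> * - y)"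
      unfolding r_def pow by (intro mult_right_mono T1 x) auto
    also have "\<dots> = exp (- \<eta> * (\<bar>real_of_int l\<bar> + \<bar>real_of_int k\<bar>) - y * \<bar>real_of_int k\<bar>)"
      unfolding exp_add[symmetric] \<eta>(3) by (subst \<eta>(2)) (simp add: algebra_simps)
    finally show ?thesis .
  qed
  have c1: "1 \<le> c" "C \<le> c" by (auto simp: c_def)
  have rhs: "c' * s ^ nat \<bar>l\<bar> * (s ^ nat \<bar>k\<bar> * r ^ nat \<bar>k\<bar>)
      = c' * exp (- \<theta> * (\<bar>real_of_int l\<bar> + \<bar>real_of_int k\<bar>) - y * \<bar>real_of_int k\<bar>)" for c' l k
    unfolding r_def s_def pow by (simp add: exp_add[symmetric] mult.assoc algebra_simps)
  have fin: "finite_sections r s c (koopman_kernel \<tau>) (\<lambda>n. edmd_kernel \<tau> \<alpha> (m n) n)"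
    if m: "\<forall>n\<ge>1. real (m n) \<ge> \<delta> * real n" for \<alpha> m
  proof
    show "0 < r" "0 < s" "s < 1" "0 < c" using y \<theta> c1 by (auto simp: r_def s_def)
    show "kernel_bound r s c (koopman_kernel \<tau>)"
      unfolding kernel_bound_def rhs
    proof (intro allI)
      fix l k
      have "- \<eta> * (\<bar>real_of_int l\<bar> + \<bar>real_of_int k\<bar>) \<le> - \<theta> * (\<bar>real_of_int l\<bar> + \<bar>real_of_int k\<bar>)"
        using \<theta> \<eta> by (intro mult_right_mono) auto
      then have "exp (- \<eta> * (\<bar>real_of_int l\<bar> + \<bar>real_of_int k\<bar>) - y * \<bar>real_of_int k\<bar>)
          \<le> 1 * exp (- \<theta> * (\<bar>real_of_int l\<bar> + \<bar>real_of_int k\<bar>) - y * \<bar>real_of_int k\<bar>)" by simp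
      also have "\<dots> \<le> c * exp (- \<theta> * (\<bar>real_of_int l\<bar> + \<bar>real_of_int k\<bar>) - y * \<bar>real_of_int k\<bar>)"
        using c1 by (intro mult_right_mono) auto
      finally show "cmod (koopman_kernel \<tau> l k) * r ^ nat \<bar>l\<bar>
          \<le> c * exp (- \<theta> * (\<bar>real_of_int l\<bar> + \<bar>real_of_int k\<bar>) - y * \<bar>real_of_int k\<bar>)"
        using T2[of l k] by linarith
    qed
    show "edmd_kernel \<tau> \<alpha> (m n) n l k = 0" if "\<not> (\<bar>l\<bar> < int n \<and> \<bar>k\<bar> < int n)" for n l k
      using that by (auto simp: edmd_kernel_def)
    fix n
    show "kernel_bound r s (c * s ^ n) (\<lambda>l k. koopman_kernel \<tau> l k - edmd_kernel \<tau> \<alpha> (m n) n l k)"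
      unfolding kernel_bound_def rhs
    proof (intro allI)
      fix l k
      let ?l = "\<bar>real_of_int l\<bar>" and ?k = "\<bar>real_of_int k\<bar>"
      have R: "c * s ^ n * exp (- \<theta> * (?l + ?k) - y * ?k) = c * exp (- \<theta> * (real n + ?l + ?k) - y * ?k)"
        unfolding s_def pown by (simp add: exp_add[symmetric] mult.assoc algebra_simps)
      show "cmod (koopman_kernel \<tau> l k - edmd_kernel \<tau> \<alpha> (m n) n l k) * r ^ nat \<bar>l\<bar>
          \<le> c * s ^ n * exp (- \<theta> * (?l + ?k) - y * ?k)"
      proof (cases "\<bar>l\<bar> < int n \<and> \<bar>k\<bar> < int n")
        case False
        \<comment> \<open>Outside the block the section vanishes and the error is the Koopman entry
          itself; half of its decay pays for the factor s^n.\<close>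
        then have "real n \<le> ?l + ?k" by linarith
        then have "\<theta> * (real n + ?l + ?k) \<le> \<theta> * (2 * (?l + ?k))" using \<theta> by (intro mult_left_mono) auto
        also have "\<dots> \<le> \<eta> / 2 * (2 * (?l + ?k))" using \<theta> by (intro mult_right_mono) auto
        also have "\<dots> = \<eta> * (?l + ?k)" by simp
        finally have "\<theta> * (real n + ?l + ?k) \<le> \<eta> * (?l + ?k)" .
        then have "- \<eta> * (?l + ?k) - y * ?k \<le> - \<theta> * (real n + ?l + ?k) - y * ?k" by simp
        then have "exp (- \<eta> * (?l + ?k) - y * ?k) \<le> 1 * exp (- \<theta> * (real n + ?l + ?k) - y * ?k)" by simp
        also have "\<dots> \<le> c * exp (- \<theta> * (real n + ?l + ?k) - y * ?k)"
          using c1 by (intro mult_right_mono) auto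
        finally have "exp (- \<eta> * (?l + ?k) - y * ?k) \<le> c * exp (- \<theta> * (real n + ?l + ?k) - y * ?k)" .
        moreover have "edmd_kernel \<tau> \<alpha> (m n) n l k = 0" using False by (auto simp: edmd_kernel_def)
        ultimately show ?thesis unfolding R using T2[of l k] by simp
      next
        case True
        then have lk: "?l \<le> real n" "?k \<le> real n" and n: "1 \<le> n" by linarith+
        have mn: "\<delta> * real n \<le> real (m n)" using m n by blast
        moreover have "0 < \<delta> * real n" using \<delta>2 n by simp
        ultimately have "0 < m n" by linarith
        \<comment> \<open>The row weight only helps and is dropped; inside the block only the column
          weight has to be paid for.\<close>
        have "r ^ nat \<bar>l\<bar> \<le> 1" using y by (auto simp: r_def intro!: power_le_one)
        then have "cmod (koopman_kernel \<tau> l k - edmd_kernel \<tau> \<alpha> (m n) n l k) * r ^ nat \<bar>l\<bar>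
            \<le> cmod (koopman_kernel \<tau> l k - edmd_kernel \<tau> \<alpha> (m n) n l k) * 1"
          by (intro mult_left_mono) auto
        also have "\<dots> \<le> C * exp (\<kappa>2 * x1 * ?k + x1 * ?l - x1 * real (m n))"
          using aliasing[OF \<open>0 < m n\<close>] True by simp
        also have "\<dots> \<le> C * exp (- \<theta> * (real n + ?l + ?k) - y * ?k)"
        proof -
          have "\<kappa>2 * x1 * ?k + x1 * ?l - x1 * real (m n) \<le> \<kappa>2 * x1 * real n + x1 * real n - x1 * (\<delta> * real n)"
            using lk mn x1 \<kappa> by (intro diff_mono add_mono mult_left_mono) auto
          also have "\<dots> = - \<Omega> * real n" by (simp add: \<Omega>_def algebra_simps)
          finally have 1: "\<kappa>2 * x1 * ?k + x1 * ?l - x1 * real (m n) \<le> - \<Omega> * real n" .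
          have "\<theta> * (real n + ?l + ?k) \<le> \<Omega> / 6 * (3 * real n)"
            using \<theta> \<Omega> lk by (intro mult_mono) auto
          moreover have "y * ?k \<le> \<Omega> / 2 * real n" using y y\<Omega> \<Omega> lk by (intro mult_mono) auto
          ultimately have "\<kappa>2 * x1 * ?k + x1 * ?l - x1 * real (m n) \<le> - \<theta> * (real n + ?l + ?k) - y * ?k"
            using 1 by (simp add: algebra_simps)
          then show ?thesis using C by simp
        qed
        also have "\<dots> \<le> c * exp (- \<theta> * (real n + ?l + ?k) - y * ?k)"
          using c1 by (intro mult_right_mono) auto
        finally show ?thesis unfolding R .
      qed
    qed
  qed
  have "0 < r" "r < 1" using y by (auto simp: r_def)
  then show ?thesis using that \<delta>2 fin by blast
qed

text \<open>On Laurent polynomials the kernel sum is finite, and linearity of the Fourier integral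
  gives the claim. The holomorphic extension serves only to provide continuity of \<tau> on the
  circle.\<close>

lemma koopman_operator_kernel:
  assumes \<tau>: "analytic_expanding_circle_map \<tau>"
    and K: "0 < r" "0 < s" "s < 1" "0 \<le> c" "kernel_bound r s c (koopman_kernel \<tau>)"
  shows "is_koopman_operator \<tau> r (kernel_operator (koopman_kernel \<tau>))"
  unfolding is_koopman_operator_def
proof (intro conjI ballI)
  show "H2_bounded_operator r (kernel_operator (koopman_kernel \<tau>))"
    by (rule kernel_operator_H2_bounded[OF K])
  fix p assume "p \<in> laurent_polynomials"
  then obtain N a where p: "p = (\<lambda>z. \<Sum>k\<in>{- int N..int N}. a k * z powi k)"
    by (auto simp: laurent_polynomials_def)
  obtain \<rho> h where h: "0 < \<rho>" "\<rho> < 1" "h holomorphic_on annulus \<rho>" "\<And>z. z \<in> sphere 0 1 \<Longrightarrow> h z = \<tau> z"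
    using \<tau> unfolding analytic_expanding_circle_map_def by blast
  have cis_in: "cis t \<in> annulus \<rho>" for t using h by (auto simp: annulus_def one_less_inverse)
  have "continuous_on {0..2 * pi} (\<lambda>t. h (cis t))"
    by (rule continuous_on_compose2[OF holomorphic_on_imp_continuous_on[OF h(3)]])
       (use cis_in in \<open>auto intro!: continuous_intros\<close>)
  then have cont: "continuous_on {0..2 * pi} (\<lambda>t. \<tau> (cis t))" by (simp add: h(4))
  have "\<tau> ` sphere 0 1 \<subseteq> sphere 0 1" using \<tau> unfolding analytic_expanding_circle_map_def by blast
  then have "\<tau> (cis t) \<in> sphere 0 1" for t by (rule subsetD) simp
  then have nz: "\<tau> (cis t) \<noteq> 0" for t by (metis mem_sphere_0 norm_zero zero_neq_one)
  show "kernel_operator (koopman_kernel \<tau>) (fourier_coeff p) = fourier_coeff (p \<circ> \<tau>)"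
  proof
    fix l
    let ?f = "\<lambda>k t. \<tau> (cis t) powi k * cis (- (of_int l * t))"
    have "kernel_operator (koopman_kernel \<tau>) (fourier_coeff p) l
        = (\<Sum>k\<in>{- int N..int N}. koopman_kernel \<tau> l k * fourier_coeff p k)"
      by (rule kernel_operator_finite) (auto simp: p fourier_coeff_laurent)
    also have "\<dots> = (\<Sum>k\<in>{- int N..int N}. a k * koopman_kernel \<tau> l k)"
      by (intro sum.cong) (auto simp: p fourier_coeff_laurent)
    finally have 1: "kernel_operator (koopman_kernel \<tau>) (fourier_coeff p) l
        = (\<Sum>k\<in>{- int N..int N}. a k * koopman_kernel \<tau> l k)" .
    have "(?f k has_integral integral {0..2 * pi} (?f k)) {0..2 * pi}" for k
      using nz by (intro integrable_integral integrable_continuous_interval continuous_intros cont) auto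
    then have "((\<lambda>t. \<Sum>k\<in>{- int N..int N}. a k * ?f k t) has_integral
        (\<Sum>k\<in>{- int N..int N}. a k * integral {0..2 * pi} (?f k))) {0..2 * pi}"
      by (intro has_integral_sum has_integral_mult_right) auto
    moreover have "(\<lambda>t. \<Sum>k\<in>{- int N..int N}. a k * ?f k t) = (\<lambda>t. (p \<circ> \<tau>) (cis t) * cis (- (of_int l * t)))"
      by (auto simp: p sum_distrib_right mult.assoc)
    ultimately have "integral {0..2 * pi} (\<lambda>t. (p \<circ> \<tau>) (cis t) * cis (- (of_int l * t)))
        = (\<Sum>k\<in>{- int N..int N}. a k * integral {0..2 * pi} (?f k))"
      by (simp only: integral_unique)
    then have "fourier_coeff (p \<circ> \<tau>) l = (\<Sum>k\<in>{- int N..int N}. a k * koopman_kernel \<tau> l k)"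
      by (simp add: fourier_coeff_def koopman_kernel_def sum_distrib_left mult_ac)
    then show "kernel_operator (koopman_kernel \<tau>) (fourier_coeff p) l = fourier_coeff (p \<circ> \<tau>) l"
      using 1 by simp
  qed
qed

lemma mat_inverse_one: "mat_inverse (1\<^sub>m N :: complex mat) = Some (1\<^sub>m N)"
proof (cases "mat_inverse (1\<^sub>m N :: complex mat)")
  case None
  have "(1\<^sub>m N :: complex mat) \<in> Units (ring_mat TYPE(complex) N ())"
    by (rule det_non_zero_imp_unit) auto
  then show ?thesis using mat_inverse(1)[OF one_carrier_mat None, of "()"] by blast
next
  case (Some B)
  from mat_inverse(2)[OF one_carrier_mat Some] show ?thesis using Some by auto
qed

text \<open>Two indices of the block differ by at most 2 n - 2 < m, so the orthogonality relation
  makes \<open>edmd_H\<close> the identity and the EDMD matrix reduces to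
  \<open>edmd_G\<close>.\<close>

lemma transpose_circle_edmd:
  assumes m: "2 * n \<le> m" and n: "1 \<le> n"
  shows "transpose_mat (circle_edmd \<tau> \<alpha> m n) = centred_mat n (edmd_kernel \<tau> \<alpha> m n)"
proof -
  let ?N = "2 * n - 1" and ?\<psi> = "\<lambda>l z. z powi l :: complex" and ?z = "circle_points \<alpha> m"
  have H: "edmd_H ?\<psi> m ?z n = 1\<^sub>m ?N"
  proof (rule eq_matI)
    fix i j assume "i < dim_row (1\<^sub>m ?N :: complex mat)" "j < dim_col (1\<^sub>m ?N :: complex mat)"
    then have ij: "i < ?N" "j < ?N" by auto
    have "(\<Sum>s<m. ?z s powi centred n i * cnj (?z s powi centred n j)) = (\<Sum>s<m. ?z s powi (centred n i - centred n j))"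
    proof (rule sum.cong[OF refl])
      have "cis u powi a * cnj (cis u powi b) = cis u powi (a - b)" for u a b
        unfolding cis_power_int cis_cnj cis_mult by (simp add: left_diff_distrib)
      then show "?z s powi centred n i * cnj (?z s powi centred n j) = ?z s powi (centred n i - centred n j)" for s
        unfolding circle_points_cis .
    qed
    also have "\<dots> = (if centred n i - centred n j = 0 then of_nat m else 0)"
      using abs_centred[OF ij(1)] abs_centred[OF ij(2)] m by (intro sum_circle_points_powi) linarith
    finally show "edmd_H ?\<psi> m ?z n $$ (i, j) = 1\<^sub>m ?N $$ (i, j)"
      using ij m n by (simp add: edmd_H_def centred_eq_iff del: complex_cnj_power_int)
  qed (auto simp: edmd_H_def)
  have G: "edmd_G \<tau> ?\<psi> m ?z n \<in> carrier_mat ?N ?N" by (simp add: edmd_G_def)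
  have "circle_edmd \<tau> \<alpha> m n = edmd_G \<tau> ?\<psi> m ?z n"
    unfolding circle_edmd_def edmd_matrix_def H mat_inverse_one option.sel by (rule right_mult_one_mat[OF G])
  then show ?thesis
    by (auto intro!: eq_matI simp: edmd_G_def edmd_kernel_def abs_centred simp del: complex_cnj_power_int One_nat_def)
qed

section \<open>Vectors of length 2n - 1 as finitely supported sequences\<close>

definition seq_of_vec :: "nat \<Rightarrow> complex Matrix.vec \<Rightarrow> int \<Rightarrow> complex" where
  "seq_of_vec n v k = (if \<bar>k\<bar> < int n then centred_entry n v k else 0)"

lemma seq_of_vec_centred:
  assumes "i < 2 * n - 1"
  shows "seq_of_vec n v (centred n i) = vec_index v i"
proof -
  have "nat (centred n i + int n - 1) = i" by (simp add: centred_def)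
  then show ?thesis using abs_centred[OF assms] by (simp add: seq_of_vec_def centred_entry_def)
qed

lemma fourier_coeff_laurent_of_vec: "fourier_coeff (laurent_of_vec n v) = seq_of_vec n v"
proof
  fix k
  have "laurent_of_vec n v = (\<lambda>z. \<Sum>k\<in>{k. \<bar>k\<bar> < int n}. centred_entry n v k * z powi k)"
    by (simp add: laurent_of_vec_def fun_eq_iff)
  then show "fourier_coeff (laurent_of_vec n v) k = seq_of_vec n v k"
    by (simp add: fourier_coeff_laurent[OF finite_abs_less] seq_of_vec_def)
qed

context finite_sections
begin

lemma centred_mat_mult_seq:
  assumes v: "v \<in> carrier_vec (2 * n - 1)" and i: "i < 2 * n - 1"
  shows "vec_index (centred_mat n (A n) *\<^sub>v v) i = kA n (seq_of_vec n v) (centred n i)"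
proof -
  have "vec_index (centred_mat n (A n) *\<^sub>v v) i
      = (\<Sum>j=0..<2 * n - 1. A n (centred n i) (centred n j) * seq_of_vec n v (centred n j))"
    using v i by (simp add: scalar_prod_def seq_of_vec_centred)
  also have "\<dots> = kA n (seq_of_vec n v) (centred n i)"
    unfolding kA_sum by (rule sum_centred[of "\<lambda>k. A n (centred n i) k * seq_of_vec n v k"])
  finally show ?thesis .
qed

lemma seq_eqI:
  assumes "\<And>k. \<not> \<bar>k\<bar> < int n \<Longrightarrow> f k = h k" "\<And>i. i < 2 * n - 1 \<Longrightarrow> f (centred n i) = h (centred n i)"
  shows "f = h"
proof
  fix k show "f k = h k" using assms obtain_centred[of k n] by (cases "\<bar>k\<bar> < int n") metis+
qed

lemma eigenvalue_iff_is_eigenvalue: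
  "eigenvalue (centred_mat n (A n)) \<mu> \<longleftrightarrow> is_eigenvalue n \<mu>"
proof
  assume "eigenvalue (centred_mat n (A n)) \<mu>"
  then obtain v where v: "v \<in> carrier_vec (2 * n - 1)" "v \<noteq> 0\<^sub>v (2 * n - 1)"
    "centred_mat n (A n) *\<^sub>v v = \<mu> \<cdot>\<^sub>v v"
    unfolding eigenvalue_def eigenvector_def by auto
  have "kA n (seq_of_vec n v) = (\<lambda>k. \<mu> * seq_of_vec n v k)"
  proof (rule seq_eqI)
    fix i assume i: "i < 2 * n - 1"
    show "kA n (seq_of_vec n v) (centred n i) = \<mu> * seq_of_vec n v (centred n i)"
      unfolding centred_mat_mult_seq[OF v(1) i, symmetric] v(3) seq_of_vec_centred[OF i] using v(1) i by simp
  qed (simp add: kA_support seq_of_vec_def)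
  moreover have "seq_of_vec n v \<noteq> (\<lambda>_. 0)"
  proof
    assume z: "seq_of_vec n v = (\<lambda>_. 0)"
    have "v = 0\<^sub>v (2 * n - 1)"
      by (rule eq_vecI) (use v(1) seq_of_vec_centred[of _ n v] in \<open>simp_all add: z\<close>)
    then show False using v(2) by simp
  qed
  ultimately show "is_eigenvalue n \<mu>"
    unfolding is_eigenvalue_def by (intro exI[of _ "seq_of_vec n v"]) (auto simp: seq_of_vec_def)
next
  assume "is_eigenvalue n \<mu>"
  then obtain h where h: "h \<noteq> (\<lambda>_. 0)" "\<And>k. \<not> \<bar>k\<bar> < int n \<Longrightarrow> h k = 0" "kA n h = (\<lambda>k. \<mu> * h k)"
    unfolding is_eigenvalue_def by auto
  define v where "v = Matrix.vec (2 * n - 1) (\<lambda>i. h (centred n i))"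
  have v: "v \<in> carrier_vec (2 * n - 1)" by (simp add: v_def)
  have vh: "seq_of_vec n v = h"
  proof (rule seq_eqI)
    show "seq_of_vec n v (centred n i) = h (centred n i)" if "i < 2 * n - 1" for i
      unfolding seq_of_vec_centred[OF that] using that by (simp add: v_def)
  qed (simp add: seq_of_vec_def h(2))
  have "centred_mat n (A n) *\<^sub>v v = \<mu> \<cdot>\<^sub>v v"
  proof (rule eq_vecI)
    fix i assume "i < dim_vec (\<mu> \<cdot>\<^sub>v v)"
    then have i: "i < 2 * n - 1" by (simp add: v_def)
    show "vec_index (centred_mat n (A n) *\<^sub>v v) i = vec_index (\<mu> \<cdot>\<^sub>v v) i"
      unfolding centred_mat_mult_seq[OF v i] vh h(3) using i by (simp add: v_def)
  qed (simp add: v_def)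
  moreover have "v \<noteq> 0\<^sub>v (2 * n - 1)"
  proof
    assume z: "v = 0\<^sub>v (2 * n - 1)"
    have "h = (\<lambda>_. 0)"
    proof (rule seq_eqI[of n])
      show "h (centred n i) = 0" if "i < 2 * n - 1" for i
        using seq_of_vec_centred[OF that, of v] that unfolding vh by (simp add: z)
    qed (simp add: h(2))
    then show False using h(1) by simp
  qed
  ultimately show "eigenvalue (centred_mat n (A n)) \<mu>"
    unfolding eigenvalue_def eigenvector_def using v by auto
qed

text \<open>Transports generalised eigenvectors: annihilation by a power of the matrix \<mu> - A
  becomes nilpotency of \<open>shift\<close>, the hypothesis of the comparison of
  projections.\<close>

lemma seq_of_vec_pow_shift:
  assumes "v \<in> carrier_vec (2 * n - 1)"
  shows "seq_of_vec n (((\<mu> \<cdot>\<^sub>m 1\<^sub>m (2 * n - 1) - centred_mat n (A n)) ^\<^sub>m \<nu>) *\<^sub>v v) = (shift n \<mu> ^^ \<nu>) (seq_of_vec n v)"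
  using assms
proof (induction \<nu> arbitrary: v)
  case (Suc \<nu>)
  let ?N = "2 * n - 1"
  let ?X = "\<mu> \<cdot>\<^sub>m 1\<^sub>m ?N - centred_mat n (A n)"
  have X: "?X \<in> carrier_mat ?N ?N" by (rule minus_carrier_mat[OF centred_mat_carrier])
  have Xv: "?X *\<^sub>v v \<in> carrier_vec ?N" by (rule mult_mat_vec_carrier[OF X Suc.prems])
  have step: "seq_of_vec n (?X *\<^sub>v v) = shift n \<mu> (seq_of_vec n v)"
  proof (rule seq_eqI)
    fix i assume i: "i < ?N"
    have "?X *\<^sub>v v = (\<mu> \<cdot>\<^sub>m 1\<^sub>m ?N) *\<^sub>v v - centred_mat n (A n) *\<^sub>v v"
      by (rule minus_mult_distrib_mat_vec[OF _ centred_mat_carrier Suc.prems]) simp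
    moreover have "(\<mu> \<cdot>\<^sub>m 1\<^sub>m ?N) *\<^sub>v v = \<mu> \<cdot>\<^sub>v v"
      using Suc.prems by auto
    ultimately have "vec_index (?X *\<^sub>v v) i = \<mu> * vec_index v i - vec_index (centred_mat n (A n) *\<^sub>v v) i"
      using i Suc.prems by simp
    then show "seq_of_vec n (?X *\<^sub>v v) (centred n i) = shift n \<mu> (seq_of_vec n v) (centred n i)"
      unfolding centred_mat_mult_seq[OF Suc.prems i] seq_of_vec_centred[OF i] shift_def .
  qed (simp add: seq_of_vec_def shift_def kA_support)
  have "(?X ^\<^sub>m Suc \<nu>) *\<^sub>v v = (?X ^\<^sub>m \<nu>) *\<^sub>v (?X *\<^sub>v v)"
    unfolding pow_mat.simps by (rule assoc_mult_mat_vec[OF pow_carrier_mat[OF X] X Suc.prems])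
  then show ?case using Suc.IH[OF Xv] step by (simp add: funpow_swap1)
qed simp

end

lemma exp_rate_bigo:
  fixes f :: "nat \<Rightarrow> real"
  assumes q: "0 < q" "q < 1" and le: "\<forall>\<^sub>F n in sequentially. norm (f n) \<le> K * q ^ n"
  shows "\<exists>a>0. f \<in> O(\<lambda>n. exp (- a * real n))"
proof (intro exI[of _ "- ln q"] conjI)
  show "0 < - ln q" using q by simp
  have "exp (- (- ln q) * real n) = q ^ n" for n
    using q by (simp add: mult.commute[of _ "real n"] exp_of_nat_mult)
  then show "f \<in> O(\<lambda>n. exp (- (- ln q) * real n))"
    using le q by (intro bigoI[of _ K]) (auto elim!: eventually_mono)
qed

theorem theorem2p12:
  fixes \<tau> :: "complex \<Rightarrow> complex" and \<delta> :: real
  assumes "analytic_expanding_circle_map \<tau>"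
    and "\<delta> > 0" and "\<delta> > 1 + max_expansion \<tau>"
  shows "\<exists>r C. 0 < r \<and> r < 1 \<and> is_koopman_operator \<tau> r C \<and> H2_hilbert_schmidt r C \<and>
    (\<forall>(\<alpha>::real) (m::nat \<Rightarrow> nat). (\<forall>n\<ge>1. real (m n) \<ge> \<delta> * real n) \<longrightarrow>
      (\<forall>\<mu> lam. (\<forall>n\<ge>1. \<mu> n \<in> spectrum (circle_edmd \<tau> \<alpha> (m n) n)) \<and> \<mu> \<longlonglongrightarrow> lam
          \<longrightarrow> lam \<in> H2_spectrum r C) \<and>
      (\<forall>lam\<in>H2_spectrum r C. \<exists>\<mu>.
          (\<forall>n\<ge>1. \<mu> n \<in> spectrum (circle_edmd \<tau> \<alpha> (m n) n)) \<and> \<mu> \<longlonglongrightarrow> lam \<and>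
          (\<exists>a>0. (\<lambda>n. cmod (lam - \<mu> n)) \<in> O(\<lambda>n. exp (- a * real n)))) \<and>
      (\<forall>lam\<in>H2_spectrum r C. \<forall>\<mu> \<xi>.
          lam \<noteq> 0 \<and>
          (\<forall>n\<ge>1. \<mu> n \<in> spectrum (circle_edmd \<tau> \<alpha> (m n) n)) \<and> \<mu> \<longlonglongrightarrow> lam \<and>
          (\<exists>a>0. (\<lambda>n. cmod (lam - \<mu> n)) \<in> O(\<lambda>n. exp (- a * real n))) \<and>
          (\<forall>n\<ge>1. generalised_eigenvector (transpose_mat (circle_edmd \<tau> \<alpha> (m n) n)) (\<mu> n) (\<xi> n) \<and>
            (\<Sum>k | \<bar>k\<bar> < int n. (cmod (centred_entry n (\<xi> n) k))\<^sup>2 * r ^ (2 * nat \<bar>k\<bar>)) = 1)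
          \<longrightarrow> (\<exists>b>0. (\<lambda>n. H2_norm r (\<lambda>k.
                riesz_projection r C lam (fourier_coeff (laurent_of_vec n (\<xi> n))) k
                - fourier_coeff (laurent_of_vec n (\<xi> n)) k)) \<in> O(\<lambda>n. exp (- b * real n)))))"
proof -
  obtain r s c where r: "0 < r" "r < 1" and \<delta>2: "2 < \<delta>" and
    fin: "\<And>\<alpha> m. (\<forall>n\<ge>1. real (m n) \<ge> \<delta> * real n) \<Longrightarrow>
      finite_sections r s c (koopman_kernel \<tau>) (\<lambda>n. edmd_kernel \<tau> \<alpha> (m n) n)"
    using koopman_kernel_bounds[OF assms(1,3)] by blast
  let ?C = "kernel_operator (koopman_kernel \<tau>)"
  \<comment> \<open>One admissible choice of nodes, made only to extract the bounds on the Koopman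
    kernel, which do not depend on \<alpha> and m.\<close>
  interpret F: finite_sections r s c "koopman_kernel \<tau>" "\<lambda>n. edmd_kernel \<tau> 0 (nat \<lceil>\<delta> * real n\<rceil>) n"
    using \<delta>2 by (intro fin) auto
  have 1: "is_koopman_operator \<tau> r ?C"
    by (rule koopman_operator_kernel[OF assms(1) r(1) F.s F.c0(1) F.T_bound])
  have 2: "H2_hilbert_schmidt r ?C"
    by (rule kernel_operator_hilbert_schmidt[OF r(1) F.s F.c0(1) F.T_bound])
  show ?thesis
  proof (rule exI[of _ r], rule exI[of _ ?C], intro conjI r 1 2 allI impI ballI)
    fix \<alpha> :: real and m :: "nat \<Rightarrow> nat"
    assume m: "\<forall>n\<ge>1. real (m n) \<ge> \<delta> * real n"
    interpret S: finite_sections r s c "koopman_kernel \<tau>" "\<lambda>n. edmd_kernel \<tau> \<alpha> (m n) n"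
      by (rule fin[OF m])
    have m2: "2 * n \<le> m n" if "1 \<le> n" for n
    proof -
      have "2 * real n \<le> \<delta> * real n" using \<delta>2 by (intro mult_right_mono) auto
      also have "\<dots> \<le> real (m n)" using m that by blast
      finally show ?thesis by linarith
    qed
    have trans: "transpose_mat (circle_edmd \<tau> \<alpha> (m n) n) = centred_mat n (edmd_kernel \<tau> \<alpha> (m n) n)" if "1 \<le> n" for n
      by (rule transpose_circle_edmd[OF m2[OF that] that])
    have spec: "\<mu> \<in> spectrum (circle_edmd \<tau> \<alpha> (m n) n) \<longleftrightarrow> S.is_eigenvalue n \<mu>" if n: "1 \<le> n" for n \<mu>
    proof -
      have M: "circle_edmd \<tau> \<alpha> (m n) n \<in> carrier_mat (2 * n - 1) (2 * n - 1)"
        using trans[OF n] centred_mat_carrier transpose_carrier_mat by metis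
      \<comment> \<open>A matrix and its transpose have the same characteristic polynomial; the
        sections of the kernel are the transposes.\<close>
      have "eigenvalue (circle_edmd \<tau> \<alpha> (m n) n) \<mu> \<longleftrightarrow> eigenvalue (transpose_mat (circle_edmd \<tau> \<alpha> (m n) n)) \<mu>"
        using M by (simp add: eigenvalue_root_char_poly[OF M] eigenvalue_root_char_poly[OF transpose_carrier_mat[THEN iffD2, OF M]])
      then show ?thesis unfolding trans[OF n] S.eigenvalue_iff_is_eigenvalue by (simp add: spectrum_def)
    qed
    {
      fix \<mu> lam
      assume "(\<forall>n\<ge>1. \<mu> n \<in> spectrum (circle_edmd \<tau> \<alpha> (m n) n)) \<and> \<mu> \<longlonglongrightarrow> lam"
      then show "lam \<in> H2_spectrum r ?C"
        using spec by (intro S.eigenvalue_limit_in_spectrum[of \<mu>]) auto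
    next
      fix lam assume lam: "lam \<in> H2_spectrum r ?C"
      obtain K q n0 where q: "0 < K" "0 < q" "q < 1"
        and ev: "\<And>n. n0 \<le> n \<Longrightarrow> \<exists>\<mu>. S.is_eigenvalue n \<mu> \<and> cmod (lam - \<mu>) \<le> K * q ^ n"
        using S.spectrum_approximation[OF lam] by blast
      \<comment> \<open>The approximation starts at n0 only. Below n0 any eigenvalue will do, and
        \<open>small_eigenvalue\<close> is used for its mere existence.\<close>
      have "\<exists>\<mu>. (1 \<le> n \<longrightarrow> S.is_eigenvalue n \<mu>) \<and> (n0 \<le> n \<longrightarrow> cmod (lam - \<mu>) \<le> K * q ^ n)" for n
      proof -
        consider "n0 \<le> n" | "\<not> n0 \<le> n" "1 \<le> n" | "\<not> n0 \<le> n" "\<not> 1 \<le> n" by blast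
        then show ?thesis
        proof cases
          case 1
          then show ?thesis using ev[OF 1] by blast
        next
          case 2
          from S.small_eigenvalue[OF 2(2)] show ?thesis using 2(1) by blast
        qed simp
      qed
      then obtain \<mu> where \<mu>: "\<And>n. 1 \<le> n \<Longrightarrow> S.is_eigenvalue n (\<mu> n)"
        "\<And>n. n0 \<le> n \<Longrightarrow> cmod (lam - \<mu> n) \<le> K * q ^ n" by metis
      have bound: "\<forall>\<^sub>F n in sequentially. norm (lam - \<mu> n) \<le> K * q ^ n"
        using \<mu>(2) by (auto simp: eventually_sequentially)
      have "(\<lambda>n. K * q ^ n) \<longlonglongrightarrow> 0"
        using q by (intro tendsto_mult_right_zero LIMSEQ_realpow_zero) auto
      from tendsto_diff[OF tendsto_const[of lam] Lim_null_comparison[OF bound this]]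
      have "\<mu> \<longlonglongrightarrow> lam" by simp
      moreover have "\<exists>a>0. (\<lambda>n. cmod (lam - \<mu> n)) \<in> O(\<lambda>n. exp (- a * real n))"
        using bound by (intro exp_rate_bigo[OF q(2,3)]) simp
      ultimately show "\<exists>\<mu>. (\<forall>n\<ge>1. \<mu> n \<in> spectrum (circle_edmd \<tau> \<alpha> (m n) n)) \<and> \<mu> \<longlonglongrightarrow> lam \<and>
          (\<exists>a>0. (\<lambda>n. cmod (lam - \<mu> n)) \<in> O(\<lambda>n. exp (- a * real n)))"
        using \<mu>(1) spec by (intro exI[of _ \<mu>]) auto
    next
      fix lam \<mu> \<xi>
      assume lam: "lam \<in> H2_spectrum r ?C"
      assume *: "lam \<noteq> 0 \<and>
          (\<forall>n\<ge>1. \<mu> n \<in> spectrum (circle_edmd \<tau> \<alpha> (m n) n)) \<and> \<mu> \<longlonglongrightarrow> lam \<and>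
          (\<exists>a>0. (\<lambda>n. cmod (lam - \<mu> n)) \<in> O(\<lambda>n. exp (- a * real n))) \<and>
          (\<forall>n\<ge>1. generalised_eigenvector (transpose_mat (circle_edmd \<tau> \<alpha> (m n) n)) (\<mu> n) (\<xi> n) \<and>
            (\<Sum>k | \<bar>k\<bar> < int n. (cmod (centred_entry n (\<xi> n) k))\<^sup>2 * r ^ (2 * nat \<bar>k\<bar>)) = 1)"
      let ?h = "\<lambda>n. seq_of_vec n (\<xi> n)"
      have h1: "H2_norm r (?h n) = 1" if "1 \<le> n" for n
      proof -
        have "H2_norm r (?h n) = sqrt (\<Sum>k | \<bar>k\<bar> < int n. (cmod (?h n k))\<^sup>2 * r ^ (2 * nat \<bar>k\<bar>))"
          by (rule H2_I_finite(2)[OF finite_abs_less]) (simp add: seq_of_vec_def)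
        also have "(\<Sum>k | \<bar>k\<bar> < int n. (cmod (?h n k))\<^sup>2 * r ^ (2 * nat \<bar>k\<bar>))
            = (\<Sum>k | \<bar>k\<bar> < int n. (cmod (centred_entry n (\<xi> n) k))\<^sup>2 * r ^ (2 * nat \<bar>k\<bar>))"
          by (intro sum.cong) (auto simp: seq_of_vec_def)
        also have "\<dots> = 1" using * that by blast
        finally show ?thesis by simp
      qed
      have nil: "\<exists>\<nu>. (S.shift n (\<mu> n) ^^ \<nu>) (?h n) = (\<lambda>_. 0)" if n: "1 \<le> n" for n
      proof -
        have "generalised_eigenvector (centred_mat n (edmd_kernel \<tau> \<alpha> (m n) n)) (\<mu> n) (\<xi> n)"
          using * n unfolding trans[OF n, symmetric] by blast
        then obtain \<nu> where \<nu>: "\<xi> n \<in> carrier_vec (2 * n - 1)"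
          "((\<mu> n \<cdot>\<^sub>m 1\<^sub>m (2 * n - 1) - centred_mat n (edmd_kernel \<tau> \<alpha> (m n) n)) ^\<^sub>m \<nu>) *\<^sub>v \<xi> n = 0\<^sub>v (2 * n - 1)"
          unfolding generalised_eigenvector_def by auto
        have "seq_of_vec n (0\<^sub>v (2 * n - 1)) = (\<lambda>_. 0)"
        proof (rule S.seq_eqI[of n])
          show "seq_of_vec n (0\<^sub>v (2 * n - 1)) (centred n i) = 0" if "i < 2 * n - 1" for i
            unfolding seq_of_vec_centred[OF that] using that by simp
        qed (simp add: seq_of_vec_def)
        then show ?thesis using S.seq_of_vec_pow_shift[OF \<nu>(1), of "\<mu> n" \<nu>] \<nu>(2) by auto
      qed
      have supp: "?h n k = 0" if "\<not> \<bar>k\<bar> < int n" for n k using that by (simp add: seq_of_vec_def)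
      obtain K where "\<forall>\<^sub>F n in sequentially. H2_norm r (\<lambda>k. riesz_projection r ?C lam (?h n) k - ?h n k) \<le> K * s ^ n"
      proof (rule S.riesz_projection_generalised_eigenvectors[of lam \<mu> ?h])
        show "lam \<in> H2_spectrum r ?C" "lam \<noteq> 0" "\<mu> \<longlonglongrightarrow> lam" using lam * by blast+
      qed (use supp h1 nil in blast)+
      then show "\<exists>b>0. (\<lambda>n. H2_norm r (\<lambda>k.
                riesz_projection r ?C lam (fourier_coeff (laurent_of_vec n (\<xi> n))) k
                - fourier_coeff (laurent_of_vec n (\<xi> n)) k)) \<in> O(\<lambda>n. exp (- b * real n))"
        unfolding fourier_coeff_laurent_of_vec
        by (intro exp_rate_bigo[OF F.s]) (simp add: H2_norm_nonneg[OF r(1)])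
    }
  qed
qed

end
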